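(* Let $r\ge 1$ and $n\ge 3$ be integers, let $V=\mathbb{C}^n$, let $A_{r,1,n}$ be the graded Hecke algebra for $G(r,1,n)$ acting on $V$ nonfaithfully through its quotient $\mathfrak S_n$, as defined in the context, and let $H^*_{r,1,n}$ be the algebra defined by generators and relations in the context. Then there is an isomorphism of $\mathbb{C}$-algebras $$A_{r,1,n}\cong H^*_{r,1,n}.$$
   Context: All algebras are associative over $\mathbb{C}$. $G=G(r,1,n)$ is the group of all monomial $n\times n$ complex matrices whose nonzero entries are $r$-th roots of unity. Fix a primitive $r$-th root of unity $\xi$; $\xi_i\in G$ is the diagonal matrix with $i$-th diagonal entry $\xi$ and all other diagonal entries $1$. The symmetric group $\mathfrak S_n$ is the subgroup of permutation matrices ($\sigma$ sends the $i$-th basis vector to the $\sigma(i)$-th); $(1,2,3)$ is a 3-cycle, $s_i=(i,i+1)$. Let $N$ be the normal subgroup of diagonal matrices, so $G/N\cong\mathfrak S_n$. Let $V=\mathbb{C}^n$ with basis $v_1,\dots,v_n$. Define the (nonfaithful) representation $\rho:G\to \mathrm{GL}(V)$ as the quotient map $G\to\mathfrak S_n$ followed by the permutation representation $\sigma(v_i)=v_{\sigma(i)}$. In the definition of $A_{r,1,n}$, $G$ acts on $V$ via $\rho$. The skew group algebra $T(V)\#G$ is $T(V)\otimes\mathbb{C}G$ with product $(a\otimes g)(b\otimes h)=a\,g(b)\otimes gh$; write $\overline g$ for $1\otimes g$, and $a\overline{g}$ for $a\otimes g$. For $g\in G$, $V^g=\{v\in V: g(v)=v\}$. Definition of $A_{r,1,n}$: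 $$A_{r,1,n}=\bigl(T(V)\#G(r,1,n)\bigr)\Big/\Bigl(vw-wv-\sum_{g\in G}a_g(v,w)\overline g \;:\; v,w\in V\Bigr),$$ where $a_g:V\times V\to\mathbb{C}$ are the skew-symmetric bilinear forms given by: $a_g\equiv 0$ if $g$ is not conjugate in $G$ to $(1,2,3)$; $a_{(1,2,3)}(v_1-v_2,v_2-v_3)=1$ and $a_{(1,2,3)}(V^{(1,2,3)},V)=0$; and $a_{h^{-1}(1,2,3)h}(v,w)=a_{(1,2,3)}(h(v),h(w))$ for all $h\in G$, $v,w\in V$. Definition of $H^*_{r,1,n}$: the algebra generated by $v_1,\dots,v_n$ and all $\overline g$ ($g\in G(r,1,n)$) such that $\mathbb{C}G(r,1,n)$ and $S(V)$ (the symmetric algebra) are subalgebras and the following additional relations hold: $$\overline{\xi}_i v_k=v_k\overline{\xi}_i\quad(1\le i,k\le n),$$ $$\overline{s}_iv_k=v_k\overline{s}_i\quad(k\ne i,i+1),$$ $$\overline{s}_iv_{i+1}=v_i\overline{s}_i+\sum_{a=0}^{r-1}(\overline{\xi}_i)^a(\overline{\xi}_{i+1})^{-a}\quad(1\le i\le n-1).$$ (That is, it is generated by these symbols subject to the relations of the group $G(r,1,n)$, commutativity of the $v_k$ among themselves, and the displayed relations.) *)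

theory Defs
  imports
    "HOL-Algebra.QuotRing"
    "HOL-Algebra.Module"
    "HOL-Combinatorics.Cycles"
    "Jordan_Normal_Form.Matrix"
begin

section \<open>Associative algebras over the complex numbers\<close>

text \<open>
  An associative unital complex algebra is a record of type \<open>(complex, 'a) module\<close>: a ring
  together with a scalar multiplication. (The locale \<open>algebra\<close> of \<open>HOL-Algebra\<close> is not
  usable here, since it demands a commutative ring.)
\<close>

definition algebra_iso ::
    "(complex, 'a, 'm) module_scheme \<Rightarrow> (complex, 'b, 'k) module_scheme \<Rightarrow> ('a \<Rightarrow> 'b) set" where
  "algebra_iso A B =
     {f \<in> ring_iso A B. \<forall>c. \<forall>x \<in> carrier A. f (c \<odot>\<^bsub>A\<^esub> x) = c \<odot>\<^bsub>B\<^esub> f x}"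

text \<open>
  Quotient by a two-sided ideal: the ring \<open>A Quot I\<close> with scalars acting by
  \<open>c (I + x) = I + c x\<close>.
\<close>

definition quot_algebra ::
    "(complex, 'a, 'm) module_scheme \<Rightarrow> 'a set \<Rightarrow> (complex, 'a set) module" where
  "quot_algebra A I =
     \<lparr>carrier = carrier (A Quot I), monoid.mult = monoid.mult (A Quot I), one = \<one>\<^bsub>A Quot I\<^esub>,
      zero = \<zero>\<^bsub>A Quot I\<^esub>, add = add (A Quot I),
      smult = (\<lambda>c X. \<Union>x\<in>X. I +>\<^bsub>A\<^esub> (c \<odot>\<^bsub>A\<^esub> x))\<rparr>"

text \<open>
  The free associative algebra on a set \<open>S\<close>: finitely supported functions on the words over
  \<open>S\<close>, with the product that extends concatenation of words.
\<close>

definition free_algebra :: "'s set \<Rightarrow> (complex, 's list \<Rightarrow> complex) module" where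
  "free_algebra S =
     \<lparr>carrier = {f. finite {w. f w \<noteq> 0} \<and> (\<forall>w. f w \<noteq> 0 \<longrightarrow> w \<in> lists S)},
      monoid.mult = (\<lambda>f g w. \<Sum>k\<le>length w. f (take k w) * g (drop k w)),
      one = (\<lambda>w. if w = [] then 1 else 0),
      zero = (\<lambda>w. 0),
      add = (\<lambda>f g w. f w + g w),
      smult = (\<lambda>c f w. c * f w)\<rparr>"

definition free_gen :: "'s \<Rightarrow> 's list \<Rightarrow> complex" where
  "free_gen x = (\<lambda>w. if w = [x] then 1 else 0)"

text \<open>
  The skew group algebra of \<open>G\<close> over an algebra \<open>R\<close> on which \<open>g \<in> G\<close> acts by \<open>act g\<close>. The
  element \<open>\<Sum>g. a\<^sub>g \<otimes> g\<close> of the tensor product of \<open>R\<close> and the group algebra is the finitely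
  supported function \<open>g \<mapsto> a\<^sub>g\<close>; the product is the bilinear extension of
  \<open>(a \<otimes> g) (b \<otimes> h) = a g(b) \<otimes> g h\<close>.
\<close>

definition skew_group_algebra ::
    "(complex, 'a, 'm) module_scheme \<Rightarrow> ('g, 'k) monoid_scheme \<Rightarrow> ('g \<Rightarrow> 'a \<Rightarrow> 'a)
       \<Rightarrow> (complex, 'g \<Rightarrow> 'a) module" where
  "skew_group_algebra R G act =
     \<lparr>carrier = {F. (\<forall>g \<in> carrier G. F g \<in> carrier R) \<and> (\<forall>g. g \<notin> carrier G \<longrightarrow> F g = \<zero>\<^bsub>R\<^esub>) \<and>
                    finite {g. F g \<noteq> \<zero>\<^bsub>R\<^esub>}},
      monoid.mult = (\<lambda>F H x. if x \<in> carrier G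
                then \<Oplus>\<^bsub>R\<^esub>g \<in> {g \<in> carrier G. F g \<noteq> \<zero>\<^bsub>R\<^esub>}.
                       F g \<otimes>\<^bsub>R\<^esub> act g (H (inv\<^bsub>G\<^esub> g \<otimes>\<^bsub>G\<^esub> x))
                else \<zero>\<^bsub>R\<^esub>),
      one = (\<lambda>x. if x = \<one>\<^bsub>G\<^esub> then \<one>\<^bsub>R\<^esub> else \<zero>\<^bsub>R\<^esub>),
      zero = (\<lambda>x. \<zero>\<^bsub>R\<^esub>),
      add = (\<lambda>F H x. F x \<oplus>\<^bsub>R\<^esub> H x),
      smult = (\<lambda>c F x. c \<odot>\<^bsub>R\<^esub> F x)\<rparr>"

definition pure_tensor :: "('a, 'm) ring_scheme \<Rightarrow> 'a \<Rightarrow> 'g \<Rightarrow> 'g \<Rightarrow> 'a" where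
  "pure_tensor R a g = (\<lambda>x. if x = g then a else \<zero>\<^bsub>R\<^esub>)"


section \<open>The group \<open>G(r,1,n)\<close> and its representation on \<open>V\<close>\<close>

text \<open>
  All indices are shifted to start at 0: the basis \<open>v\<^sub>1, \<dots>, v\<^sub>n\<close> of \<open>V = carrier_vec n\<close> is
  \<open>unit_vec n 0, \<dots>, unit_vec n (n - 1)\<close>, and the symmetric group permutes \<open>{0..<n}\<close>.
\<close>

definition monomial_mat :: "nat \<Rightarrow> complex mat \<Rightarrow> bool" where
  "monomial_mat n A \<longleftrightarrow> A \<in> carrier_mat n n \<and>
     (\<forall>i<n. \<exists>!j. j < n \<and> A $$ (i, j) \<noteq> 0) \<and> (\<forall>j<n. \<exists>!i. i < n \<and> A $$ (i, j) \<noteq> 0)"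

definition Grn :: "nat \<Rightarrow> nat \<Rightarrow> complex mat monoid" where
  "Grn r n =
     \<lparr>carrier = {A. monomial_mat n A \<and> (\<forall>i<n. \<forall>j<n. A $$ (i, j) \<noteq> 0 \<longrightarrow> A $$ (i, j) ^ r = 1)},
      monoid.mult = (*), one = 1\<^sub>m n\<rparr>"

definition perm_mat :: "nat \<Rightarrow> (nat \<Rightarrow> nat) \<Rightarrow> complex mat" where
  "perm_mat n \<sigma> = Matrix.mat n n (\<lambda>(i, j). if i = \<sigma> j then 1 else 0)"

text \<open>The quotient map of \<open>G(r,1,n)\<close> by its diagonal matrices, onto the symmetric group.\<close>

definition perm_of :: "nat \<Rightarrow> complex mat \<Rightarrow> nat \<Rightarrow> nat" where
  "perm_of n A j = (THE i. i < n \<and> A $$ (i, j) \<noteq> 0)"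

definition rho :: "nat \<Rightarrow> complex mat \<Rightarrow> complex mat" where
  "rho n A = perm_mat n (perm_of n A)"

definition cyc3 :: "nat \<Rightarrow> complex mat" where
  "cyc3 n = perm_mat n (cycle_of_list [0, 1, 2])"

definition simple_refl :: "nat \<Rightarrow> nat \<Rightarrow> complex mat" where
  "simple_refl n i = perm_mat n (Transposition.transpose i (Suc i))"

definition xi_mat :: "nat \<Rightarrow> complex \<Rightarrow> nat \<Rightarrow> complex mat" where
  "xi_mat n \<xi> i = mat_diag n (\<lambda>j. if j = i then \<xi> else 1)"

definition primitive_root_of_unity :: "nat \<Rightarrow> complex \<Rightarrow> bool" where
  "primitive_root_of_unity r \<xi> \<longleftrightarrow> \<xi> ^ r = 1 \<and> (\<forall>k. 0 < k \<and> k < r \<longrightarrow> \<xi> ^ k \<noteq> 1)"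


section \<open>The graded Hecke algebra \<open>A\<^sub>r\<^sub>,\<^sub>1\<^sub>,\<^sub>n\<close>\<close>

text \<open>
  The tensor algebra of \<open>V\<close>, in coordinates: the word \<open>[i\<^sub>1, \<dots>, i\<^sub>k]\<close> stands for
  the basis element \<open>v\<close>\<open>\<^bsub>i\<^sub>1\<^esub> \<otimes> \<dots> \<otimes> v\<close>\<open>\<^bsub>i\<^sub>k\<^esub>\<close> of the \<open>k\<close>-th tensor power of \<open>V\<close>.
\<close>

definition tensor_algebra :: "nat \<Rightarrow> (complex, nat list \<Rightarrow> complex) module" where
  "tensor_algebra n = free_algebra {..<n}"

definition vec_in_tensor :: "nat \<Rightarrow> complex vec \<Rightarrow> nat list \<Rightarrow> complex" where
  "vec_in_tensor n v = (\<lambda>w. if length w = 1 \<and> hd w < n then v $ hd w else 0)"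

text \<open>
  The diagonal action on tensors, \<open>u\<^sub>1 \<otimes> \<dots> \<otimes> u\<^sub>k \<mapsto> M u\<^sub>1 \<otimes> \<dots> \<otimes> M u\<^sub>k\<close>, of the linear map of \<open>V\<close> with
  matrix \<open>M\<close>.
\<close>

definition tensor_act :: "nat \<Rightarrow> complex mat \<Rightarrow> (nat list \<Rightarrow> complex) \<Rightarrow> nat list \<Rightarrow> complex" where
  "tensor_act n M f = (\<lambda>w. if w \<in> lists {..<n}
     then \<Sum>u \<in> {u \<in> lists {..<n}. length u = length w}.
            (\<Prod>k<length w. M $$ (w ! k, u ! k)) * f u
     else 0)"

definition skew_TV :: "nat \<Rightarrow> nat \<Rightarrow> (complex, complex mat \<Rightarrow> nat list \<Rightarrow> complex) module" where
  "skew_TV r n =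
     skew_group_algebra (tensor_algebra n) (Grn r n) (\<lambda>g. tensor_act n (rho n g))"

definition A_vec :: "nat \<Rightarrow> complex vec \<Rightarrow> complex mat \<Rightarrow> nat list \<Rightarrow> complex" where
  "A_vec n v = pure_tensor (tensor_algebra n) (vec_in_tensor n v) (1\<^sub>m n)"

definition A_bar :: "nat \<Rightarrow> complex mat \<Rightarrow> complex mat \<Rightarrow> nat list \<Rightarrow> complex" where
  "A_bar n g = pure_tensor (tensor_algebra n) \<one>\<^bsub>tensor_algebra n\<^esub> g"

definition skew_bilinear :: "nat \<Rightarrow> (complex vec \<Rightarrow> complex vec \<Rightarrow> complex) \<Rightarrow> bool" where
  "skew_bilinear n b \<longleftrightarrow>
     (\<forall>u \<in> carrier_vec n. \<forall>v \<in> carrier_vec n. \<forall>w \<in> carrier_vec n. \<forall>c.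
        b (u + v) w = b u w + b v w \<and> b (c \<cdot>\<^sub>v u) w = c * b u w \<and>
        b w (u + v) = b w u + b w v \<and> b w (c \<cdot>\<^sub>v u) = c * b w u \<and>
        b u v = - b v u)"

definition fixed_space :: "nat \<Rightarrow> complex mat \<Rightarrow> complex vec set" where
  "fixed_space n g = {v \<in> carrier_vec n. rho n g *\<^sub>v v = v}"

text \<open>
  The defining properties of the family \<open>a\<^sub>g\<close>. They determine \<open>a\<^sub>g(v, w)\<close> for all \<open>g\<close> in the group
  and \<open>v, w\<close> in \<open>V\<close>; existence of such a family is \<open>ex_hecke_forms\<close> below.
\<close>

definition hecke_forms ::
    "nat \<Rightarrow> nat \<Rightarrow> (complex mat \<Rightarrow> complex vec \<Rightarrow> complex vec \<Rightarrow> complex) \<Rightarrow> bool" where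
  "hecke_forms r n a \<longleftrightarrow>
     (let G = Grn r n; c = cyc3 n; V = carrier_vec n in
       (\<forall>g \<in> carrier G. skew_bilinear n (a g)) \<and>
       (\<forall>g \<in> carrier G. (\<nexists>h. h \<in> carrier G \<and> g = inv\<^bsub>G\<^esub> h \<otimes>\<^bsub>G\<^esub> c \<otimes>\<^bsub>G\<^esub> h) \<longrightarrow>
          (\<forall>v \<in> V. \<forall>w \<in> V. a g v w = 0)) \<and>
       a c (unit_vec n 0 - unit_vec n 1) (unit_vec n 1 - unit_vec n 2) = 1 \<and>
       (\<forall>v \<in> fixed_space n c. \<forall>w \<in> V. a c v w = 0) \<and>
       (\<forall>h \<in> carrier G. \<forall>v \<in> V. \<forall>w \<in> V.
          a (inv\<^bsub>G\<^esub> h \<otimes>\<^bsub>G\<^esub> c \<otimes>\<^bsub>G\<^esub> h) v w = a c (rho n h *\<^sub>v v) (rho n h *\<^sub>v w)))"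

definition A_rels ::
    "nat \<Rightarrow> nat \<Rightarrow> (complex mat \<Rightarrow> complex vec \<Rightarrow> complex vec \<Rightarrow> complex)
       \<Rightarrow> (complex mat \<Rightarrow> nat list \<Rightarrow> complex) set" where
  "A_rels r n a = (let S = skew_TV r n in
     {(A_vec n v \<otimes>\<^bsub>S\<^esub> A_vec n w) \<ominus>\<^bsub>S\<^esub> (A_vec n w \<otimes>\<^bsub>S\<^esub> A_vec n v)
        \<ominus>\<^bsub>S\<^esub> (\<Oplus>\<^bsub>S\<^esub>g \<in> carrier (Grn r n). a g v w \<odot>\<^bsub>S\<^esub> A_bar n g)
      | v w. v \<in> carrier_vec n \<and> w \<in> carrier_vec n})"

definition A_algebra ::
    "nat \<Rightarrow> nat \<Rightarrow> (complex mat \<Rightarrow> complex vec \<Rightarrow> complex vec \<Rightarrow> complex)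
       \<Rightarrow> (complex, (complex mat \<Rightarrow> nat list \<Rightarrow> complex) set) module" where
  "A_algebra r n a = quot_algebra (skew_TV r n) (Idl\<^bsub>skew_TV r n\<^esub> (A_rels r n a))"


section \<open>The algebra \<open>H\<^sup>*\<^sub>r\<^sub>,\<^sub>1\<^sub>,\<^sub>n\<close>\<close>

datatype H_gen = VGen nat | GGen "complex mat"

definition H_free :: "nat \<Rightarrow> nat \<Rightarrow> (complex, H_gen list \<Rightarrow> complex) module" where
  "H_free r n = free_algebra (VGen ` {..<n} \<union> GGen ` carrier (Grn r n))"

abbreviation H_v :: "nat \<Rightarrow> H_gen list \<Rightarrow> complex" where
  "H_v k \<equiv> free_gen (VGen k)"

abbreviation H_bar :: "complex mat \<Rightarrow> H_gen list \<Rightarrow> complex" where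
  "H_bar g \<equiv> free_gen (GGen g)"

text \<open>
  Each relation is written as a difference of its two sides. The first two families make
  \<open>g \<mapsto> H_bar g\<close> a group homomorphism, so that a negative power of \<open>H_bar g\<close> is the
  corresponding power of \<open>H_bar (g\<^sup>-\<^sup>1)\<close>.
\<close>

definition H_rels :: "nat \<Rightarrow> nat \<Rightarrow> complex \<Rightarrow> (H_gen list \<Rightarrow> complex) set" where
  "H_rels r n \<xi> = (let F = H_free r n; G = Grn r n; x = xi_mat n \<xi>; s = simple_refl n in
     {H_bar g \<otimes>\<^bsub>F\<^esub> H_bar h \<ominus>\<^bsub>F\<^esub> H_bar (g \<otimes>\<^bsub>G\<^esub> h) | g h. g \<in> carrier G \<and> h \<in> carrier G} \<union>
     {H_bar \<one>\<^bsub>G\<^esub> \<ominus>\<^bsub>F\<^esub> \<one>\<^bsub>F\<^esub>} \<union>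
     {H_v i \<otimes>\<^bsub>F\<^esub> H_v j \<ominus>\<^bsub>F\<^esub> H_v j \<otimes>\<^bsub>F\<^esub> H_v i | i j. i < n \<and> j < n} \<union>
     {H_bar (x i) \<otimes>\<^bsub>F\<^esub> H_v k \<ominus>\<^bsub>F\<^esub> H_v k \<otimes>\<^bsub>F\<^esub> H_bar (x i) | i k. i < n \<and> k < n} \<union>
     {H_bar (s i) \<otimes>\<^bsub>F\<^esub> H_v k \<ominus>\<^bsub>F\<^esub> H_v k \<otimes>\<^bsub>F\<^esub> H_bar (s i)
        | i k. Suc i < n \<and> k < n \<and> k \<noteq> i \<and> k \<noteq> Suc i} \<union>
     {H_bar (s i) \<otimes>\<^bsub>F\<^esub> H_v (Suc i) \<ominus>\<^bsub>F\<^esub>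
        (H_v i \<otimes>\<^bsub>F\<^esub> H_bar (s i) \<oplus>\<^bsub>F\<^esub>
          (\<Oplus>\<^bsub>F\<^esub>a \<in> {..<r}. (H_bar (x i) [^]\<^bsub>F\<^esub> a) \<otimes>\<^bsub>F\<^esub> (H_bar (inv\<^bsub>G\<^esub> (x (Suc i))) [^]\<^bsub>F\<^esub> a)))
        | i. Suc i < n})"

definition H_star :: "nat \<Rightarrow> nat \<Rightarrow> complex \<Rightarrow> (complex, (H_gen list \<Rightarrow> complex) set) module" where
  "H_star r n \<xi> = quot_algebra (H_free r n) (Idl\<^bsub>H_free r n\<^esub> (H_rels r n \<xi>))"


section \<open>Existence of the forms \<open>a\<^sub>g\<close>\<close>

lemma monomial_perm_of:
  assumes "monomial_mat n A" "j < n"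
  shows "perm_of n A j < n" "A $$ (perm_of n A j, j) \<noteq> 0"
    "\<And>i. i < n \<Longrightarrow> A $$ (i, j) \<noteq> 0 \<longleftrightarrow> i = perm_of n A j"
proof -
  have ex: "\<exists>!i. i < n \<and> A $$ (i, j) \<noteq> 0"
    using assms by (simp add: monomial_mat_def)
  from theI'[OF ex] show 1: "perm_of n A j < n" "A $$ (perm_of n A j, j) \<noteq> 0"
    by (simp_all add: perm_of_def)
  show "A $$ (i, j) \<noteq> 0 \<longleftrightarrow> i = perm_of n A j" if "i < n" for i
    using ex 1 that by blast
qed

lemma perm_of_eqI:
  assumes "monomial_mat n A" "j < n" "i < n" "A $$ (i, j) \<noteq> 0"
  shows "perm_of n A j = i"
  using monomial_perm_of(3)[OF assms(1,2,3)] assms(4) by blast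

lemma perm_of_inj:
  assumes "monomial_mat n A" "i < n" "j < n" "perm_of n A i = perm_of n A j"
  shows "i = j"
proof -
  have "\<exists>!j. j < n \<and> A $$ (perm_of n A i, j) \<noteq> 0"
    using assms(1) monomial_perm_of(1)[OF assms(1,2)] by (simp add: monomial_mat_def)
  moreover have "A $$ (perm_of n A i, i) \<noteq> 0" "A $$ (perm_of n A i, j) \<noteq> 0"
    using monomial_perm_of(2)[OF assms(1,2)] monomial_perm_of(2)[OF assms(1,3)] assms(4) by simp_all
  ultimately show ?thesis using assms(2,3) by blast
qed

lemma perm_of_surj:
  assumes "monomial_mat n A" "i < n"
  obtains j where "j < n" "perm_of n A j = i"
proof -
  obtain j where "j < n" "A $$ (i, j) \<noteq> 0"
    using assms ex1_implies_ex[of "\<lambda>j. j < n \<and> A $$ (i, j) \<noteq> 0"] by (auto simp: monomial_mat_def)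
  thus ?thesis using that perm_of_eqI[OF assms(1) _ assms(2)] by blast
qed

lemma monomial_matI:
  assumes A: "A \<in> carrier_mat n n"
    and \<sigma>: "\<And>j. j < n \<Longrightarrow> \<sigma> j < n" and inj: "inj_on \<sigma> {..<n}"
    and nz: "\<And>i j. i < n \<Longrightarrow> j < n \<Longrightarrow> A $$ (i, j) \<noteq> 0 \<longleftrightarrow> i = \<sigma> j"
  shows "monomial_mat n A" "\<And>j. j < n \<Longrightarrow> perm_of n A j = \<sigma> j"
proof -
  have "\<sigma> ` {..<n} = {..<n}"
    by (rule endo_inj_surj) (use \<sigma> inj in auto)
  hence surj: "\<exists>j<n. \<sigma> j = i" if "i < n" for i
    using that by (metis imageE lessThan_iff)
  show M: "monomial_mat n A"
    unfolding monomial_mat_def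
  proof (intro conjI allI impI)
    fix i assume "i < n"
    with surj obtain j where "j < n" "\<sigma> j = i" by blast
    thus "\<exists>!j. j < n \<and> A $$ (i, j) \<noteq> 0"
      using nz inj \<open>i < n\<close> by (intro ex1I[of _ j]) (auto simp: inj_on_def)
  next
    fix j assume "j < n"
    thus "\<exists>!i. i < n \<and> A $$ (i, j) \<noteq> 0"
      using nz \<sigma> by (intro ex1I[of _ "\<sigma> j"]) auto
  qed (fact A)
  show "perm_of n A j = \<sigma> j" if "j < n" for j
    by (rule perm_of_eqI[OF M that]) (use nz \<sigma> that in auto)
qed

lemma monomial_mult_index:
  assumes "A \<in> carrier_mat n n" "monomial_mat n B" "i < n" "j < n"
  shows "(A * B) $$ (i, j) = A $$ (i, perm_of n B j) * B $$ (perm_of n B j, j)"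
proof -
  have B: "B \<in> carrier_mat n n" using assms(2) by (simp add: monomial_mat_def)
  have "(A * B) $$ (i, j) = (\<Sum>k\<in>{0..<n}. A $$ (i, k) * B $$ (k, j))"
    using assms B by (simp add: scalar_prod_def)
  also have "\<dots> = (\<Sum>k\<in>{perm_of n B j}. A $$ (i, k) * B $$ (k, j))"
    using monomial_perm_of[OF assms(2,4)] by (intro sum.mono_neutral_right) auto
  finally show ?thesis by simp
qed

lemma monomial_mult:
  assumes "monomial_mat n A" "monomial_mat n B"
  shows "monomial_mat n (A * B)"
    "\<And>j. j < n \<Longrightarrow> perm_of n (A * B) j = perm_of n A (perm_of n B j)"
proof -
  have c: "A \<in> carrier_mat n n" "B \<in> carrier_mat n n"
    using assms by (simp_all add: monomial_mat_def)
  have 1: "A * B \<in> carrier_mat n n" using c by simp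
  have 2: "inj_on (\<lambda>j. perm_of n A (perm_of n B j)) {..<n}"
    by (intro inj_onI) (metis assms lessThan_iff monomial_perm_of(1) perm_of_inj)
  have 3: "(A * B) $$ (i, j) \<noteq> 0 \<longleftrightarrow> i = perm_of n A (perm_of n B j)" if "i < n" "j < n" for i j
    using monomial_mult_index[OF c(1) assms(2) that] monomial_perm_of[OF assms(2) that(2)]
      monomial_perm_of[OF assms(1)] that by auto
  from monomial_matI[OF 1 _ 2 3] assms monomial_perm_of(1)
  show "monomial_mat n (A * B)"
    "\<And>j. j < n \<Longrightarrow> perm_of n (A * B) j = perm_of n A (perm_of n B j)" by blast+
qed

lemma Grn_simps [simp]:
  "g \<otimes>\<^bsub>Grn r n\<^esub> h = g * h" "\<one>\<^bsub>Grn r n\<^esub> = 1\<^sub>m n"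
  by (simp_all add: Grn_def)

lemma Grn_monomial: "g \<in> carrier (Grn r n) \<Longrightarrow> monomial_mat n g"
  by (simp add: Grn_def)

lemma Grn_carrier_mat: "g \<in> carrier (Grn r n) \<Longrightarrow> g \<in> carrier_mat n n"
  by (simp add: Grn_def monomial_mat_def)

lemma group_Grn: "group (Grn r n)"
proof (rule groupI)
  fix A B assume A: "A \<in> carrier (Grn r n)" and B: "B \<in> carrier (Grn r n)"
  note M = monomial_mult[OF Grn_monomial[OF A] Grn_monomial[OF B]]
  have "(A * B) $$ (i, j) ^ r = 1" if "i < n" "j < n" "(A * B) $$ (i, j) \<noteq> 0" for i j
    using monomial_mult_index[OF Grn_carrier_mat[OF A] Grn_monomial[OF B] that(1,2)]
      that A B monomial_perm_of[OF Grn_monomial[OF B] that(2)]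
    by (auto simp: Grn_def power_mult_distrib)
  with M(1) show "A \<otimes>\<^bsub>Grn r n\<^esub> B \<in> carrier (Grn r n)"
    by (simp add: Grn_def)
next
  have "monomial_mat n (1\<^sub>m n)" by (auto simp: monomial_mat_def split: if_splits)
  thus "\<one>\<^bsub>Grn r n\<^esub> \<in> carrier (Grn r n)" by (auto simp: Grn_def)
next
  fix A B C assume "A \<in> carrier (Grn r n)" "B \<in> carrier (Grn r n)" "C \<in> carrier (Grn r n)"
  thus "A \<otimes>\<^bsub>Grn r n\<^esub> B \<otimes>\<^bsub>Grn r n\<^esub> C = A \<otimes>\<^bsub>Grn r n\<^esub> (B \<otimes>\<^bsub>Grn r n\<^esub> C)"
    by (simp add: assoc_mult_mat[OF Grn_carrier_mat Grn_carrier_mat Grn_carrier_mat])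
next
  fix A assume "A \<in> carrier (Grn r n)"
  thus "\<one>\<^bsub>Grn r n\<^esub> \<otimes>\<^bsub>Grn r n\<^esub> A = A" by (simp add: left_mult_one_mat[OF Grn_carrier_mat])
next
  fix A assume A: "A \<in> carrier (Grn r n)"
  note M = Grn_monomial[OF A]
  define B where "B = Matrix.mat n n (\<lambda>(i, j). inverse (A $$ (j, i)))"
  have Bc: "B \<in> carrier_mat n n" by (simp add: B_def)
  have "j < n \<and> B $$ (i, j) \<noteq> 0 \<longleftrightarrow> j < n \<and> A $$ (j, i) \<noteq> 0"
    "j < n \<and> B $$ (j, i) \<noteq> 0 \<longleftrightarrow> j < n \<and> A $$ (i, j) \<noteq> 0" if "i < n" for i j
    using that by (auto simp: B_def)
  hence "monomial_mat n B" using M Bc by (simp add: monomial_mat_def)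
  moreover have "B $$ (i, j) ^ r = 1" if "i < n" "j < n" "B $$ (i, j) \<noteq> 0" for i j
    using that A by (auto simp: B_def Grn_def power_inverse)
  ultimately have "B \<in> carrier (Grn r n)" by (simp add: Grn_def)
  moreover have "B * A = 1\<^sub>m n"
  proof (rule eq_matI)
    fix i j assume "i < dim_row (1\<^sub>m n)" "j < dim_col (1\<^sub>m n)"
    hence ij: "i < n" "j < n" by auto
    have "(B * A) $$ (i, j) = inverse (A $$ (perm_of n A j, i)) * A $$ (perm_of n A j, j)"
      using monomial_mult_index[OF Bc M ij] monomial_perm_of(1)[OF M ij(2)] ij by (simp add: B_def)
    also have "\<dots> = 1\<^sub>m n $$ (i, j)"
      using ij monomial_perm_of(2)[OF M ij(2)] perm_of_inj[OF M ij]
        monomial_perm_of(3)[OF M ij(1) monomial_perm_of(1)[OF M ij(2)]] by (cases "i = j") auto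
    finally show "(B * A) $$ (i, j) = 1\<^sub>m n $$ (i, j)" .
  qed (use A Bc Grn_carrier_mat in auto)
  ultimately show "\<exists>B\<in>carrier (Grn r n). B \<otimes>\<^bsub>Grn r n\<^esub> A = \<one>\<^bsub>Grn r n\<^esub>" by auto
qed

lemma monomial_perm_mat:
  assumes "\<sigma> permutes {..<n}"
  shows "monomial_mat n (perm_mat n \<sigma>)" "\<And>j. j < n \<Longrightarrow> perm_of n (perm_mat n \<sigma>) j = \<sigma> j"
proof -
  have "\<And>j. j < n \<Longrightarrow> \<sigma> j < n" "inj_on \<sigma> {..<n}"
    using assms permutes_in_image permutes_inj_on by fastforce+
  from monomial_matI[OF _ this, of "perm_mat n \<sigma>"]
  show "monomial_mat n (perm_mat n \<sigma>)" "\<And>j. j < n \<Longrightarrow> perm_of n (perm_mat n \<sigma>) j = \<sigma> j"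
    by (auto simp: perm_mat_def)
qed

lemma perm_mat_in_Grn: "\<sigma> permutes {..<n} \<Longrightarrow> perm_mat n \<sigma> \<in> carrier (Grn r n)"
  using monomial_perm_mat[of \<sigma> n] by (auto simp: Grn_def perm_mat_def)

lemma rho_index:
  assumes "monomial_mat n g" "v \<in> carrier_vec n" "j < n"
  shows "(rho n g *\<^sub>v v) $ perm_of n g j = v $ j"
proof -
  have p: "perm_of n g j < n" using monomial_perm_of(1)[OF assms(1,3)] .
  have "(rho n g *\<^sub>v v) $ perm_of n g j =
      (\<Sum>k\<in>{0..<n}. (if perm_of n g j = perm_of n g k then 1 else 0) * v $ k)"
    using assms p by (simp add: rho_def perm_mat_def scalar_prod_def)
  also have "\<dots> = (\<Sum>k\<in>{j}. v $ k)"
    using assms perm_of_inj[OF assms(1)] by (intro sum.mono_neutral_cong_right) auto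
  finally show ?thesis by simp
qed

lemma rho_mult:
  assumes "monomial_mat n g" "monomial_mat n h" "v \<in> carrier_vec n"
  shows "rho n (g * h) *\<^sub>v v = rho n g *\<^sub>v (rho n h *\<^sub>v v)"
proof (rule eq_vecI)
  have [simp]: "dim_row (rho n k) = n" for k by (simp add: rho_def perm_mat_def)
  show "dim_vec (rho n (g * h) *\<^sub>v v) = dim_vec (rho n g *\<^sub>v (rho n h *\<^sub>v v))" by simp
  fix i assume "i < dim_vec (rho n g *\<^sub>v (rho n h *\<^sub>v v))"
  hence "i < n" by simp
  note M = monomial_mult[OF assms(1,2)]
  obtain j where j: "j < n" "perm_of n (g * h) j = i" using perm_of_surj[OF M(1) \<open>i < n\<close>] .
  have "rho n h *\<^sub>v v \<in> carrier_vec n" by (simp add: carrier_vecI)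
  from rho_index[OF assms(1) this monomial_perm_of(1)[OF assms(2) j(1)]]
  show "(rho n (g * h) *\<^sub>v v) $ i = (rho n g *\<^sub>v (rho n h *\<^sub>v v)) $ i"
    using rho_index[OF M(1) assms(3) j(1)] rho_index[OF assms(2,3) j(1)] M(2)[OF j(1)] j by simp
qed

lemma cyc3_perm:
  fixes n :: nat
  assumes "n \<ge> 3"
  shows "cycle_of_list [0, 1, 2] permutes {..<n}"
    "cycle_of_list [0, 1, 2] 0 = (1::nat)" "cycle_of_list [0, 1, 2] 1 = (2::nat)"
    "cycle_of_list [0, 1, 2] 2 = (0::nat)" "\<And>k::nat. k \<ge> 3 \<Longrightarrow> cycle_of_list [0, 1, 2] k = k"
proof -
  show "cycle_of_list [0, 1, 2] permutes {..<n}"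
    using assms by (auto intro!: permutes_compose permutes_swap_id)
qed (auto simp: transpose_def)

definition cyc3_form :: "complex vec \<Rightarrow> complex vec \<Rightarrow> complex" where
  "cyc3_form v w = (v $ 0 * w $ 1 - v $ 1 * w $ 0 + v $ 1 * w $ 2 - v $ 2 * w $ 1
     + v $ 2 * w $ 0 - v $ 0 * w $ 2) / 3"

lemma cyc3_form_centralizer:
  assumes n: "n \<ge> 3" and m: "monomial_mat n m" and comm: "m * cyc3 n = cyc3 n * m"
    and v: "v \<in> carrier_vec n" and w: "w \<in> carrier_vec n"
  shows "cyc3_form (rho n m *\<^sub>v v) (rho n m *\<^sub>v w) = cyc3_form v w"
proof -
  let ?c = "cycle_of_list [0, 1, 2 :: nat]" and ?s = "perm_of n m"
  note c = cyc3_perm[OF n]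
  note C = monomial_perm_mat[OF c(1), folded cyc3_def]
  have s: "?s (?c j) = ?c (?s j)" if "j < n" for j
    using monomial_mult(2)[OF m C(1) that] monomial_mult(2)[OF C(1) m that] comm
      C(2)[OF that] C(2)[OF monomial_perm_of(1)[OF m that]] by simp
  have s01: "?s 1 = ?c (?s 0)" and s12: "?s 2 = ?c (?s 1)"
    using s[of 0] s[of 1] c n by simp_all
  have "?s 0 \<noteq> ?s 1" using perm_of_inj[OF m, of 0 1] n by auto
  hence "?s 0 < 3" using s01 c(5)[of "?s 0"] by (cases "?s 0 \<ge> 3") auto
  hence "?s 0 = 0 \<or> ?s 0 = 1 \<or> ?s 0 = 2" by auto
  moreover have r: "(rho n m *\<^sub>v u) $ ?s 0 = u $ 0" "(rho n m *\<^sub>v u) $ ?s 1 = u $ 1"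
      "(rho n m *\<^sub>v u) $ ?s 2 = u $ 2" if "u \<in> carrier_vec n" for u
    using rho_index[OF m that] n by simp_all
  ultimately show ?thesis
    using s01 s12 c(2-4) r[OF v] r[OF w]
    by (elim disjE) (simp_all del: cycle_of_list.simps add: cyc3_form_def)
qed

lemma ex_hecke_forms:
  assumes n: "n \<ge> 3"
  shows "\<exists>a. hecke_forms r n a"
proof -
  let ?G = "Grn r n" and ?c = "cyc3 n"
  interpret G: group ?G by (rule group_Grn)
  note c = cyc3_perm[OF n]
  note C = monomial_perm_mat[OF c(1), folded cyc3_def]
  have cG: "?c \<in> carrier ?G" using perm_mat_in_Grn[OF c(1)] by (simp add: cyc3_def)
  define P where "P g h \<longleftrightarrow> h \<in> carrier ?G \<and> g = inv\<^bsub>?G\<^esub> h \<otimes>\<^bsub>?G\<^esub> ?c \<otimes>\<^bsub>?G\<^esub> h" for g h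
  define b where "b h v w = cyc3_form (rho n h *\<^sub>v v) (rho n h *\<^sub>v w)" for h v w
  define a where "a g v w = (if \<exists>h. P g h then b (SOME h. P g h) v w else 0)" for g v w
  have rc [simp]: "rho n h *\<^sub>v v \<in> carrier_vec n" for h and v :: "complex vec"
    by (simp add: rho_def perm_mat_def carrier_vecI)
  have bb: "b h v w = b k v w"
    if P: "P g h" "P g k" and v: "v \<in> carrier_vec n" and w: "w \<in> carrier_vec n" for g h k v w
  proof -
    have h: "h \<in> carrier ?G" and k: "k \<in> carrier ?G" using P by (auto simp: P_def)
    define m where "m = k \<otimes>\<^bsub>?G\<^esub> inv\<^bsub>?G\<^esub> h"
    have mG: "m \<in> carrier ?G" using h k by (simp add: m_def del: Grn_simps)
    have kk: "k = m \<otimes>\<^bsub>?G\<^esub> h" using h k by (simp add: m_def G.m_assoc del: Grn_simps)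
    have eq: "inv\<^bsub>?G\<^esub> h \<otimes>\<^bsub>?G\<^esub> ?c \<otimes>\<^bsub>?G\<^esub> h = inv\<^bsub>?G\<^esub> k \<otimes>\<^bsub>?G\<^esub> ?c \<otimes>\<^bsub>?G\<^esub> k"
      using P by (simp add: P_def)
    have "m \<otimes>\<^bsub>?G\<^esub> ?c = k \<otimes>\<^bsub>?G\<^esub> (inv\<^bsub>?G\<^esub> h \<otimes>\<^bsub>?G\<^esub> ?c \<otimes>\<^bsub>?G\<^esub> h) \<otimes>\<^bsub>?G\<^esub> inv\<^bsub>?G\<^esub> h"
      using h k cG by (simp add: m_def G.m_assoc del: Grn_simps)
    also have "\<dots> = ?c \<otimes>\<^bsub>?G\<^esub> m"
      unfolding eq using h k cG
      by (simp add: m_def G.m_assoc G.inv_solve_left' flip: G.m_assoc[of k "inv\<^bsub>?G\<^esub> k"] del: Grn_simps)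
    finally have "m * ?c = ?c * m" by simp
    from cyc3_form_centralizer[OF n Grn_monomial[OF mG] this, of "rho n h *\<^sub>v v" "rho n h *\<^sub>v w"]
    show ?thesis
      using rho_mult[OF Grn_monomial[OF mG] Grn_monomial[OF h]] v w
      by (simp add: b_def kk)
  qed
  have a_eq: "a g v w = b h v w"
    if "P g h" "v \<in> carrier_vec n" "w \<in> carrier_vec n" for g h v w
    using bb[OF someI[of "P g", OF that(1)] that] that(1) by (auto simp: a_def)
  have P1: "P ?c (1\<^sub>m n)"
    using G.inv_one G.one_closed cG by (auto simp: P_def dest: Grn_carrier_mat)
  have r1: "rho n (1\<^sub>m n) *\<^sub>v v = v" if "v \<in> carrier_vec n" for v
  proof -
    have M: "monomial_mat n (1\<^sub>m n)" using G.one_closed Grn_monomial by fastforce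
    have p: "perm_of n (1\<^sub>m n) j = j" if "j < n" for j
      using perm_of_eqI[OF M that that] that by simp
    show ?thesis
      by (rule eq_vecI) (use rho_index[OF M that] p that in \<open>auto simp: rho_def perm_mat_def\<close>)
  qed
  have a_c: "a ?c v w = cyc3_form v w" if "v \<in> carrier_vec n" "w \<in> carrier_vec n" for v w
    using a_eq[OF P1 that] r1 that by (simp add: b_def)
  have "skew_bilinear n (b h)" for h
  proof -
    have rd: "rho n h \<in> carrier_mat n n" by (simp add: rho_def perm_mat_def)
    have dim: "dim_row (rho n h) = n" by (simp add: rho_def perm_mat_def)
    show ?thesis
      unfolding skew_bilinear_def b_def cyc3_form_def
      using n
      by (simp add: mult_add_distrib_mat_vec[OF rd] mult_mat_vec[OF rd] dim field_simps del: index_mult_mat_vec)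
  qed
  hence "skew_bilinear n (a g)" for g
    by (cases "\<exists>h. P g h") (simp_all only: a_def[abs_def] if_True if_False, auto simp: skew_bilinear_def)
  moreover have "a g v w = 0" if "\<nexists>h. P g h" for g v w
    using that by (simp add: a_def)
  moreover have "a ?c (unit_vec n 0 - unit_vec n 1) (unit_vec n 1 - unit_vec n 2) = 1"
    using n by (simp add: a_c cyc3_form_def)
  moreover have "a ?c v w = 0" if "v \<in> fixed_space n ?c" "w \<in> carrier_vec n" for v w
  proof -
    have v: "v \<in> carrier_vec n" and fx: "rho n ?c *\<^sub>v v = v"
      using that by (auto simp: fixed_space_def)
    have "v $ 1 = v $ 0" "v $ 2 = v $ 1"
      using rho_index[OF C(1) v, of 0] rho_index[OF C(1) v, of 1] C(2)[of 0] C(2)[of 1] c n fx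
      by simp_all
    thus ?thesis using a_c[OF v that(2)] by (simp add: cyc3_form_def)
  qed
  moreover have "a (inv\<^bsub>?G\<^esub> h \<otimes>\<^bsub>?G\<^esub> ?c \<otimes>\<^bsub>?G\<^esub> h) v w = a ?c (rho n h *\<^sub>v v) (rho n h *\<^sub>v w)"
    if "h \<in> carrier ?G" "v \<in> carrier_vec n" "w \<in> carrier_vec n" for h v w
    using a_eq[of _ h v w] a_c that by (simp add: P_def b_def)
  ultimately have "hecke_forms r n a"
    unfolding hecke_forms_def Let_def P_def by blast
  thus ?thesis by blast
qed

end

theory Submission
  imports Defs
begin

text \<open>
  For \<open>i \<noteq> j\<close> let \<open>S\<^sub>i\<^sub>j\<close> be the sum of the reflections \<open>\<xi>\<^sub>i\<^sup>a \<xi>\<^sub>j\<^sup>-\<^sup>a (i j)\<close>, and put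
  \<open>M\<^sub>i = (\<Sum>l>i. S\<^sub>i\<^sub>l - \<Sum>l<i. S\<^sub>i\<^sub>l) / 2\<close>. If \<open>u\<^sub>i = v\<^sub>i + M\<^sub>i\<close> then the relations between the group and the
  \<open>v\<^sub>i\<close> in \<open>H\<^sup>*\<close> say exactly that the group permutes the \<open>u\<^sub>i\<close>, and given this,
  \<open>[v\<^sub>i, v\<^sub>j] = [u\<^sub>i, u\<^sub>j] + [M\<^sub>i, M\<^sub>j]\<close>, because \<open>[M\<^sub>i, u\<^sub>j]\<close> and \<open>[u\<^sub>i, M\<^sub>j]\<close> cancel. Since \<open>S\<^sub>i\<^sub>j S\<^sub>j\<^sub>k\<close> is the
  sum of all conjugates of the three-cycle lying over \<open>i \<mapsto> j \<mapsto> k \<mapsto> i\<close>, the commutator \<open>[M\<^sub>i, M\<^sub>j]\<close> is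
  \<open>- 3/4\<close> times the right-hand side of the relation for \<open>[v\<^sub>i, v\<^sub>j]\<close> in \<open>A\<close>. So rescaling
  \<open>u\<^sub>i\<close> by \<open>2 / sqrt 3\<close> turns the relations of \<open>H\<^sup>*\<close> into those of \<open>A\<close> and conversely, which gives
  mutually inverse homomorphisms; no PBW basis is needed.
\<close>


section \<open>Associative algebras and their homomorphisms\<close>

text \<open>The factor 1/2 and the opposite signs in M_i are forced. Commuting s_i past v_{i+1} has
  to produce one full copy of S_ij with j = i + 1, so the weight of a pair must jump by 1 when two
  neighbours exchange their order. On the other hand, the mixed commutators cancel only if the
  weight is antisymmetric in i and j. One-sided sums of Jucys-Murphy type meet the first condition
  but not the second. The commutator calculation is needed twice, once inside each algebra. It is
  therefore carried out in an arbitrary complex algebra with a homomorphism T from the group, and a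
  homomorphism out of A or H* is encoded as a family of elements satisfying relations with T. The
  shift by M turns one kind of family into the other. Since M is built from group elements alone,
  both resulting homomorphisms carry M to M, and this is why they are inverse to each other.\<close>

locale complex_algebra = ring R for R :: "(complex, 'a, 'm) module_scheme" (structure) +
  assumes smult_closed [simp, intro]: "x \<in> carrier R \<Longrightarrow> c \<odot> x \<in> carrier R"
    and smult_add_left: "x \<in> carrier R \<Longrightarrow> (c + d) \<odot> x = c \<odot> x \<oplus> d \<odot> x"
    and smult_add_right: "x \<in> carrier R \<Longrightarrow> y \<in> carrier R \<Longrightarrow> c \<odot> (x \<oplus> y) = c \<odot> x \<oplus> c \<odot> y"
    and smult_smult: "x \<in> carrier R \<Longrightarrow> c \<odot> (d \<odot> x) = (c * d) \<odot> x"
    and smult_one [simp]: "x \<in> carrier R \<Longrightarrow> 1 \<odot> x = x"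
    and smult_mult_left: "x \<in> carrier R \<Longrightarrow> y \<in> carrier R \<Longrightarrow> (c \<odot> x) \<otimes> y = c \<odot> (x \<otimes> y)"
    and smult_mult_right: "x \<in> carrier R \<Longrightarrow> y \<in> carrier R \<Longrightarrow> x \<otimes> (c \<odot> y) = c \<odot> (x \<otimes> y)"
begin

lemma smult_0_left [simp]:
  assumes "x \<in> carrier R" shows "0 \<odot> x = \<zero>"
proof -
  have "0 \<odot> x \<oplus> 0 \<odot> x = 0 \<odot> x" using smult_add_left[OF assms, of 0 0] by simp
  thus ?thesis using assms add.l_cancel_one by blast
qed

lemma smult_0_right [simp]: "c \<odot> \<zero> = \<zero>"
  using smult_smult[of \<zero> c 0] by simp

lemma smult_uminus_left: 
  assumes "x \<in> carrier R" shows "(- c) \<odot> x = \<ominus> (c \<odot> x)"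
proof -
  have "(- c) \<odot> x \<oplus> c \<odot> x = \<zero>" using smult_add_left[OF assms, of "- c" c] assms by simp
  thus ?thesis using assms minus_equality by auto
qed

lemma smult_minus_1: "x \<in> carrier R \<Longrightarrow> (- 1) \<odot> x = \<ominus> x"
  by (simp add: smult_uminus_left)

lemma smult_uminus_right: "x \<in> carrier R \<Longrightarrow> c \<odot> (\<ominus> x) = \<ominus> (c \<odot> x)"
  by (simp add: smult_smult smult_uminus_left[symmetric] flip: smult_minus_1)

lemma smult_diff_right:
  "x \<in> carrier R \<Longrightarrow> y \<in> carrier R \<Longrightarrow> c \<odot> (x \<ominus> y) = c \<odot> x \<ominus> c \<odot> y"
  by (simp add: a_minus_def smult_add_right smult_uminus_right)

lemma diff_eq_zero_iff:
  assumes "x \<in> carrier R" "y \<in> carrier R"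
  shows "x \<ominus> y = \<zero> \<longleftrightarrow> x = y"
proof
  assume "x \<ominus> y = \<zero>"
  hence "x \<ominus> y \<oplus> y = y" using assms by simp
  thus "x = y" using assms by (simp add: a_minus_def a_assoc l_neg)
qed (use assms in \<open>simp add: a_minus_def r_neg\<close>)

lemma smult_finsum:
  "f \<in> A \<rightarrow> carrier R \<Longrightarrow> c \<odot> (\<Oplus>i\<in>A. f i) = (\<Oplus>i\<in>A. c \<odot> f i)"
proof (induction A rule: infinite_finite_induct)
  case (insert x F)
  hence "f \<in> F \<rightarrow> carrier R" "f x \<in> carrier R" by auto
  with insert show ?case by (simp add: smult_add_right Pi_def)
qed auto

lemma finsum_swap:
  assumes "finite A" "finite B" "\<And>i j. i \<in> A \<Longrightarrow> j \<in> B \<Longrightarrow> f i j \<in> carrier R"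
  shows "(\<Oplus>i\<in>A. \<Oplus>j\<in>B. f i j) = (\<Oplus>j\<in>B. \<Oplus>i\<in>A. f i j)"
  using assms(1,3)
proof (induction A rule: finite_induct)
  case (insert x F)
  hence "(\<Oplus>j\<in>B. f x j) \<oplus> (\<Oplus>j\<in>B. \<Oplus>i\<in>F. f i j) = (\<Oplus>j\<in>B. f x j \<oplus> (\<Oplus>i\<in>F. f i j))"
    by (intro finsum_addf[symmetric]) (auto intro!: finsum_closed)
  also have "\<dots> = (\<Oplus>j\<in>B. \<Oplus>i\<in>insert x F. f i j)"
    using insert by (intro finsum_cong') (auto intro!: finsum_closed simp: Pi_def)
  finally show ?case using insert by (simp add: Pi_def)
qed simp

lemma finsum_delta:
  assumes "finite A" "x \<in> A" "f \<in> A \<rightarrow> carrier R"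
  shows "(\<Oplus>i\<in>A. if i = x then f i else \<zero>) = f x"
proof -
  have "(\<Oplus>i\<in>A. if x = i then f i else \<zero>) = f x"
    using assms by (intro finsum_singleton) auto
  thus ?thesis by (simp add: eq_commute[of x])
qed

lemma finsum_diff:
  assumes "f \<in> A \<rightarrow> carrier R" "g \<in> A \<rightarrow> carrier R"
  shows "(\<Oplus>i\<in>A. f i \<ominus> g i) = (\<Oplus>i\<in>A. f i) \<ominus> (\<Oplus>i\<in>A. g i)"
proof -
  have "(\<Oplus>i\<in>A. f i \<ominus> g i) = (\<Oplus>i\<in>A. f i \<oplus> (-1) \<odot> g i)"
    using assms by (intro finsum_cong') (auto simp: a_minus_def smult_minus_1 Pi_def)
  also have "\<dots> = (\<Oplus>i\<in>A. f i) \<oplus> (\<Oplus>i\<in>A. (-1) \<odot> g i)"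
    using assms by (intro finsum_addf) auto
  also have "(\<Oplus>i\<in>A. (-1) \<odot> g i) = \<ominus> (\<Oplus>i\<in>A. g i)"
    using assms by (simp flip: smult_finsum add: smult_minus_1)
  finally show ?thesis by (simp add: a_minus_def)
qed

end

definition alg_hom ::
    "(complex, 'a, 'm) module_scheme \<Rightarrow> (complex, 'b, 'k) module_scheme \<Rightarrow> ('a \<Rightarrow> 'b) set" where
  "alg_hom A B = {f \<in> Ring.ring_hom A B. \<forall>c. \<forall>x\<in>carrier A. f (c \<odot>\<^bsub>A\<^esub> x) = c \<odot>\<^bsub>B\<^esub> f x}"

lemma alg_hom_closed: "f \<in> alg_hom A B \<Longrightarrow> x \<in> carrier A \<Longrightarrow> f x \<in> carrier B"
  and alg_hom_mult: "f \<in> alg_hom A B \<Longrightarrow> x \<in> carrier A \<Longrightarrow> y \<in> carrier A \<Longrightarrow>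
    f (x \<otimes>\<^bsub>A\<^esub> y) = f x \<otimes>\<^bsub>B\<^esub> f y"
  and alg_hom_add: "f \<in> alg_hom A B \<Longrightarrow> x \<in> carrier A \<Longrightarrow> y \<in> carrier A \<Longrightarrow>
    f (x \<oplus>\<^bsub>A\<^esub> y) = f x \<oplus>\<^bsub>B\<^esub> f y"
  and alg_hom_one: "f \<in> alg_hom A B \<Longrightarrow> f \<one>\<^bsub>A\<^esub> = \<one>\<^bsub>B\<^esub>"
  and alg_hom_smult: "f \<in> alg_hom A B \<Longrightarrow> x \<in> carrier A \<Longrightarrow> f (c \<odot>\<^bsub>A\<^esub> x) = c \<odot>\<^bsub>B\<^esub> f x"
  by (auto simp: alg_hom_def Ring.ring_hom_def)

lemma alg_homI:
  assumes "\<And>x. x \<in> carrier A \<Longrightarrow> f x \<in> carrier B"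
    "\<And>x y. x \<in> carrier A \<Longrightarrow> y \<in> carrier A \<Longrightarrow> f (x \<otimes>\<^bsub>A\<^esub> y) = f x \<otimes>\<^bsub>B\<^esub> f y"
    "\<And>x y. x \<in> carrier A \<Longrightarrow> y \<in> carrier A \<Longrightarrow> f (x \<oplus>\<^bsub>A\<^esub> y) = f x \<oplus>\<^bsub>B\<^esub> f y"
    "f \<one>\<^bsub>A\<^esub> = \<one>\<^bsub>B\<^esub>"
    "\<And>c x. x \<in> carrier A \<Longrightarrow> f (c \<odot>\<^bsub>A\<^esub> x) = c \<odot>\<^bsub>B\<^esub> f x"
  shows "f \<in> alg_hom A B"
  using assms by (auto simp: alg_hom_def Ring.ring_hom_def)

lemma alg_hom_comp:
  "f \<in> alg_hom A B \<Longrightarrow> g \<in> alg_hom B C \<Longrightarrow> (\<lambda>x. g (f x)) \<in> alg_hom A C"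
  by (auto simp: alg_hom_def Ring.ring_hom_def Pi_def)

locale alg_hom_pair = A: complex_algebra A + B: complex_algebra B
  for A :: "(complex, 'a, 'm) module_scheme" (structure)
  and B :: "(complex, 'b, 'k) module_scheme" (structure) +
  fixes f assumes hom: "f \<in> alg_hom A B"
begin

lemmas closed [simp] = alg_hom_closed[OF hom]
  and mult = alg_hom_mult[OF hom] and add = alg_hom_add[OF hom]
  and one = alg_hom_one[OF hom] and smult = alg_hom_smult[OF hom]

lemma zero: "f \<zero>\<^bsub>A\<^esub> = \<zero>\<^bsub>B\<^esub>"
  using smult[of "\<zero>\<^bsub>A\<^esub>" 0] by simp

lemma uminus: "x \<in> carrier A \<Longrightarrow> f (\<ominus>\<^bsub>A\<^esub> x) = \<ominus>\<^bsub>B\<^esub> f x"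
  by (simp flip: A.smult_minus_1 B.smult_minus_1 add: smult)

lemma diff: "x \<in> carrier A \<Longrightarrow> y \<in> carrier A \<Longrightarrow> f (x \<ominus>\<^bsub>A\<^esub> y) = f x \<ominus>\<^bsub>B\<^esub> f y"
  by (simp add: a_minus_def add uminus)

lemma finsum:
  "g \<in> I \<rightarrow> carrier A \<Longrightarrow> f (\<Oplus>\<^bsub>A\<^esub>i\<in>I. g i) = (\<Oplus>\<^bsub>B\<^esub>i\<in>I. f (g i))"
proof (induction I rule: infinite_finite_induct)
  case (insert x F)
  hence "g \<in> F \<rightarrow> carrier A" "g x \<in> carrier A" by auto
  with insert show ?case by (simp add: add Pi_def)
qed (auto simp: zero)

lemma nat_pow: "x \<in> carrier A \<Longrightarrow> f (x [^]\<^bsub>A\<^esub> (k :: nat)) = f x [^]\<^bsub>B\<^esub> k"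
  by (induction k) (auto simp: one mult)

lemma ring_hom_ring: "ring_hom_ring A B f"
  using hom by (intro ring_hom_ringI2 A.ring_axioms B.ring_axioms) (simp add: alg_hom_def)

end

lemma algebra_isoI:
  assumes f: "f \<in> alg_hom A B" and g: "g \<in> alg_hom B A"
    and gf: "\<And>x. x \<in> carrier A \<Longrightarrow> g (f x) = x" and fg: "\<And>y. y \<in> carrier B \<Longrightarrow> f (g y) = y"
  shows "f \<in> algebra_iso A B"
proof -
  have "bij_betw f (carrier A) (carrier B)"
    using alg_hom_closed[OF f] alg_hom_closed[OF g] gf fg by (intro bij_betw_byWitness[of _ g]) auto
  thus ?thesis using f by (auto simp: algebra_iso_def ring_iso_def alg_hom_def)
qed


section \<open>Quotients\<close>

lemma quot_algebra_simps [simp]: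
  "carrier (quot_algebra A I) = carrier (A Quot I)"
  "monoid.mult (quot_algebra A I) = monoid.mult (A Quot I)"
  "one (quot_algebra A I) = one (A Quot I)"
  "zero (quot_algebra A I) = zero (A Quot I)"
  "add (quot_algebra A I) = add (A Quot I)"
  by (simp_all add: quot_algebra_def)

locale algebra_ideal = complex_algebra A + ideal I A
  for A :: "(complex, 'a, 'm) module_scheme" (structure) and I
begin

lemma carrier_quot: "carrier (quot_algebra A I) = (\<lambda>x. I +> x) ` carrier A"
  by (auto simp: FactRing_def A_RCOSETS_def')

lemma mult_quot:
  "x \<in> carrier A \<Longrightarrow> y \<in> carrier A \<Longrightarrow> (I +> x) \<otimes>\<^bsub>quot_algebra A I\<^esub> (I +> y) = I +> (x \<otimes> y)"
  using rcoset_mult_add by (simp add: FactRing_def)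

lemma add_quot:
  "x \<in> carrier A \<Longrightarrow> y \<in> carrier A \<Longrightarrow> (I +> x) \<oplus>\<^bsub>quot_algebra A I\<^esub> (I +> y) = I +> (x \<oplus> y)"
  using a_rcos_sum by (simp add: FactRing_def)

lemma one_quot: "\<one>\<^bsub>quot_algebra A I\<^esub> = I +> \<one>"
  by (simp add: FactRing_def)

text \<open>The action on a coset is defined as a union over its representatives, so it must not
  depend on the representative. An ideal absorbs scalars because c i is the product of c 1 with i;
  hence all cosets in the union agree.\<close>

lemma smult_quot:
  assumes x: "x \<in> carrier A"
  shows "c \<odot>\<^bsub>quot_algebra A I\<^esub> (I +> x) = I +> (c \<odot> x)"
proof -
  have "I +> (c \<odot> y) = I +> (c \<odot> x)" if "y \<in> I +> x" for y
  proof -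
    from that obtain i where i: "i \<in> I" "y = i \<oplus> x" by (auto simp: a_r_coset_def')
    have iA: "i \<in> carrier A" using i by auto
    have "(c \<odot> \<one>) \<otimes> i \<in> I" using i by (intro I_l_closed) auto
    hence "c \<odot> i \<in> I" using iA by (simp add: smult_mult_left)
    hence "c \<odot> y \<in> I +> (c \<odot> x)"
      using i iA x by (auto simp: a_r_coset_def' smult_add_right)
    thus ?thesis using a_repr_independence'[of "c \<odot> y" "c \<odot> x"] x by simp
  qed
  hence "(\<Union>y\<in>I +> x. I +> (c \<odot> y)) = (\<Union>y\<in>I +> x. I +> (c \<odot> x))" by simp
  \<comment> \<open>A union of equal cosets is that coset only over a nonempty index set.\<close>
  moreover have "I +> x \<noteq> {}" using x a_rcos_self by blast
  ultimately show ?thesis by (simp add: quot_algebra_def)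
qed

lemma complex_algebra_quot: "complex_algebra (quot_algebra A I)"
proof -
  interpret Q: ring "A Quot I" by (rule quotient_is_ring)
  have "ring (quot_algebra A I)"
  proof (intro ringI abelian_groupI monoidI, unfold quot_algebra_simps)
    show "\<exists>y\<in>carrier (A Quot I). y \<oplus>\<^bsub>A Quot I\<^esub> x = \<zero>\<^bsub>A Quot I\<^esub>" if "x \<in> carrier (A Quot I)" for x
      using Q.a_inv_closed[OF that] Q.l_neg[OF that] by blast
    show "x \<oplus>\<^bsub>A Quot I\<^esub> y = y \<oplus>\<^bsub>A Quot I\<^esub> x"
      if "x \<in> carrier (A Quot I)" "y \<in> carrier (A Quot I)" for x y
      using that by (rule Q.a_comm)
  qed (auto simp: Q.a_assoc Q.m_assoc Q.l_distr Q.r_distr)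
  thus ?thesis
    by (intro complex_algebra.intro complex_algebra_axioms.intro)
       (auto simp: carrier_quot smult_quot add_quot mult_quot smult_add_left smult_add_right
           smult_smult smult_mult_left smult_mult_right simp del: quot_algebra_simps)
qed

lemma proj_hom: "(\<lambda>x. I +> x) \<in> alg_hom A (quot_algebra A I)"
  by (rule alg_homI) (auto simp: carrier_quot mult_quot add_quot one_quot smult_quot
      simp del: quot_algebra_simps)

end

lemma (in complex_algebra) algebra_ideal_genideal:
  "X \<subseteq> carrier R \<Longrightarrow> algebra_ideal R (Idl X)"
  by (intro algebra_ideal.intro complex_algebra_axioms genideal_ideal)

lemma (in complex_algebra) proj_rel:
  assumes "X \<subseteq> carrier R" "x \<in> X"
  shows "Idl X +> x = \<zero>\<^bsub>quot_algebra R (Idl X)\<^esub>"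
proof -
  interpret algebra_ideal R "Idl X" by (rule algebra_ideal_genideal[OF assms(1)])
  have "x \<in> Idl X" using genideal_self[OF assms(1)] assms(2) by blast
  thus ?thesis by (simp add: FactRing_def a_rcos_const)
qed

text \<open>The kernel of f is an ideal that contains X, hence \<open>Idl X\<close>, so f is
  constant on cosets. This is the last stage in mapping out of either algebra of the
  theorem.\<close>

lemma (in complex_algebra) quot_lift:
  assumes B: "complex_algebra B" and f: "f \<in> alg_hom R B"
    and X: "X \<subseteq> carrier R" and kill: "\<And>x. x \<in> X \<Longrightarrow> f x = \<zero>\<^bsub>B\<^esub>"
  obtains k where "k \<in> alg_hom (quot_algebra R (Idl X)) B"
    "\<And>x. x \<in> carrier R \<Longrightarrow> k (Idl X +> x) = f x"
proof -
  interpret B: complex_algebra B by (rule B)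
  interpret f: alg_hom_pair R B f using f by unfold_locales
  interpret fr: ring_hom_ring R B f by (rule f.ring_hom_ring)
  interpret Q: algebra_ideal R "Idl X" by (rule algebra_ideal_genideal[OF X])
  have "X \<subseteq> a_kernel R B f"
    unfolding a_kernel_def' using X kill by blast
  hence "Idl X \<subseteq> a_kernel R B f" by (rule genideal_minimal[OF fr.kernel_is_ideal])
  hence 0: "f i = \<zero>\<^bsub>B\<^esub>" if "i \<in> Idl X" for i
    unfolding a_kernel_def' using that by blast
  \<comment> \<open>The image of a coset under f is a singleton, so its value can be read off
    without choosing a representative.\<close>
  define k where "k Y = the_elem (f ` Y)" for Y
  have k: "k (Idl X +> x) = f x" if x: "x \<in> carrier R" for x
  proof -
    have "f ` (Idl X +> x) = {f x}"
    proof
      show "f ` (Idl X +> x) \<subseteq> {f x}"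
        using x 0 by (auto simp: a_r_coset_def' f.add)
      show "{f x} \<subseteq> f ` (Idl X +> x)" using Q.a_rcos_self[OF x] by blast
    qed
    thus ?thesis by (simp add: k_def)
  qed
  have "k \<in> alg_hom (quot_algebra R (Idl X)) B"
    by (rule alg_homI) (auto simp: Q.carrier_quot Q.mult_quot Q.add_quot Q.one_quot Q.smult_quot k
        f.mult f.add f.one f.smult simp del: quot_algebra_simps)
  thus ?thesis using k that by blast
qed


section \<open>Free algebras\<close>

definition free_word :: "'s list \<Rightarrow> 's list \<Rightarrow> complex" where
  "free_word u = (\<lambda>w. if w = u then 1 else 0)"

lemma free_gen_eq_word: "free_gen x = free_word [x]"
  by (simp add: free_gen_def free_word_def)

lemma free_algebra_simps:
  "carrier (free_algebra S) = {f. finite {w. f w \<noteq> 0} \<and> (\<forall>w. f w \<noteq> 0 \<longrightarrow> w \<in> lists S)}"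
  "f \<otimes>\<^bsub>free_algebra S\<^esub> g = (\<lambda>w. \<Sum>k\<le>length w. f (take k w) * g (drop k w))"
  "\<one>\<^bsub>free_algebra S\<^esub> = free_word []"
  "\<zero>\<^bsub>free_algebra S\<^esub> = (\<lambda>w. 0)"
  "f \<oplus>\<^bsub>free_algebra S\<^esub> g = (\<lambda>w. f w + g w)"
  "c \<odot>\<^bsub>free_algebra S\<^esub> f = (\<lambda>w. c * f w)"
  by (simp_all add: free_algebra_def free_word_def)

text \<open>Both sides sum over all ways to cut w into three consecutive pieces. On the left the cut
  after the second piece is chosen first; on the right the lengths of the first two pieces are
  chosen in turn. The triangle of pairs (j, m) with j + m at most the length of w links the
  two.\<close>

lemma convolution_assoc:
  fixes f g h :: "'s list \<Rightarrow> complex"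
  shows "(\<Sum>k\<le>length w. (\<Sum>j\<le>length (take k w). f (take j (take k w)) * g (drop j (take k w)))
      * h (drop k w)) =
    (\<Sum>k\<le>length w. f (take k w) *
      (\<Sum>j\<le>length (drop k w). g (take j (drop k w)) * h (drop j (drop k w))))"
proof -
  let ?N = "length w"
  define G where "G j m = f (take j w) * g (take m (drop j w)) * h (drop (j + m) w)" for j m
  have "(\<Sum>k\<le>?N. (\<Sum>j\<le>length (take k w). f (take j (take k w)) * g (drop j (take k w)))
      * h (drop k w)) = (\<Sum>k\<le>?N. \<Sum>j\<le>k. G j (k - j))"
    by (intro sum.cong refl) (simp add: G_def sum_distrib_right drop_take min_absorb1)
  also have "\<dots> = (\<Sum>(j, m)\<in>{(j, m). j + m \<le> ?N}. G j m)"
    by (rule sum.triangle_reindex_eq[symmetric])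
  also have "{(j, m). j + m \<le> ?N} = Sigma {..?N} (\<lambda>j. {..?N - j})" by auto
  also have "(\<Sum>(j, m)\<in>Sigma {..?N} (\<lambda>j. {..?N - j}). G j m) = (\<Sum>j\<le>?N. \<Sum>m\<le>?N - j. G j m)"
    by (rule sum.Sigma[symmetric]) auto
  also have "\<dots> = (\<Sum>k\<le>?N. f (take k w) *
      (\<Sum>j\<le>length (drop k w). g (take j (drop k w)) * h (drop j (drop k w))))"
    by (intro sum.cong refl) (simp add: G_def sum_distrib_left mult.assoc add.commute)
  finally show ?thesis .
qed

text \<open>A word in the support of a product is a concatenation of words from the two supports,
  and there are finitely many of these.\<close>

lemma free_algebra_mult_closed:
  assumes "f \<in> carrier (free_algebra S)" "g \<in> carrier (free_algebra S)"
  shows "f \<otimes>\<^bsub>free_algebra S\<^esub> g \<in> carrier (free_algebra S)"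
proof -
  let ?U = "(\<lambda>(u, v). u @ v) ` ({w. f w \<noteq> 0} \<times> {w. g w \<noteq> 0})"
  have supp: "w \<in> ?U" if nz: "(\<Sum>k\<le>length w. f (take k w) * g (drop k w)) \<noteq> 0" for w
  proof -
    obtain k where "f (take k w) * g (drop k w) \<noteq> 0"
      using sum.not_neutral_contains_not_neutral[OF nz] by blast
    thus ?thesis by (intro image_eqI[of _ _ "(take k w, drop k w)"]) auto
  qed
  have *: "u @ v \<in> lists S" if "f u \<noteq> 0" "g v \<noteq> 0" for u v
    using assms that by (simp add: free_algebra_simps del: in_lists_conv_set)
  have "?U \<subseteq> lists S" by (rule subsetI, elim imageE) (use * in fastforce)
  moreover have "finite ?U" using assms by (simp add: free_algebra_simps)
  ultimately show ?thesis
    unfolding free_algebra_simps using supp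
    by (blast intro: finite_subset)
qed

lemma free_word_closed [simp]: "w \<in> lists S \<Longrightarrow> free_word w \<in> carrier (free_algebra S)"
  by (auto simp: free_algebra_simps free_word_def)

lemma free_word_mult_left:
  "free_word u \<otimes>\<^bsub>free_algebra S\<^esub> f =
    (\<lambda>w. if take (length u) w = u then f (drop (length u) w) else 0)"
proof
  fix w
  have "(free_word u \<otimes>\<^bsub>free_algebra S\<^esub> f) w =
      (\<Sum>k\<in>{..length w}. if k = length u then if take k w = u then f (drop k w) else 0 else 0)"
    unfolding free_algebra_simps by (intro sum.cong) (auto simp: free_word_def)
  also have "\<dots> = (if take (length u) w = u then f (drop (length u) w) else 0)"
    by (auto simp: sum.delta)
  finally show "(free_word u \<otimes>\<^bsub>free_algebra S\<^esub> f) w = \<dots>" .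
qed

lemma free_word_mult:
  "free_word u \<otimes>\<^bsub>free_algebra S\<^esub> free_word v = free_word (u @ v)"
  unfolding free_word_mult_left by (auto simp: free_word_def fun_eq_iff) (metis append_take_drop_id)

lemma mult_free_word_Nil:
  "f \<otimes>\<^bsub>free_algebra S\<^esub> free_word [] = f"
proof
  fix w
  have "(f \<otimes>\<^bsub>free_algebra S\<^esub> free_word []) w = (\<Sum>k\<le>length w. if k = length w then f w else 0)"
    unfolding free_algebra_simps by (intro sum.cong) (auto simp: free_word_def)
  thus "(f \<otimes>\<^bsub>free_algebra S\<^esub> free_word []) w = f w" by simp
qed

lemma complex_algebra_free: "complex_algebra (free_algebra S)"
proof -
  let ?F = "free_algebra S"
  have add: "f \<oplus>\<^bsub>?F\<^esub> g \<in> carrier ?F" if "f \<in> carrier ?F" "g \<in> carrier ?F" for f g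
  proof -
    have "{w. f w + g w \<noteq> 0} \<subseteq> {w. f w \<noteq> 0} \<union> {w. g w \<noteq> 0}" by auto
    hence "finite {w. f w + g w \<noteq> 0}" using that by (auto simp: free_algebra_simps intro: finite_subset)
    moreover have "w \<in> lists S" if "f w + g w \<noteq> 0" for w
      using that \<open>f \<in> carrier ?F\<close> \<open>g \<in> carrier ?F\<close> by (cases "f w = 0") (auto simp: free_algebra_simps)
    ultimately show ?thesis by (simp add: free_algebra_simps)
  qed
  have smult: "c \<odot>\<^bsub>?F\<^esub> f \<in> carrier ?F" if "f \<in> carrier ?F" for c f
    using that by (auto simp: free_algebra_simps)
  have "ring ?F"
  proof (intro ringI abelian_groupI monoidI)
    fix f assume f: "f \<in> carrier ?F"
    show "\<exists>g\<in>carrier ?F. g \<oplus>\<^bsub>?F\<^esub> f = \<zero>\<^bsub>?F\<^esub>"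
      using smult[OF f, of "-1"] by (intro bexI[of _ "\<lambda>w. - f w"]) (auto simp: free_algebra_simps)
    show "\<one>\<^bsub>?F\<^esub> \<otimes>\<^bsub>?F\<^esub> f = f" by (simp add: free_algebra_simps(3) free_word_mult_left)
    show "f \<otimes>\<^bsub>?F\<^esub> \<one>\<^bsub>?F\<^esub> = f" by (simp add: free_algebra_simps(3) mult_free_word_Nil)
  next
    fix f g h assume "f \<in> carrier ?F" "g \<in> carrier ?F" "h \<in> carrier ?F"
    show "f \<otimes>\<^bsub>?F\<^esub> g \<otimes>\<^bsub>?F\<^esub> h = f \<otimes>\<^bsub>?F\<^esub> (g \<otimes>\<^bsub>?F\<^esub> h)"
      unfolding free_algebra_simps by (intro ext convolution_assoc)
    show "f \<otimes>\<^bsub>?F\<^esub> g \<in> carrier ?F" "f \<oplus>\<^bsub>?F\<^esub> g \<in> carrier ?F"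
      by (intro free_algebra_mult_closed add; fact)+
  qed (auto simp: free_algebra_simps algebra_simps sum.distrib free_word_def)
  thus ?thesis
    by (intro complex_algebra.intro complex_algebra_axioms.intro smult)
       (auto simp: free_algebra_simps algebra_simps sum_distrib_left)
qed

text \<open>Induction on the size of the support, one word at a time. The rule reduces identities
  that are linear in f to identities about words.\<close>

lemma free_algebra_induct [consumes 1, case_names zero add]:
  assumes f: "f \<in> carrier (free_algebra S)"
    and 0: "P \<zero>\<^bsub>free_algebra S\<^esub>"
    and step: "\<And>f c w. f \<in> carrier (free_algebra S) \<Longrightarrow> w \<in> lists S \<Longrightarrow> P f \<Longrightarrow>
      P (c \<odot>\<^bsub>free_algebra S\<^esub> free_word w \<oplus>\<^bsub>free_algebra S\<^esub> f)"
  shows "P f"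
proof -
  have "finite {w. f w \<noteq> 0}" using f by (simp add: free_algebra_simps)
  thus ?thesis using f
  proof (induction "{w. f w \<noteq> 0}" arbitrary: f rule: finite_induct)
    case empty
    hence "f = (\<lambda>w. 0)" by auto
    thus ?case using 0 by (simp add: free_algebra_simps)
  next
    case (insert w W)
    \<comment> \<open>Deleting the coefficient of w leaves an element whose support is the smaller
      set \<open>W\<close>.\<close>
    define g where "g = f(w := 0)"
    have supp: "{v. g v \<noteq> 0} = W" using insert.hyps by (auto simp: g_def)
    have "g \<in> carrier (free_algebra S)"
      using insert.prems supp insert.hyps(1) by (auto simp: free_algebra_simps g_def split: if_splits)
    moreover have "w \<in> lists S" using insert by (auto simp: free_algebra_simps)
    ultimately have "P (f w \<odot>\<^bsub>free_algebra S\<^esub> free_word w \<oplus>\<^bsub>free_algebra S\<^esub> g)"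
      using insert.hyps(3)[of g] supp by (intro step) auto
    moreover have "f w \<odot>\<^bsub>free_algebra S\<^esub> free_word w \<oplus>\<^bsub>free_algebra S\<^esub> g = f"
      by (auto simp: free_algebra_simps g_def free_word_def)
    ultimately show ?case by simp
  qed
qed

lemma free_gen_closed [simp]: "x \<in> S \<Longrightarrow> free_gen x \<in> carrier (free_algebra S)"
  by (simp add: free_gen_eq_word)

text \<open>Agreement spreads from generators to words by multiplicativity and from words to all
  elements by linearity.\<close>

lemma alg_hom_free_eqI:
  assumes B: "complex_algebra B"
    and f: "f \<in> alg_hom (free_algebra S) B" and g: "g \<in> alg_hom (free_algebra S) B"
    and gens: "\<And>x. x \<in> S \<Longrightarrow> f (free_gen x) = g (free_gen x)"
    and a: "a \<in> carrier (free_algebra S)"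
  shows "f a = g a"
proof -
  interpret f: alg_hom_pair "free_algebra S" B f
    using B f complex_algebra_free by (auto simp: alg_hom_pair_def alg_hom_pair_axioms_def)
  interpret g: alg_hom_pair "free_algebra S" B g
    using B g complex_algebra_free by (auto simp: alg_hom_pair_def alg_hom_pair_axioms_def)
  have "f (free_word w) = g (free_word w)" if "w \<in> lists S" for w
    using that
  proof (induction w)
    case Nil
    thus ?case using f.one g.one by (simp add: free_algebra_simps(3))
  next
    case (Cons x w)
    have "free_word (x # w) = free_gen x \<otimes>\<^bsub>free_algebra S\<^esub> free_word w"
      by (simp add: free_gen_eq_word free_word_mult)
    thus ?case using Cons gens[of x] by (simp add: f.mult g.mult)
  qed
  from a this show ?thesis
    by (induction a rule: free_algebra_induct) (auto simp: f.zero g.zero f.add g.add f.smult g.smult)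
qed

section \<open>Evaluation of free algebras\<close>

context complex_algebra
begin

definition word_prod :: "('s \<Rightarrow> 'a) \<Rightarrow> 's list \<Rightarrow> 'a" where
  "word_prod e w = foldr (\<lambda>x y. e x \<otimes> y) w \<one>"

lemma word_prod_closed: "e \<in> S \<rightarrow> carrier R \<Longrightarrow> w \<in> lists S \<Longrightarrow> word_prod e w \<in> carrier R"
  by (induction w) (auto simp: word_prod_def)

lemma word_prod_append:
  "e \<in> S \<rightarrow> carrier R \<Longrightarrow> u \<in> lists S \<Longrightarrow> v \<in> lists S \<Longrightarrow>
    word_prod e (u @ v) = word_prod e u \<otimes> word_prod e v"
proof (induction u)
  case (Cons x u)
  thus ?case using word_prod_closed[of e S u] word_prod_closed[of e S v]
    by (auto simp: word_prod_def m_assoc Pi_iff)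
qed (auto simp: word_prod_def dest: word_prod_closed)

definition free_eval :: "('s \<Rightarrow> 'a) \<Rightarrow> ('s list \<Rightarrow> complex) \<Rightarrow> 'a" where
  "free_eval e f = (\<Oplus>w\<in>{w. f w \<noteq> 0}. f w \<odot> word_prod e w)"

text \<open>Zero coefficients contribute nothing, so the range of summation may be enlarged.
  Additivity relies on this, because two elements and their sum have different supports.\<close>

lemma free_eval_superset:
  assumes "e \<in> S \<rightarrow> carrier R" "finite W" "W \<subseteq> lists S" "{w. f w \<noteq> 0} \<subseteq> W"
  shows "free_eval e f = (\<Oplus>w\<in>W. f w \<odot> word_prod e w)"
  unfolding free_eval_def
  using assms word_prod_closed[OF assms(1)]
  by (intro add.finprod_mono_neutral_cong_left) (auto simp: subset_iff)

lemma free_eval_word: "e \<in> S \<rightarrow> carrier R \<Longrightarrow> w \<in> lists S \<Longrightarrow> free_eval e (free_word w) = word_prod e w"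
  using word_prod_closed[of e S w]
  by (subst free_eval_superset[of e S "{w}"]) (auto simp: free_word_def)

lemma free_eval_hom:
  assumes e: "e \<in> S \<rightarrow> carrier R"
  shows "free_eval e \<in> alg_hom (free_algebra S) R"
proof -
  let ?F = "free_algebra S"
  interpret F: complex_algebra ?F by (rule complex_algebra_free)
  note wp = word_prod_closed[OF e]
  have closed: "free_eval e f \<in> carrier R" if "f \<in> carrier ?F" for f
    unfolding free_eval_def using that wp by (intro finsum_closed) (auto simp: free_algebra_simps)
  have smult: "free_eval e (c \<odot>\<^bsub>?F\<^esub> f) = c \<odot> free_eval e f" if f: "f \<in> carrier ?F" for c f
  proof -
    have "free_eval e (c \<odot>\<^bsub>?F\<^esub> f) = (\<Oplus>w\<in>{w. f w \<noteq> 0}. (c * f w) \<odot> word_prod e w)"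
      using f by (subst free_eval_superset[OF e, of "{w. f w \<noteq> 0}"]) (auto simp: free_algebra_simps)
    also have "\<dots> = c \<odot> free_eval e f"
      unfolding free_eval_def using f wp
      by (subst smult_finsum) (auto simp: free_algebra_simps smult_smult intro!: finsum_cong')
    finally show ?thesis .
  qed
  have ev_add: "free_eval e (f \<oplus>\<^bsub>?F\<^esub> g) = free_eval e f \<oplus> free_eval e g"
    if f: "f \<in> carrier ?F" and g: "g \<in> carrier ?F" for f g
  proof -
    let ?W = "{w. f w \<noteq> 0} \<union> {w. g w \<noteq> 0}"
    have W: "finite ?W" "?W \<subseteq> lists S" using f g by (auto simp: free_algebra_simps)
    have "free_eval e (f \<oplus>\<^bsub>?F\<^esub> g) = (\<Oplus>w\<in>?W. (f w + g w) \<odot> word_prod e w)"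
      by (subst free_eval_superset[OF e W]) (auto simp: free_algebra_simps)
    also have "\<dots> = (\<Oplus>w\<in>?W. f w \<odot> word_prod e w \<oplus> g w \<odot> word_prod e w)"
      using W wp by (intro finsum_cong') (auto simp: smult_add_left subset_iff)
    also have "\<dots> = (\<Oplus>w\<in>?W. f w \<odot> word_prod e w) \<oplus> (\<Oplus>w\<in>?W. g w \<odot> word_prod e w)"
      using W wp by (intro finsum_addf Pi_I smult_closed) blast+
    also have "\<dots> = free_eval e f \<oplus> free_eval e g"
      using free_eval_superset[OF e W, of f] free_eval_superset[OF e W, of g] by auto
    finally show ?thesis .
  qed
  have ev_zero: "free_eval e \<zero>\<^bsub>?F\<^esub> = \<zero>" by (simp add: free_eval_def free_algebra_simps)
  \<comment> \<open>Multiplicativity is obtained by linearity in one factor at a time: here the left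
    factor is a word and the right one is arbitrary.\<close>
  have word_mult: "free_eval e (free_word u \<otimes>\<^bsub>?F\<^esub> g) = word_prod e u \<otimes> free_eval e g"
    if u: "u \<in> lists S" and g: "g \<in> carrier ?F" for u g
    using g
  proof (induction g rule: free_algebra_induct)
    case zero
    thus ?case using u wp ev_zero by simp
  next
    case (add g c v)
    have uv: "u @ v \<in> lists S" using u add by auto
    have "free_word u \<otimes>\<^bsub>?F\<^esub> (c \<odot>\<^bsub>?F\<^esub> free_word v \<oplus>\<^bsub>?F\<^esub> g) =
        c \<odot>\<^bsub>?F\<^esub> free_word (u @ v) \<oplus>\<^bsub>?F\<^esub> free_word u \<otimes>\<^bsub>?F\<^esub> g"
      using u add by (simp add: F.r_distr F.smult_mult_right free_word_mult)
    thus ?case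
      using u uv add wp closed
      by (simp add: ev_add
        smult free_eval_word[OF e] word_prod_append[OF e] r_distr smult_mult_right)
  qed
  have mult: "free_eval e (f \<otimes>\<^bsub>?F\<^esub> g) = free_eval e f \<otimes> free_eval e g"
    if f: "f \<in> carrier ?F" and g: "g \<in> carrier ?F" for f g
    using f
  proof (induction f rule: free_algebra_induct)
    case zero
    thus ?case using g closed ev_zero by simp
  next
    case (add f c v)
    thus ?case
      using g wp closed
      by (simp add: ev_add
        smult free_eval_word[OF e] word_mult F.l_distr l_distr F.smult_mult_left smult_mult_left)
  qed
  have "free_eval e \<one>\<^bsub>?F\<^esub> = \<one>"
    using free_eval_word[OF e, of "[]"] by (simp add: free_algebra_simps(3) word_prod_def)
  thus ?thesis using closed mult ev_add smult by (intro alg_homI) auto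
qed

lemma free_eval_gen: "x \<in> S \<Longrightarrow> e \<in> S \<rightarrow> carrier R \<Longrightarrow> free_eval e (free_gen x) = e x"
  using free_eval_word[of e S "[x]"] by (auto simp: free_gen_eq_word word_prod_def Pi_iff)

end


section \<open>Skew group algebras\<close>

text \<open>Left translation permutes the group. This is the substitution x = g k for sums that come
  from convolution products.\<close>

lemma (in complex_algebra) finsum_group_shift:
  assumes "group G" "g \<in> carrier G" "f \<in> carrier G \<rightarrow> carrier R"
  shows "(\<Oplus>x\<in>carrier G. f x) = (\<Oplus>x\<in>carrier G. f (g \<otimes>\<^bsub>G\<^esub> x))"
proof -
  interpret G: group G by fact
  have "(\<Oplus>x\<in>(\<lambda>x. g \<otimes>\<^bsub>G\<^esub> x) ` carrier G. f x) = (\<Oplus>x\<in>carrier G. f (g \<otimes>\<^bsub>G\<^esub> x))"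
    using assms by (intro finsum_reindex G.inj_on_cmult) auto
  thus ?thesis using G.surj_const_mult[OF assms(2)] by simp
qed

lemma skew_group_algebra_simps:
  "\<one>\<^bsub>skew_group_algebra R G act\<^esub> = (\<lambda>x. if x = \<one>\<^bsub>G\<^esub> then \<one>\<^bsub>R\<^esub> else \<zero>\<^bsub>R\<^esub>)"
  "\<zero>\<^bsub>skew_group_algebra R G act\<^esub> = (\<lambda>x. \<zero>\<^bsub>R\<^esub>)"
  "F \<oplus>\<^bsub>skew_group_algebra R G act\<^esub> H = (\<lambda>x. F x \<oplus>\<^bsub>R\<^esub> H x)"
  "c \<odot>\<^bsub>skew_group_algebra R G act\<^esub> F = (\<lambda>x. c \<odot>\<^bsub>R\<^esub> F x)"
  by (simp_all add: skew_group_algebra_def)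

lemma skew_group_algebra_mult:
  "(F \<otimes>\<^bsub>skew_group_algebra R G act\<^esub> H) x = (if x \<in> carrier G
      then \<Oplus>\<^bsub>R\<^esub>g \<in> {g \<in> carrier G. F g \<noteq> \<zero>\<^bsub>R\<^esub>}. F g \<otimes>\<^bsub>R\<^esub> act g (H (inv\<^bsub>G\<^esub> g \<otimes>\<^bsub>G\<^esub> x))
      else \<zero>\<^bsub>R\<^esub>)"
  by (simp add: skew_group_algebra_def)

lemma skew_group_algebra_carrier:
  "F \<in> carrier (skew_group_algebra R G act) \<longleftrightarrow> (\<forall>g \<in> carrier G. F g \<in> carrier R) \<and>
    (\<forall>g. g \<notin> carrier G \<longrightarrow> F g = \<zero>\<^bsub>R\<^esub>) \<and> finite {g. F g \<noteq> \<zero>\<^bsub>R\<^esub>}"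
  by (simp add: skew_group_algebra_def)

locale skew_group_action = complex_algebra R + G: group G
  for R :: "(complex, 'a, 'm) module_scheme" (structure) and G :: "('g, 'k) monoid_scheme" +
  fixes act :: "'g \<Rightarrow> 'a \<Rightarrow> 'a"
  assumes finite_group: "finite (carrier G)"
    and act_hom: "g \<in> carrier G \<Longrightarrow> act g \<in> alg_hom R R"
    and act_one: "x \<in> carrier R \<Longrightarrow> act \<one>\<^bsub>G\<^esub> x = x"
    and act_mult: "g \<in> carrier G \<Longrightarrow> h \<in> carrier G \<Longrightarrow> x \<in> carrier R \<Longrightarrow>
      act (g \<otimes>\<^bsub>G\<^esub> h) x = act g (act h x)"
begin

abbreviation S where "S \<equiv> skew_group_algebra R G act"

lemma skew_carrier:
  "F \<in> carrier S \<longleftrightarrow> (\<forall>g\<in>carrier G. F g \<in> carrier R) \<and> (\<forall>g. g \<notin> carrier G \<longrightarrow> F g = \<zero>)"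
proof -
  have "finite {g. F g \<noteq> \<zero>}" if "\<forall>g. g \<notin> carrier G \<longrightarrow> F g = \<zero>"
    by (rule finite_subset[OF _ finite_group]) (use that in auto)
  thus ?thesis unfolding skew_group_algebra_carrier by blast
qed

lemma skew_apply_closed [simp]: "F \<in> carrier S \<Longrightarrow> F g \<in> carrier R"
  by (cases "g \<in> carrier G") (auto simp: skew_carrier)

lemma act_pair: "g \<in> carrier G \<Longrightarrow> alg_hom_pair R R (act g)"
  using act_hom complex_algebra_axioms by (simp add: alg_hom_pair_def alg_hom_pair_axioms_def)

lemmas act_closed [simp] = alg_hom_pair.closed[OF act_pair]
  and act_zero [simp] = alg_hom_pair.zero[OF act_pair]

lemmas skew_simps = skew_group_algebra_simps[of R G act]

lemma skew_mult_outside: "x \<notin> carrier G \<Longrightarrow> (F \<otimes>\<^bsub>S\<^esub> H) x = \<zero>"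
  unfolding skew_group_algebra_mult by (rule if_not_P)

text \<open>Extending the sum from the support of F to the whole finite group adds only zero terms.
  The range of summation then no longer depends on F, as distributivity and associativity
  require.\<close>

lemma skew_mult:
  assumes F: "F \<in> carrier S" and H: "H \<in> carrier S" and x: "x \<in> carrier G"
  shows "(F \<otimes>\<^bsub>S\<^esub> H) x = (\<Oplus>g\<in>carrier G. F g \<otimes> act g (H (inv\<^bsub>G\<^esub> g \<otimes>\<^bsub>G\<^esub> x)))"
proof -
  have "(F \<otimes>\<^bsub>S\<^esub> H) x = (\<Oplus>g\<in>{g \<in> carrier G. F g \<noteq> \<zero>}. F g \<otimes> act g (H (inv\<^bsub>G\<^esub> g \<otimes>\<^bsub>G\<^esub> x)))"
    unfolding skew_group_algebra_mult using x by (rule if_P)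
  also have "\<dots> = (\<Oplus>g\<in>carrier G. F g \<otimes> act g (H (inv\<^bsub>G\<^esub> g \<otimes>\<^bsub>G\<^esub> x)))"
    using F H finite_group by (intro add.finprod_mono_neutral_cong_left) auto
  finally show ?thesis .
qed

lemma skew_mult_closed: "F \<in> carrier S \<Longrightarrow> H \<in> carrier S \<Longrightarrow> F \<otimes>\<^bsub>S\<^esub> H \<in> carrier S"
  by (subst skew_carrier) (auto simp: skew_mult skew_mult_outside intro!: finsum_closed)

text \<open>Both coefficients at x are sums over factorizations of x into three group elements.
  Exchanging the two summations and putting g = h k for fixed h identifies them. The summands agree
  because each \<open>act h\<close> is multiplicative and the action respects products in the
  group.\<close>

lemma skew_assoc:
  assumes F: "F \<in> carrier S" and H: "H \<in> carrier S" and K: "K \<in> carrier S"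
  shows "F \<otimes>\<^bsub>S\<^esub> H \<otimes>\<^bsub>S\<^esub> K = F \<otimes>\<^bsub>S\<^esub> (H \<otimes>\<^bsub>S\<^esub> K)"
proof
  fix x
  show "(F \<otimes>\<^bsub>S\<^esub> H \<otimes>\<^bsub>S\<^esub> K) x = (F \<otimes>\<^bsub>S\<^esub> (H \<otimes>\<^bsub>S\<^esub> K)) x"
  proof (cases "x \<in> carrier G")
    case x: True
    let ?t = "\<lambda>h g. F h \<otimes> act h (H (inv\<^bsub>G\<^esub> h \<otimes>\<^bsub>G\<^esub> g)) \<otimes> act g (K (inv\<^bsub>G\<^esub> g \<otimes>\<^bsub>G\<^esub> x))"
    have "(F \<otimes>\<^bsub>S\<^esub> H \<otimes>\<^bsub>S\<^esub> K) x = (\<Oplus>g\<in>carrier G. (F \<otimes>\<^bsub>S\<^esub> H) g \<otimes> act g (K (inv\<^bsub>G\<^esub> g \<otimes>\<^bsub>G\<^esub> x)))"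
      by (intro skew_mult skew_mult_closed F H K x)
    also have "\<dots> = (\<Oplus>g\<in>carrier G. \<Oplus>h\<in>carrier G. ?t h g)"
    proof (intro finsum_cong' refl)
      fix g assume g: "g \<in> carrier G"
      show "(F \<otimes>\<^bsub>S\<^esub> H) g \<otimes> act g (K (inv\<^bsub>G\<^esub> g \<otimes>\<^bsub>G\<^esub> x)) = (\<Oplus>h\<in>carrier G. ?t h g)"
        unfolding skew_mult[OF F H g] by (rule finsum_ldistr) (use F H K g finite_group in auto)
    qed (use F H K in \<open>auto intro!: finsum_closed\<close>)
    also have "\<dots> = (\<Oplus>h\<in>carrier G. \<Oplus>g\<in>carrier G. ?t h g)"
      using F H K by (intro finsum_swap finite_group) auto
    also have "\<dots> = (\<Oplus>h\<in>carrier G. F h \<otimes> act h ((H \<otimes>\<^bsub>S\<^esub> K) (inv\<^bsub>G\<^esub> h \<otimes>\<^bsub>G\<^esub> x)))"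
    proof (intro finsum_cong' refl)
      fix h assume h: "h \<in> carrier G"
      let ?y = "inv\<^bsub>G\<^esub> h \<otimes>\<^bsub>G\<^esub> x"
      interpret h: alg_hom_pair R R "act h" by (rule act_pair[OF h])
      have "(\<Oplus>g\<in>carrier G. ?t h g) = (\<Oplus>k\<in>carrier G. ?t h (h \<otimes>\<^bsub>G\<^esub> k))"
        using F H K h by (intro finsum_group_shift) auto
      also have "\<dots> = (\<Oplus>k\<in>carrier G. F h \<otimes> act h (H k \<otimes> act k (K (inv\<^bsub>G\<^esub> k \<otimes>\<^bsub>G\<^esub> ?y))))"
      proof (intro finsum_cong' refl)
        fix k assume k: "k \<in> carrier G"
        have "inv\<^bsub>G\<^esub> h \<otimes>\<^bsub>G\<^esub> (h \<otimes>\<^bsub>G\<^esub> k) = k" 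
          using h k by (simp flip: G.m_assoc)
        moreover have "inv\<^bsub>G\<^esub> (h \<otimes>\<^bsub>G\<^esub> k) \<otimes>\<^bsub>G\<^esub> x = inv\<^bsub>G\<^esub> k \<otimes>\<^bsub>G\<^esub> ?y"
          using h k x by (simp add: G.inv_mult_group G.m_assoc)
        ultimately show "?t h (h \<otimes>\<^bsub>G\<^esub> k) = F h \<otimes> act h (H k \<otimes> act k (K (inv\<^bsub>G\<^esub> k \<otimes>\<^bsub>G\<^esub> ?y)))"
          using h k F H K by (simp add: act_mult h.mult m_assoc)
      qed (use F H K h in auto)
      also have "\<dots> = F h \<otimes> act h (\<Oplus>k\<in>carrier G. H k \<otimes> act k (K (inv\<^bsub>G\<^esub> k \<otimes>\<^bsub>G\<^esub> ?y)))"
        using F H K h finite_group by (subst h.finsum, simp, subst finsum_rdistr) (auto simp: Pi_def)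
      also have "\<dots> = F h \<otimes> act h ((H \<otimes>\<^bsub>S\<^esub> K) ?y)"
        using h x by (simp add: skew_mult[OF H K])
      finally show "(\<Oplus>g\<in>carrier G. ?t h g) = F h \<otimes> act h ((H \<otimes>\<^bsub>S\<^esub> K) ?y)" .
    qed (use F H K skew_mult_closed in auto)
    also have "\<dots> = (F \<otimes>\<^bsub>S\<^esub> (H \<otimes>\<^bsub>S\<^esub> K)) x"
      by (intro skew_mult[symmetric] skew_mult_closed F H K x)
    finally show ?thesis .
  qed (simp add: skew_mult_outside)
qed

lemma pure_tensor_closed [simp]:
  "a \<in> carrier R \<Longrightarrow> g \<in> carrier G \<Longrightarrow> pure_tensor R a g \<in> carrier S"
  by (auto simp: skew_carrier pure_tensor_def)

lemma one_skew: "\<one>\<^bsub>S\<^esub> = pure_tensor R \<one> \<one>\<^bsub>G\<^esub>"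
  by (simp add: skew_simps pure_tensor_def)

lemma pure_tensor_mult_left:
  assumes a: "a \<in> carrier R" and g: "g \<in> carrier G" and H: "H \<in> carrier S" and x: "x \<in> carrier G"
  shows "(pure_tensor R a g \<otimes>\<^bsub>S\<^esub> H) x = a \<otimes> act g (H (inv\<^bsub>G\<^esub> g \<otimes>\<^bsub>G\<^esub> x))"
proof -
  have "(pure_tensor R a g \<otimes>\<^bsub>S\<^esub> H) x =
      (\<Oplus>h\<in>carrier G. if h = g then a \<otimes> act h (H (inv\<^bsub>G\<^esub> h \<otimes>\<^bsub>G\<^esub> x)) else \<zero>)"
    unfolding skew_mult[OF pure_tensor_closed[OF a g] H x]
    using a g H x by (intro finsum_cong') (auto simp: pure_tensor_def)
  also have "\<dots> = a \<otimes> act g (H (inv\<^bsub>G\<^esub> g \<otimes>\<^bsub>G\<^esub> x))"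
    using a g H by (subst finsum_delta[OF finite_group g]) auto
  finally show ?thesis .
qed

lemma pure_tensor_mult:
  assumes a: "a \<in> carrier R" and g: "g \<in> carrier G" and b: "b \<in> carrier R" and h: "h \<in> carrier G"
  shows "pure_tensor R a g \<otimes>\<^bsub>S\<^esub> pure_tensor R b h = pure_tensor R (a \<otimes> act g b) (g \<otimes>\<^bsub>G\<^esub> h)"
proof
  fix x
  show "(pure_tensor R a g \<otimes>\<^bsub>S\<^esub> pure_tensor R b h) x = pure_tensor R (a \<otimes> act g b) (g \<otimes>\<^bsub>G\<^esub> h) x"
  proof (cases "x \<in> carrier G")
    case True
    hence "inv\<^bsub>G\<^esub> g \<otimes>\<^bsub>G\<^esub> x = h \<longleftrightarrow> x = g \<otimes>\<^bsub>G\<^esub> h"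
      using g h by (metis G.inv_solve_left)
    with True show ?thesis
      using assms by (simp add: pure_tensor_mult_left) (simp add: pure_tensor_def)
  next
    case False
    thus ?thesis using assms by (auto simp: skew_mult_outside pure_tensor_def)
  qed
qed

lemma complex_algebra_skew: "complex_algebra S"
proof -
  have neg: "\<exists>H\<in>carrier S. H \<oplus>\<^bsub>S\<^esub> F = \<zero>\<^bsub>S\<^esub>" if F: "F \<in> carrier S" for F
    using F by (intro bexI[of _ "\<lambda>x. \<ominus> F x"]) (auto simp: skew_simps l_neg skew_carrier)
  have add: "F \<oplus>\<^bsub>S\<^esub> H \<in> carrier S" if "F \<in> carrier S" "H \<in> carrier S" for F H
    using that by (auto simp: skew_simps skew_carrier)
  have distr: "(F \<oplus>\<^bsub>S\<^esub> H) \<otimes>\<^bsub>S\<^esub> K = F \<otimes>\<^bsub>S\<^esub> K \<oplus>\<^bsub>S\<^esub> H \<otimes>\<^bsub>S\<^esub> K"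
      "K \<otimes>\<^bsub>S\<^esub> (F \<oplus>\<^bsub>S\<^esub> H) = K \<otimes>\<^bsub>S\<^esub> F \<oplus>\<^bsub>S\<^esub> K \<otimes>\<^bsub>S\<^esub> H"
    if F: "F \<in> carrier S" and H: "H \<in> carrier S" and K: "K \<in> carrier S" for F H K
  proof -
    have "((F \<oplus>\<^bsub>S\<^esub> H) \<otimes>\<^bsub>S\<^esub> K) x = (F \<otimes>\<^bsub>S\<^esub> K) x \<oplus> (H \<otimes>\<^bsub>S\<^esub> K) x" if x: "x \<in> carrier G" for x
    proof -
      have "((F \<oplus>\<^bsub>S\<^esub> H) \<otimes>\<^bsub>S\<^esub> K) x = (\<Oplus>g\<in>carrier G. F g \<otimes> act g (K (inv\<^bsub>G\<^esub> g \<otimes>\<^bsub>G\<^esub> x))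
          \<oplus> H g \<otimes> act g (K (inv\<^bsub>G\<^esub> g \<otimes>\<^bsub>G\<^esub> x)))"
        unfolding skew_mult[OF add[OF F H] K x]
        using F H K x by (intro finsum_cong') (auto simp: skew_simps l_distr)
      also have "\<dots> = (F \<otimes>\<^bsub>S\<^esub> K) x \<oplus> (H \<otimes>\<^bsub>S\<^esub> K) x"
        unfolding skew_mult[OF F K x] skew_mult[OF H K x]
        using F H K x by (intro finsum_addf) auto
      finally show ?thesis .
    qed
    thus "(F \<oplus>\<^bsub>S\<^esub> H) \<otimes>\<^bsub>S\<^esub> K = F \<otimes>\<^bsub>S\<^esub> K \<oplus>\<^bsub>S\<^esub> H \<otimes>\<^bsub>S\<^esub> K"
      unfolding skew_simps(3)[of "F \<otimes>\<^bsub>S\<^esub> K"] fun_eq_iff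
      by (metis l_zero skew_mult_outside zero_closed)
    have "(K \<otimes>\<^bsub>S\<^esub> (F \<oplus>\<^bsub>S\<^esub> H)) x = (K \<otimes>\<^bsub>S\<^esub> F) x \<oplus> (K \<otimes>\<^bsub>S\<^esub> H) x" if x: "x \<in> carrier G" for x
    proof -
      have "(K \<otimes>\<^bsub>S\<^esub> (F \<oplus>\<^bsub>S\<^esub> H)) x = (\<Oplus>g\<in>carrier G. K g \<otimes> act g (F (inv\<^bsub>G\<^esub> g \<otimes>\<^bsub>G\<^esub> x))
          \<oplus> K g \<otimes> act g (H (inv\<^bsub>G\<^esub> g \<otimes>\<^bsub>G\<^esub> x)))"
        unfolding skew_mult[OF K add[OF F H] x]
        using F H K x
        by (intro finsum_cong') (auto simp: skew_simps r_distr alg_hom_add[OF act_hom])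
      also have "\<dots> = (K \<otimes>\<^bsub>S\<^esub> F) x \<oplus> (K \<otimes>\<^bsub>S\<^esub> H) x"
        unfolding skew_mult[OF K F x] skew_mult[OF K H x]
        using F H K x by (intro finsum_addf) auto
      finally show ?thesis .
    qed
    thus "K \<otimes>\<^bsub>S\<^esub> (F \<oplus>\<^bsub>S\<^esub> H) = K \<otimes>\<^bsub>S\<^esub> F \<oplus>\<^bsub>S\<^esub> K \<otimes>\<^bsub>S\<^esub> H"
      unfolding skew_simps(3)[of "K \<otimes>\<^bsub>S\<^esub> F"] fun_eq_iff
      by (metis l_zero skew_mult_outside zero_closed)
  qed
  have one: "\<one>\<^bsub>S\<^esub> \<otimes>\<^bsub>S\<^esub> F = F" "F \<otimes>\<^bsub>S\<^esub> \<one>\<^bsub>S\<^esub> = F" if F: "F \<in> carrier S" for F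
  proof -
    show "\<one>\<^bsub>S\<^esub> \<otimes>\<^bsub>S\<^esub> F = F"
    proof
      fix x show "(\<one>\<^bsub>S\<^esub> \<otimes>\<^bsub>S\<^esub> F) x = F x"
        using F by (cases "x \<in> carrier G")
          (simp_all add: one_skew pure_tensor_mult_left act_one, simp add: skew_mult_outside skew_carrier)
    qed
    show "F \<otimes>\<^bsub>S\<^esub> \<one>\<^bsub>S\<^esub> = F"
    proof
      fix x show "(F \<otimes>\<^bsub>S\<^esub> \<one>\<^bsub>S\<^esub>) x = F x"
      proof (cases "x \<in> carrier G")
        case x: True
        have 1: "\<one>\<^bsub>S\<^esub> \<in> carrier S" by (simp add: one_skew)
        have "(F \<otimes>\<^bsub>S\<^esub> \<one>\<^bsub>S\<^esub>) x = (\<Oplus>g\<in>carrier G. if g = x then F g else \<zero>)"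
          unfolding skew_mult[OF F 1 x]
        proof (intro finsum_cong' refl)
          fix g assume g: "g \<in> carrier G"
          have "inv\<^bsub>G\<^esub> g \<otimes>\<^bsub>G\<^esub> x = \<one>\<^bsub>G\<^esub> \<longleftrightarrow> g = x"
            using g x G.inv_solve_left'[of "\<one>\<^bsub>G\<^esub>" g x] by auto
          thus "F g \<otimes> act g (\<one>\<^bsub>S\<^esub> (inv\<^bsub>G\<^esub> g \<otimes>\<^bsub>G\<^esub> x)) = (if g = x then F g else \<zero>)"
            using F g alg_hom_one[OF act_hom[OF g]] by (cases "g = x") (auto simp: skew_simps)
        qed (use F in auto)
        also have "\<dots> = F x" using F x finite_group by (subst finsum_delta) auto
        finally show ?thesis .
      qed (use F in \<open>simp add: skew_mult_outside skew_carrier\<close>)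
    qed
  qed
  have smult: "c \<odot>\<^bsub>S\<^esub> F \<in> carrier S" if "F \<in> carrier S" for c F
    using that by (auto simp: skew_simps skew_carrier)
  have smult_mult: "(c \<odot>\<^bsub>S\<^esub> F) \<otimes>\<^bsub>S\<^esub> H = c \<odot>\<^bsub>S\<^esub> (F \<otimes>\<^bsub>S\<^esub> H)"
      "F \<otimes>\<^bsub>S\<^esub> (c \<odot>\<^bsub>S\<^esub> H) = c \<odot>\<^bsub>S\<^esub> (F \<otimes>\<^bsub>S\<^esub> H)"
    if F: "F \<in> carrier S" and H: "H \<in> carrier S" for c F H
  proof -
    have *: "((c \<odot>\<^bsub>S\<^esub> F) \<otimes>\<^bsub>S\<^esub> H) x = c \<odot> (F \<otimes>\<^bsub>S\<^esub> H) x \<and>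
        (F \<otimes>\<^bsub>S\<^esub> (c \<odot>\<^bsub>S\<^esub> H)) x = c \<odot> (F \<otimes>\<^bsub>S\<^esub> H) x" if x: "x \<in> carrier G" for x
      unfolding skew_mult[OF F H x] skew_mult[OF smult[OF F] H x] skew_mult[OF F smult[OF H] x]
      using F H by (subst (1 2) smult_finsum)
        (auto simp: skew_simps smult_mult_left smult_mult_right alg_hom_smult[OF act_hom]
          intro!: finsum_cong')
    show "(c \<odot>\<^bsub>S\<^esub> F) \<otimes>\<^bsub>S\<^esub> H = c \<odot>\<^bsub>S\<^esub> (F \<otimes>\<^bsub>S\<^esub> H)"
      "F \<otimes>\<^bsub>S\<^esub> (c \<odot>\<^bsub>S\<^esub> H) = c \<odot>\<^bsub>S\<^esub> (F \<otimes>\<^bsub>S\<^esub> H)"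
      unfolding skew_simps(4)[of c "F \<otimes>\<^bsub>S\<^esub> H"] fun_eq_iff
      using * by (metis smult_0_right skew_mult_outside)+
  qed
  have "abelian_group S"
  proof (rule abelian_groupI)
    show "\<zero>\<^bsub>S\<^esub> \<in> carrier S" by (simp add: skew_carrier skew_simps)
    show "\<exists>H\<in>carrier S. H \<oplus>\<^bsub>S\<^esub> F = \<zero>\<^bsub>S\<^esub>" if "F \<in> carrier S" for F using that by (rule neg)
    show "F \<oplus>\<^bsub>S\<^esub> H \<in> carrier S" if "F \<in> carrier S" "H \<in> carrier S" for F H
      using that by (rule add)
    show "F \<oplus>\<^bsub>S\<^esub> H = H \<oplus>\<^bsub>S\<^esub> F" if "F \<in> carrier S" "H \<in> carrier S" for F H
      using that by (simp add: skew_simps a_comm)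
  qed (simp_all add: skew_simps a_assoc)
  moreover have "Group.monoid S"
  proof (rule monoidI)
    show "\<one>\<^bsub>S\<^esub> \<in> carrier S" by (simp add: one_skew)
  qed (fact one skew_assoc skew_mult_closed)+
  ultimately have ring: "ring S" by (intro ringI distr)
  show ?thesis
    by (intro complex_algebra.intro ring complex_algebra_axioms.intro smult smult_mult)
       (auto simp: skew_simps smult_add_left smult_add_right smult_smult)
qed

sublocale S: complex_algebra S by (rule complex_algebra_skew)

section \<open>Generators and universal property of skew group algebras\<close>

lemma finsum_skew_apply:
  "F \<in> I \<rightarrow> carrier S \<Longrightarrow> (\<Oplus>\<^bsub>S\<^esub>i\<in>I. F i) x = (\<Oplus>i\<in>I. F i x)"
proof (induction I rule: infinite_finite_induct)
  case (insert i I)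
  hence "F \<in> I \<rightarrow> carrier S" "F i \<in> carrier S" by auto
  with insert show ?case by (simp add: skew_simps Pi_def)
qed (auto simp: skew_simps)

text \<open>Each element is a sum of products of a coefficient with a group element, so that R and
  the group together generate the algebra.\<close>

lemma skew_decomp:
  assumes F: "F \<in> carrier S"
  shows "F = (\<Oplus>\<^bsub>S\<^esub>g\<in>carrier G. pure_tensor R (F g) \<one>\<^bsub>G\<^esub> \<otimes>\<^bsub>S\<^esub> pure_tensor R \<one> g)"
proof
  fix x
  have "(\<Oplus>\<^bsub>S\<^esub>g\<in>carrier G. pure_tensor R (F g) \<one>\<^bsub>G\<^esub> \<otimes>\<^bsub>S\<^esub> pure_tensor R \<one> g) x =
      (\<Oplus>g\<in>carrier G. (pure_tensor R (F g) \<one>\<^bsub>G\<^esub> \<otimes>\<^bsub>S\<^esub> pure_tensor R \<one> g) x)"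
    using F by (intro finsum_skew_apply) (auto simp: S.m_closed)
  also have "\<dots> = (\<Oplus>g\<in>carrier G. if g = x then F g else \<zero>)"
    using F by (intro finsum_cong') (auto simp: pure_tensor_mult act_one, auto simp: pure_tensor_def)
  also have "\<dots> = F x"
  proof (cases "x \<in> carrier G")
    case True
    thus ?thesis using F finite_group by (subst finsum_delta) auto
  next
    case False
    hence "(\<Oplus>g\<in>carrier G. if g = x then F g else \<zero>) = (\<Oplus>g\<in>carrier G. \<zero>)"
      by (intro finsum_cong') auto
    thus ?thesis using F False by (simp add: skew_carrier)
  qed
  finally show "F x = (\<Oplus>\<^bsub>S\<^esub>g\<in>carrier G. pure_tensor R (F g) \<one>\<^bsub>G\<^esub> \<otimes>\<^bsub>S\<^esub> pure_tensor R \<one> g) x" ..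
qed

lemma inject_hom: "(\<lambda>a. pure_tensor R a \<one>\<^bsub>G\<^esub>) \<in> alg_hom R S"
  by (intro alg_homI) (auto simp: pure_tensor_mult act_one one_skew, auto simp: skew_simps pure_tensor_def)

lemma alg_hom_skew_eqI:
  assumes B: "complex_algebra B" and f: "f \<in> alg_hom S B" and g: "g \<in> alg_hom S B"
    and R: "\<And>a. a \<in> carrier R \<Longrightarrow> f (pure_tensor R a \<one>\<^bsub>G\<^esub>) = g (pure_tensor R a \<one>\<^bsub>G\<^esub>)"
    and G: "\<And>x. x \<in> carrier G \<Longrightarrow> f (pure_tensor R \<one> x) = g (pure_tensor R \<one> x)"
    and F: "F \<in> carrier S"
  shows "f F = g F"
proof -
  interpret B: complex_algebra B by (rule B)
  interpret f: alg_hom_pair S B f using f by unfold_locales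
  interpret g: alg_hom_pair S B g using g by unfold_locales
  let ?t = "\<lambda>x. pure_tensor R (F x) \<one>\<^bsub>G\<^esub> \<otimes>\<^bsub>S\<^esub> pure_tensor R \<one> x"
  have t: "?t \<in> carrier G \<rightarrow> carrier S" using F by (auto intro: S.m_closed)
  have "f (\<Oplus>\<^bsub>S\<^esub>x\<in>carrier G. ?t x) = g (\<Oplus>\<^bsub>S\<^esub>x\<in>carrier G. ?t x)"
    unfolding f.finsum[OF t] g.finsum[OF t]
    using F R G t by (intro B.finsum_cong') (auto simp: f.mult g.mult Pi_iff)
  thus ?thesis using skew_decomp[OF F] by simp
qed

text \<open>A covariant pair, namely a homomorphism on coefficients and one on the group linked by
  \<open>T_act\<close>, extends by linearity. Covariance is what moves T g past the coefficients of
  the right factor when two images are multiplied.\<close>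

lemma skew_lift:
  assumes B: "complex_algebra B" and \<phi>: "\<phi> \<in> alg_hom R B"
    and T: "\<And>g. g \<in> carrier G \<Longrightarrow> T g \<in> carrier B"
    and T_one: "T \<one>\<^bsub>G\<^esub> = \<one>\<^bsub>B\<^esub>"
    and T_mult: "\<And>g h. g \<in> carrier G \<Longrightarrow> h \<in> carrier G \<Longrightarrow> T (g \<otimes>\<^bsub>G\<^esub> h) = T g \<otimes>\<^bsub>B\<^esub> T h"
    and T_act: "\<And>g a. g \<in> carrier G \<Longrightarrow> a \<in> carrier R \<Longrightarrow>
      T g \<otimes>\<^bsub>B\<^esub> \<phi> a = \<phi> (act g a) \<otimes>\<^bsub>B\<^esub> T g"
  obtains \<Psi> where "\<Psi> \<in> alg_hom S B"
    "\<And>a g. a \<in> carrier R \<Longrightarrow> g \<in> carrier G \<Longrightarrow> \<Psi> (pure_tensor R a g) = \<phi> a \<otimes>\<^bsub>B\<^esub> T g"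
proof -
  interpret B: complex_algebra B by (rule B)
  interpret \<phi>: alg_hom_pair R B \<phi> using \<phi> by unfold_locales
  define \<Psi> where "\<Psi> F = (\<Oplus>\<^bsub>B\<^esub>g\<in>carrier G. \<phi> (F g) \<otimes>\<^bsub>B\<^esub> T g)" for F
  have pure: "\<Psi> (pure_tensor R a g) = \<phi> a \<otimes>\<^bsub>B\<^esub> T g" if "a \<in> carrier R" "g \<in> carrier G" for a g
  proof -
    have "\<Psi> (pure_tensor R a g) =
        (\<Oplus>\<^bsub>B\<^esub>h\<in>carrier G. if h = g then \<phi> a \<otimes>\<^bsub>B\<^esub> T h else \<zero>\<^bsub>B\<^esub>)"
      unfolding \<Psi>_def using that T by (intro B.finsum_cong') (auto simp: pure_tensor_def \<phi>.zero)
    thus ?thesis using that T finite_group by (subst (asm) B.finsum_delta) auto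
  qed
  have mult: "\<Psi> (F \<otimes>\<^bsub>S\<^esub> H) = \<Psi> F \<otimes>\<^bsub>B\<^esub> \<Psi> H" if F: "F \<in> carrier S" and H: "H \<in> carrier S" for F H
  proof -
    let ?t = "\<lambda>g x. \<phi> (F g) \<otimes>\<^bsub>B\<^esub> \<phi> (act g (H (inv\<^bsub>G\<^esub> g \<otimes>\<^bsub>G\<^esub> x))) \<otimes>\<^bsub>B\<^esub> T x"
    have "\<Psi> (F \<otimes>\<^bsub>S\<^esub> H) = (\<Oplus>\<^bsub>B\<^esub>x\<in>carrier G. \<Oplus>\<^bsub>B\<^esub>g\<in>carrier G. ?t g x)"
      unfolding \<Psi>_def
    proof (intro B.finsum_cong' refl)
      fix x assume x: "x \<in> carrier G"
      have "\<phi> ((F \<otimes>\<^bsub>S\<^esub> H) x) =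
          (\<Oplus>\<^bsub>B\<^esub>g\<in>carrier G. \<phi> (F g) \<otimes>\<^bsub>B\<^esub> \<phi> (act g (H (inv\<^bsub>G\<^esub> g \<otimes>\<^bsub>G\<^esub> x))))"
        unfolding skew_mult[OF F H x] using F H
        by (subst \<phi>.finsum) (auto simp: \<phi>.mult intro!: B.finsum_cong')
      thus "\<phi> ((F \<otimes>\<^bsub>S\<^esub> H) x) \<otimes>\<^bsub>B\<^esub> T x = (\<Oplus>\<^bsub>B\<^esub>g\<in>carrier G. ?t g x)"
        using F H x T finite_group by (simp, subst B.finsum_ldistr) auto
    qed (use F H T in \<open>auto intro!: B.finsum_closed\<close>)
    also have "\<dots> = (\<Oplus>\<^bsub>B\<^esub>g\<in>carrier G. \<Oplus>\<^bsub>B\<^esub>x\<in>carrier G. ?t g x)"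
      using F H T by (intro B.finsum_swap finite_group) auto
    also have "\<dots> = (\<Oplus>\<^bsub>B\<^esub>g\<in>carrier G. (\<phi> (F g) \<otimes>\<^bsub>B\<^esub> T g) \<otimes>\<^bsub>B\<^esub> \<Psi> H)"
    proof (intro B.finsum_cong' refl)
      fix g assume g: "g \<in> carrier G"
      have "(\<Oplus>\<^bsub>B\<^esub>x\<in>carrier G. ?t g x) = (\<Oplus>\<^bsub>B\<^esub>k\<in>carrier G. ?t g (g \<otimes>\<^bsub>G\<^esub> k))"
        using F H T g by (intro B.finsum_group_shift) auto
      also have "\<dots> = (\<Oplus>\<^bsub>B\<^esub>k\<in>carrier G. (\<phi> (F g) \<otimes>\<^bsub>B\<^esub> T g) \<otimes>\<^bsub>B\<^esub> (\<phi> (H k) \<otimes>\<^bsub>B\<^esub> T k))"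
      proof (intro B.finsum_cong' refl)
        fix k assume k: "k \<in> carrier G"
        have "inv\<^bsub>G\<^esub> g \<otimes>\<^bsub>G\<^esub> (g \<otimes>\<^bsub>G\<^esub> k) = k" 
          using g k by (simp flip: G.m_assoc)
        hence "?t g (g \<otimes>\<^bsub>G\<^esub> k) = \<phi> (F g) \<otimes>\<^bsub>B\<^esub> ((\<phi> (act g (H k)) \<otimes>\<^bsub>B\<^esub> T g) \<otimes>\<^bsub>B\<^esub> T k)"
          using g k F H T by (simp add: T_mult B.m_assoc)
        also have "\<phi> (act g (H k)) \<otimes>\<^bsub>B\<^esub> T g = T g \<otimes>\<^bsub>B\<^esub> \<phi> (H k)"
          using T_act[of g "H k"] g H by simp
        finally show "?t g (g \<otimes>\<^bsub>G\<^esub> k) = (\<phi> (F g) \<otimes>\<^bsub>B\<^esub> T g) \<otimes>\<^bsub>B\<^esub> (\<phi> (H k) \<otimes>\<^bsub>B\<^esub> T k)"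
          using g k F H T by (simp add: B.m_assoc)
      qed (use F H T g in auto)
      also have "\<dots> = (\<phi> (F g) \<otimes>\<^bsub>B\<^esub> T g) \<otimes>\<^bsub>B\<^esub> \<Psi> H"
        unfolding \<Psi>_def using F H T g finite_group by (subst B.finsum_rdistr) auto
      finally show "(\<Oplus>\<^bsub>B\<^esub>x\<in>carrier G. ?t g x) = (\<phi> (F g) \<otimes>\<^bsub>B\<^esub> T g) \<otimes>\<^bsub>B\<^esub> \<Psi> H" .
    qed (use F H T in \<open>auto simp: \<Psi>_def intro!: B.finsum_closed B.m_closed\<close>)
    also have "\<dots> = \<Psi> F \<otimes>\<^bsub>B\<^esub> \<Psi> H"
      using F H T finite_group unfolding \<Psi>_def[of F]
      by (subst B.finsum_ldistr) (auto simp: \<Psi>_def intro!: B.finsum_closed)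
    finally show ?thesis .
  qed
  have "\<Psi> \<in> alg_hom S B"
  proof (rule alg_homI)
    fix F H assume F: "F \<in> carrier S" and H: "H \<in> carrier S"
    show "\<Psi> (F \<otimes>\<^bsub>S\<^esub> H) = \<Psi> F \<otimes>\<^bsub>B\<^esub> \<Psi> H" by (rule mult[OF F H])
    have "\<Psi> (F \<oplus>\<^bsub>S\<^esub> H) =
        (\<Oplus>\<^bsub>B\<^esub>g\<in>carrier G. \<phi> (F g) \<otimes>\<^bsub>B\<^esub> T g \<oplus>\<^bsub>B\<^esub> \<phi> (H g) \<otimes>\<^bsub>B\<^esub> T g)"
      unfolding \<Psi>_def using F H T
      by (intro B.finsum_cong') (auto simp: skew_simps \<phi>.add B.l_distr)
    thus "\<Psi> (F \<oplus>\<^bsub>S\<^esub> H) = \<Psi> F \<oplus>\<^bsub>B\<^esub> \<Psi> H"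
      unfolding \<Psi>_def using F H T by (subst (asm) B.finsum_addf) auto
  next
    show "\<Psi> \<one>\<^bsub>S\<^esub> = \<one>\<^bsub>B\<^esub>" unfolding one_skew using pure by (simp add: T_one \<phi>.one)
  next
    fix c F assume F: "F \<in> carrier S"
    show "\<Psi> F \<in> carrier B" unfolding \<Psi>_def using F T by (auto intro!: B.finsum_closed)
    show "\<Psi> (c \<odot>\<^bsub>S\<^esub> F) = c \<odot>\<^bsub>B\<^esub> \<Psi> F"
      unfolding \<Psi>_def using F T
      by (subst B.smult_finsum) (auto simp: skew_simps \<phi>.smult B.smult_mult_left intro!: B.finsum_cong')
  qed
  thus ?thesis using pure that by blast
qed

end


section \<open>The group \<open>G(r,1,n)\<close>\<close>

text \<open>As a matrix, g sends the j-th basis vector to \<open>entry n g j\<close> times the basis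
  vector with index \<open>perm_of n g j\<close>. These two functions of j serve as coordinates on
  the group.\<close>

definition entry :: "nat \<Rightarrow> complex mat \<Rightarrow> nat \<Rightarrow> complex" where
  "entry n g j = g $$ (perm_of n g j, j)"

definition monomial :: "nat \<Rightarrow> (nat \<Rightarrow> nat) \<Rightarrow> (nat \<Rightarrow> complex) \<Rightarrow> complex mat" where
  "monomial n \<sigma> d = Matrix.mat n n (\<lambda>(i, j). if i = \<sigma> j then d j else 0)"

locale Grn_group =
  fixes r n :: nat
  assumes r_pos: "r \<ge> 1"
begin

abbreviation G where "G \<equiv> Grn r n"

sublocale G: group "Grn r n" by (rule group_Grn)

lemma perm_less [simp]: "g \<in> carrier G \<Longrightarrow> j < n \<Longrightarrow> perm_of n g j < n"
  using monomial_perm_of(1) Grn_monomial by blast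

lemma perm_inj: "g \<in> carrier G \<Longrightarrow> i < n \<Longrightarrow> j < n \<Longrightarrow> perm_of n g i = perm_of n g j \<longleftrightarrow> i = j"
  using perm_of_inj Grn_monomial by blast

lemma entry_nz: "g \<in> carrier G \<Longrightarrow> j < n \<Longrightarrow> entry n g j \<noteq> 0"
  using monomial_perm_of(2) Grn_monomial unfolding entry_def by blast

lemma entry_root: "g \<in> carrier G \<Longrightarrow> j < n \<Longrightarrow> entry n g j ^ r = 1"
  using entry_nz perm_less unfolding entry_def Grn_def by simp

lemma mult_closed [simp]: "g \<in> carrier G \<Longrightarrow> h \<in> carrier G \<Longrightarrow> g * h \<in> carrier G"
  using G.m_closed by simp

lemma mult_assoc: "g \<in> carrier G \<Longrightarrow> h \<in> carrier G \<Longrightarrow> k \<in> carrier G \<Longrightarrow> g * h * k = g * (h * k)"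
  using G.m_assoc by simp

lemma perm_mult: "g \<in> carrier G \<Longrightarrow> h \<in> carrier G \<Longrightarrow> j < n \<Longrightarrow>
    perm_of n (g * h) j = perm_of n g (perm_of n h j)"
  using monomial_mult(2) Grn_monomial by blast

lemma entry_mult: "g \<in> carrier G \<Longrightarrow> h \<in> carrier G \<Longrightarrow> j < n \<Longrightarrow>
    entry n (g * h) j = entry n g (perm_of n h j) * entry n h j"
  unfolding entry_def perm_mult
  using monomial_mult_index[OF Grn_carrier_mat Grn_monomial, of g r n h r] by simp

lemma Grn_eqI:
  assumes g: "g \<in> carrier G" and h: "h \<in> carrier G"
    and p: "\<And>j. j < n \<Longrightarrow> perm_of n g j = perm_of n h j"
    and e: "\<And>j. j < n \<Longrightarrow> entry n g j = entry n h j"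
  shows "g = h"
proof (rule eq_matI)
  have dims: "g \<in> carrier_mat n n" "h \<in> carrier_mat n n" using g h Grn_carrier_mat by auto
  thus "dim_row g = dim_row h" "dim_col g = dim_col h" by auto
  fix i j assume "i < dim_row h" "j < dim_col h"
  hence ij: "i < n" "j < n" using dims by auto
  show "g $$ (i, j) = h $$ (i, j)"
    using monomial_perm_of(3)[OF Grn_monomial[OF g] ij(2,1)]
      monomial_perm_of(3)[OF Grn_monomial[OF h] ij(2,1)] p[OF ij(2)] e[OF ij(2)]
    by (cases "i = perm_of n h j") (auto simp: entry_def)
qed

lemma monomial_Grn:
  assumes "\<And>j. j < n \<Longrightarrow> \<sigma> j < n" "inj_on \<sigma> {..<n}" "\<And>j. j < n \<Longrightarrow> d j ^ r = 1"
  shows "monomial n \<sigma> d \<in> carrier G" "\<And>j. j < n \<Longrightarrow> perm_of n (monomial n \<sigma> d) j = \<sigma> j"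
    "\<And>j. j < n \<Longrightarrow> entry n (monomial n \<sigma> d) j = d j"
proof -
  have nz: "d j \<noteq> 0" if "j < n" for j using assms(3)[OF that] r_pos by (intro notI) (simp add: power_0_left)
  have m: "monomial n \<sigma> d \<in> carrier_mat n n" by (simp add: monomial_def)
  have *: "monomial n \<sigma> d $$ (i, j) \<noteq> 0 \<longleftrightarrow> i = \<sigma> j" if "i < n" "j < n" for i j
    using that nz by (simp add: monomial_def)
  note M = monomial_matI[OF m assms(1,2) *]
  show p: "\<And>j. j < n \<Longrightarrow> perm_of n (monomial n \<sigma> d) j = \<sigma> j" using M(2) .
  show "\<And>j. j < n \<Longrightarrow> entry n (monomial n \<sigma> d) j = d j"
    using p assms(1) by (simp add: entry_def) (simp add: monomial_def)
  show "monomial n \<sigma> d \<in> carrier G"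
    using M(1) assms by (auto simp: Grn_def) (auto simp: monomial_def)
qed

lemma one_closed [simp]: "1\<^sub>m n \<in> carrier G"
  using G.one_closed by simp

lemma perm_one [simp]: "j < n \<Longrightarrow> perm_of n (1\<^sub>m n) j = j"
  using perm_of_eqI[OF Grn_monomial[OF one_closed]] by simp

lemma entry_one [simp]: "j < n \<Longrightarrow> entry n (1\<^sub>m n) j = 1"
  by (simp add: entry_def)

lemma inv_mult [simp]: "g \<in> carrier G \<Longrightarrow> inv\<^bsub>G\<^esub> g * g = 1\<^sub>m n" "g \<in> carrier G \<Longrightarrow> g * inv\<^bsub>G\<^esub> g = 1\<^sub>m n"
  using G.l_inv G.r_inv by simp_all

lemma perm_inv:
  assumes "g \<in> carrier G" "j < n"
  shows "perm_of n (inv\<^bsub>G\<^esub> g) (perm_of n g j) = j" "perm_of n g (perm_of n (inv\<^bsub>G\<^esub> g) j) = j"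
  using perm_mult[of "inv\<^bsub>G\<^esub> g" g j] perm_mult[of g "inv\<^bsub>G\<^esub> g" j] assms by simp_all

lemma entry_inv:
  assumes "g \<in> carrier G" "j < n"
  shows "entry n (inv\<^bsub>G\<^esub> g) (perm_of n g j) = inverse (entry n g j)"
  using entry_mult[of "inv\<^bsub>G\<^esub> g" g j] assms entry_nz[OF assms] by (simp add: field_simps)

text \<open>The two coordinate functions determine the element, and each has a finite range: indices
  below n, and r-th roots of unity with r positive.\<close>

lemma finite_Grn: "finite (carrier G)"
proof -
  let ?f = "\<lambda>g. (restrict (perm_of n g) {..<n}, restrict (entry n g) {..<n})"
  let ?C = "({..<n} \<rightarrow>\<^sub>E {..<n}) \<times> ({..<n} \<rightarrow>\<^sub>E {z. z ^ r = (1::complex)})"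
  have "finite {z. z ^ r = (1::complex)}" using r_pos by (intro finite_roots_unity) auto
  hence "finite ?C" by (intro finite_cartesian_product finite_PiE) auto
  moreover have "?f ` carrier G \<subseteq> ?C"
    using entry_root by (simp add: image_subset_iff restrict_PiE_iff del: restrict_apply)
  moreover have "inj_on ?f (carrier G)"
  proof (intro inj_onI)
    fix g h assume gh: "g \<in> carrier G" "h \<in> carrier G" "?f g = ?f h"
    show "g = h"
    proof (rule Grn_eqI[OF gh(1,2)])
      fix j assume j: "j < n"
      have eq: "restrict (perm_of n g) {..<n} = restrict (perm_of n h) {..<n}"
        "restrict (entry n g) {..<n} = restrict (entry n h) {..<n}"
        using gh(3) by blast+
      show "perm_of n g j = perm_of n h j" "entry n g j = entry n h j"
        using fun_cong[OF eq(1), of j] fun_cong[OF eq(2), of j] j by simp_all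
    qed
  qed
  ultimately show ?thesis by (blast intro: inj_on_finite)
qed

end


section \<open>The diagonal action on the tensor algebra\<close>

lemma (in Grn_group) rho_index_eq: "g \<in> carrier G \<Longrightarrow> i < n \<Longrightarrow> j < n \<Longrightarrow>
    rho n g $$ (i, j) = (if i = perm_of n g j then 1 else 0)"
  by (simp add: rho_def perm_mat_def)

text \<open>Since \<open>rho n g\<close> is a permutation matrix, the product of its entries along
  the words w and u vanishes unless u arises from w by applying the inverse permutation to each
  letter. The sum therefore has a single nonzero term.\<close>

lemma (in Grn_group) tensor_act_eq:
  assumes g: "g \<in> carrier G" and w: "w \<in> lists {..<n}"
  shows "tensor_act n (rho n g) f w = f (map (perm_of n (inv\<^bsub>G\<^esub> g)) w)"
proof -
  let ?p = "perm_of n (inv\<^bsub>G\<^esub> g)"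
  let ?U = "{u \<in> lists {..<n}. length u = length w}"
  have wk: "w ! k < n" if "k < length w" for k using w that nth_mem by fastforce
  have "finite ?U" using finite_lists_length_eq[of "{..<n}" "length w"] by (simp add: lists_eq_set)
  have u0: "map ?p w \<in> ?U" using w g by auto
  have prod: "(\<Prod>k<length w. rho n g $$ (w ! k, u ! k)) = (if u = map ?p w then 1 else 0)"
    if u: "u \<in> ?U" for u
  proof -
    have uk: "u ! k < n" if "k < length w" for k using u that nth_mem by fastforce
    have "rho n g $$ (w ! k, u ! k) = (if u ! k = ?p (w ! k) then 1 else 0)" if "k < length w" for k
      using rho_index_eq[OF g wk[OF that] uk[OF that]] perm_inv[OF g] wk[OF that] uk[OF that] by auto
    hence "(\<Prod>k<length w. rho n g $$ (w ! k, u ! k)) =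
        (\<Prod>k<length w. if u ! k = ?p (w ! k) then 1 else 0)" by (intro prod.cong) auto
    also have "\<dots> = (if \<forall>k<length w. u ! k = ?p (w ! k) then 1 else 0)" by auto
    also have "(\<forall>k<length w. u ! k = ?p (w ! k)) \<longleftrightarrow> u = map ?p w"
      using u by (auto simp: list_eq_iff_nth_eq)
    finally show ?thesis .
  qed
  have "tensor_act n (rho n g) f w = (\<Sum>u\<in>?U. (\<Prod>k<length w. rho n g $$ (w ! k, u ! k)) * f u)"
    using w by (simp add: tensor_act_def)
  also have "\<dots> = (\<Sum>u\<in>?U. if u = map ?p w then f u else 0)"
    using prod by (intro sum.cong) auto
  also have "\<dots> = f (map ?p w)" using \<open>finite ?U\<close> u0 by (simp add: sum.delta)
  finally show ?thesis .
qed

lemma tensor_act_outside: "w \<notin> lists {..<n} \<Longrightarrow> tensor_act n M f w = 0"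
  unfolding tensor_act_def by (rule if_not_P)

context Grn_group
begin

lemma map_perm_closed: "g \<in> carrier G \<Longrightarrow> w \<in> lists {..<n} \<Longrightarrow> map (perm_of n g) w \<in> lists {..<n}"
  by auto

lemma map_perm_inv:
  "g \<in> carrier G \<Longrightarrow> w \<in> lists {..<n} \<Longrightarrow> map (perm_of n g) (map (perm_of n (inv\<^bsub>G\<^esub> g)) w) = w"
  "g \<in> carrier G \<Longrightarrow> w \<in> lists {..<n} \<Longrightarrow> map (perm_of n (inv\<^bsub>G\<^esub> g)) (map (perm_of n g) w) = w"
  by (auto simp: perm_inv intro!: map_idI)

lemma tensor_act_closed:
  assumes g: "g \<in> carrier G" and f: "f \<in> carrier (tensor_algebra n)"
  shows "tensor_act n (rho n g) f \<in> carrier (tensor_algebra n)"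
proof -
  let ?h = "tensor_act n (rho n g) f"
  have "w \<in> map (perm_of n g) ` {u. f u \<noteq> 0} \<and> w \<in> lists {..<n}" if "?h w \<noteq> 0" for w
  proof -
    have w: "w \<in> lists {..<n}" using that tensor_act_outside by metis
    hence "f (map (perm_of n (inv\<^bsub>G\<^esub> g)) w) \<noteq> 0" using that tensor_act_eq[OF g w] by simp
    thus ?thesis using w map_perm_inv(1)[OF g w] by (metis (mono_tags, lifting) image_eqI mem_Collect_eq)
  qed
  moreover have "finite (map (perm_of n g) ` {u. f u \<noteq> 0})"
    using f by (simp add: tensor_algebra_def free_algebra_simps)
  ultimately show ?thesis
    unfolding tensor_algebra_def free_algebra_simps by (blast intro: finite_subset)
qed

lemma tensor_act_word:
  assumes g: "g \<in> carrier G" and u: "u \<in> lists {..<n}"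
  shows "tensor_act n (rho n g) (free_word u) = free_word (map (perm_of n g) u)"
proof
  fix w
  show "tensor_act n (rho n g) (free_word u) w = free_word (map (perm_of n g) u) w"
  proof (cases "w \<in> lists {..<n}")
    case True
    have "map (perm_of n (inv\<^bsub>G\<^esub> g)) w = u \<longleftrightarrow> w = map (perm_of n g) u"
      using map_perm_inv(1)[OF g True] map_perm_inv(2)[OF g u] by metis
    thus ?thesis unfolding tensor_act_eq[OF g True] free_word_def by simp
  next
    case False
    thus ?thesis using map_perm_closed[OF g u] by (auto simp: tensor_act_outside free_word_def)
  qed
qed

text \<open>Acting letter by letter commutes with cutting words, hence with the product of the
  tensor algebra.\<close>

lemma tensor_act_hom:
  assumes g: "g \<in> carrier G"
  shows "tensor_act n (rho n g) \<in> alg_hom (tensor_algebra n) (tensor_algebra n)"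
proof (rule alg_homI)
  let ?T = "tensor_algebra n" and ?a = "tensor_act n (rho n g)"
  fix f h c
  show "?a (f \<oplus>\<^bsub>?T\<^esub> h) = ?a f \<oplus>\<^bsub>?T\<^esub> ?a h"
  proof
    fix w show "?a (f \<oplus>\<^bsub>?T\<^esub> h) w = (?a f \<oplus>\<^bsub>?T\<^esub> ?a h) w"
      unfolding tensor_algebra_def free_algebra_simps
      by (cases "w \<in> lists {..<n}") (simp_all add: tensor_act_eq[OF g] tensor_act_outside del: in_lists_conv_set)
  qed
  show "?a (c \<odot>\<^bsub>?T\<^esub> f) = c \<odot>\<^bsub>?T\<^esub> ?a f"
  proof
    fix w show "?a (c \<odot>\<^bsub>?T\<^esub> f) w = (c \<odot>\<^bsub>?T\<^esub> ?a f) w"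
      unfolding tensor_algebra_def free_algebra_simps
      by (cases "w \<in> lists {..<n}") (simp_all add: tensor_act_eq[OF g] tensor_act_outside del: in_lists_conv_set)
  qed
  show "?a (f \<otimes>\<^bsub>?T\<^esub> h) = ?a f \<otimes>\<^bsub>?T\<^esub> ?a h"
  proof
    fix w show "?a (f \<otimes>\<^bsub>?T\<^esub> h) w = (?a f \<otimes>\<^bsub>?T\<^esub> ?a h) w"
    proof (cases "w \<in> lists {..<n}")
      case True
      have "take k w \<in> lists {..<n}" "drop k w \<in> lists {..<n}" for k
        using True set_take_subset[of k w] set_drop_subset[of k w] by auto
      thus ?thesis
        unfolding tensor_algebra_def free_algebra_simps tensor_act_eq[OF g True]
        by (simp add: tensor_act_eq[OF g] take_map drop_map del: in_lists_conv_set)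
    next
      case False
      \<comment> \<open>If w has a letter outside the alphabet, then so has one of the two pieces of
        every cut.\<close>
      have "take k w \<notin> lists {..<n} \<or> drop k w \<notin> lists {..<n}" for k
        using False append_in_lists_conv[of "take k w" "drop k w" "{..<n}"] by simp
      hence "?a f (take k w) * ?a h (drop k w) = 0" for k
        using tensor_act_outside by (metis mult_eq_0_iff)
      hence "(\<Sum>k\<le>length w. ?a f (take k w) * ?a h (drop k w)) = 0" by (intro sum.neutral ballI)
      thus ?thesis
        unfolding tensor_algebra_def free_algebra_simps tensor_act_outside[OF False] by simp
    qed
  qed
next
  show "tensor_act n (rho n g) \<one>\<^bsub>tensor_algebra n\<^esub> = \<one>\<^bsub>tensor_algebra n\<^esub>"
    unfolding tensor_algebra_def free_algebra_simps using tensor_act_word[OF g, of "[]"] by simp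
qed (rule tensor_act_closed[OF g])

lemma complex_algebra_tensor: "complex_algebra (tensor_algebra n)"
  unfolding tensor_algebra_def by (rule complex_algebra_free)

lemma tensor_skew_action:
  "skew_group_action (tensor_algebra n) G (\<lambda>g. tensor_act n (rho n g))"
proof -
  have one: "tensor_act n (rho n \<one>\<^bsub>G\<^esub>) f = f" if f: "f \<in> carrier (tensor_algebra n)" for f
  proof
    fix w show "tensor_act n (rho n \<one>\<^bsub>G\<^esub>) f w = f w"
    proof (cases "w \<in> lists {..<n}")
      case True
      have "map (perm_of n (inv\<^bsub>G\<^esub> \<one>\<^bsub>G\<^esub>)) w = w" using True G.inv_one by (intro map_idI) auto
      thus ?thesis unfolding tensor_act_eq[OF G.one_closed True] by (rule arg_cong)
    next
      case False
      thus ?thesis using f by (auto simp: tensor_act_outside tensor_algebra_def free_algebra_simps)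
    qed
  qed
  have mult: "tensor_act n (rho n (g \<otimes>\<^bsub>G\<^esub> h)) f = tensor_act n (rho n g) (tensor_act n (rho n h) f)"
    if g: "g \<in> carrier G" and h: "h \<in> carrier G" for g h f
  proof
    fix w show "tensor_act n (rho n (g \<otimes>\<^bsub>G\<^esub> h)) f w = tensor_act n (rho n g) (tensor_act n (rho n h) f) w"
    proof (cases "w \<in> lists {..<n}")
      case True
      have gh: "g \<otimes>\<^bsub>G\<^esub> h \<in> carrier G" using g h by (rule G.m_closed)
      have "perm_of n (inv\<^bsub>G\<^esub> (g \<otimes>\<^bsub>G\<^esub> h)) j = perm_of n (inv\<^bsub>G\<^esub> h) (perm_of n (inv\<^bsub>G\<^esub> g) j)" if "j < n" for j
        unfolding G.inv_mult_group[OF g h] using perm_mult[of "inv\<^bsub>G\<^esub> h" "inv\<^bsub>G\<^esub> g" j] g h that by simp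
      hence "map (perm_of n (inv\<^bsub>G\<^esub> (g \<otimes>\<^bsub>G\<^esub> h))) w = map (perm_of n (inv\<^bsub>G\<^esub> h)) (map (perm_of n (inv\<^bsub>G\<^esub> g)) w)"
        using True by auto
      thus ?thesis
        unfolding tensor_act_eq[OF gh True] tensor_act_eq[OF g True]
          tensor_act_eq[OF h map_perm_closed[OF G.inv_closed[OF g] True]] by (rule arg_cong)
    next
      case False thus ?thesis by (simp add: tensor_act_outside)
    qed
  qed
  show ?thesis
    by (intro skew_group_action.intro skew_group_action_axioms.intro complex_algebra_tensor group_Grn
        finite_Grn tensor_act_hom one mult)
qed

end


section \<open>Reflections and three-cycles\<close>

context Grn_group
begin

text \<open>For distinct i and j these are the matrices
  \<open>\<xi>\<^sub>i\<^sup>a \<xi>\<^sub>j\<^sup>-\<^sup>a (i j)\<close>. Describing them through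
  the product of two entries avoids the choice of \<xi> and a, and makes stability under conjugation
  easy to check.\<close>

definition refls :: "nat \<Rightarrow> nat \<Rightarrow> complex mat set" where
  "refls i j = {g \<in> carrier G. (\<forall>k<n. perm_of n g k = Transposition.transpose i j k) \<and>
     entry n g i * entry n g j = 1 \<and> (\<forall>k<n. k \<noteq> i \<longrightarrow> k \<noteq> j \<longrightarrow> entry n g k = 1)}"

text \<open>Conjugation does not change the product of the entries around a cycle. For distinct
  indices, the value 1 together with entries 1 at the fixed indices describes the conjugates of
  \<open>cyc3 n\<close> that lie over the three-cycle (i j k).\<close>

definition cycles :: "nat \<Rightarrow> nat \<Rightarrow> nat \<Rightarrow> complex mat set" where
  "cycles i j k = {g \<in> carrier G. perm_of n g i = j \<and> perm_of n g j = k \<and> perm_of n g k = i \<and>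
     entry n g i * entry n g j * entry n g k = 1 \<and>
     (\<forall>l<n. l \<noteq> i \<longrightarrow> l \<noteq> j \<longrightarrow> l \<noteq> k \<longrightarrow> perm_of n g l = l \<and> entry n g l = 1)}"

lemma refls_Grn: "x \<in> refls i j \<Longrightarrow> x \<in> carrier G"
  by (simp add: refls_def)

lemma cycles_Grn: "x \<in> cycles i j k \<Longrightarrow> x \<in> carrier G"
  by (simp add: cycles_def)

lemma refls_commute: "refls i j = refls j i"
  by (auto simp: refls_def transpose_commute mult.commute)

lemma cycles_rotate: "cycles i j k = cycles j k i"
  by (auto simp: cycles_def mult_ac)

lemma refls_perm: "x \<in> refls i j \<Longrightarrow> k < n \<Longrightarrow> perm_of n x k = Transposition.transpose i j k"
  by (simp add: refls_def)

text \<open>Both identities compare coordinates in (g h g^-1) g = g h. Leaving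
  \<open>entry n g k\<close> as a factor avoids the entries of the inverse.\<close>

lemma conj_shift:
  assumes g: "g \<in> carrier G" and h: "h \<in> carrier G" and k: "k < n"
  shows "perm_of n (g * h * inv\<^bsub>G\<^esub> g) (perm_of n g k) = perm_of n g (perm_of n h k)"
    "entry n (g * h * inv\<^bsub>G\<^esub> g) (perm_of n g k) * entry n g k = entry n g (perm_of n h k) * entry n h k"
proof -
  let ?x = "g * h * inv\<^bsub>G\<^esub> g"
  have x: "?x \<in> carrier G" using g h by simp
  have eq: "?x * g = g * h" using g h G.inv_closed[OF g] by (simp add: mult_assoc right_mult_one_mat[OF Grn_carrier_mat])
  show "perm_of n ?x (perm_of n g k) = perm_of n g (perm_of n h k)"
    using perm_mult[OF x g k] perm_mult[OF g h k] eq by simp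
  show "entry n ?x (perm_of n g k) * entry n g k = entry n g (perm_of n h k) * entry n h k"
    using entry_mult[OF x g k] entry_mult[OF g h k] eq by simp
qed

text \<open>Multiplying the identities of \<open>conj_shift\<close> around the orbit {i, j}, each
  entry of g occurs once on either side and cancels; so the product of the two entries remains
  1.\<close>

lemma refls_conj:
  assumes g: "g \<in> carrier G" and h: "h \<in> refls i j" and ij: "i < n" "j < n" "i \<noteq> j"
  shows "g * h * inv\<^bsub>G\<^esub> g \<in> refls (perm_of n g i) (perm_of n g j)"
proof -
  let ?x = "g * h * inv\<^bsub>G\<^esub> g"
  have hG: "h \<in> carrier G" using h by (rule refls_Grn)
  have x: "?x \<in> carrier G" using g hG by simp
  note c = conj_shift[OF g hG]
  have hi: "perm_of n h i = j" "perm_of n h j = i" using refls_perm[OF h] ij by simp_all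
  have "entry n ?x (perm_of n g i) * entry n g i * (entry n ?x (perm_of n g j) * entry n g j) =
      entry n g j * entry n g i * (entry n h i * entry n h j)"
    using c(2)[OF ij(1)] c(2)[OF ij(2)] hi by simp
  also have "entry n h i * entry n h j = 1" using h by (simp add: refls_def)
  finally have 1: "entry n ?x (perm_of n g i) * entry n ?x (perm_of n g j) = 1"
    using entry_nz[OF g ij(1)] entry_nz[OF g ij(2)] by (simp add: field_simps)
  have "perm_of n ?x l = Transposition.transpose (perm_of n g i) (perm_of n g j) l \<and>
      (l \<noteq> perm_of n g i \<longrightarrow> l \<noteq> perm_of n g j \<longrightarrow> entry n ?x l = 1)" if "l < n" for l
  proof -
    obtain k where k: "k < n" "l = perm_of n g k"
      using perm_of_surj[OF Grn_monomial[OF g] \<open>l < n\<close>] by metis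
    have "k \<noteq> i \<Longrightarrow> k \<noteq> j \<Longrightarrow> perm_of n h k = k \<and> entry n h k = 1"
      using refls_perm[OF h k(1)] h k by (simp add: refls_def)
    thus ?thesis
      using c[OF k(1)] refls_perm[OF h k(1)] entry_nz[OF g k(1)] perm_inj[OF g k(1)] ij k hi
      by (cases "k = i"; cases "k = j") (auto simp: transpose_def)
  qed
  thus ?thesis using x 1 by (simp add: refls_def)
qed

text \<open>The same cancellation of the entries of g, now around an orbit of length three.\<close>

lemma cycles_conj:
  assumes g: "g \<in> carrier G" and h: "h \<in> cycles i j k" and ijk: "i < n" "j < n" "k < n"
  shows "g * h * inv\<^bsub>G\<^esub> g \<in> cycles (perm_of n g i) (perm_of n g j) (perm_of n g k)"
proof -
  let ?x = "g * h * inv\<^bsub>G\<^esub> g"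
  have hG: "h \<in> carrier G" using h by (rule cycles_Grn)
  have x: "?x \<in> carrier G" using g hG by simp
  note c = conj_shift[OF g hG]
  have hi: "perm_of n h i = j" "perm_of n h j = k" "perm_of n h k = i"
    and h1: "entry n h i * entry n h j * entry n h k = 1" using h by (simp_all add: cycles_def)
  have "(entry n ?x (perm_of n g i) * entry n g i) * (entry n ?x (perm_of n g j) * entry n g j) *
      (entry n ?x (perm_of n g k) * entry n g k) =
      entry n g j * entry n g k * entry n g i * (entry n h i * entry n h j * entry n h k)"
    using c(2)[OF ijk(1)] c(2)[OF ijk(2)] c(2)[OF ijk(3)] hi by simp
  hence 1: "entry n ?x (perm_of n g i) * entry n ?x (perm_of n g j) * entry n ?x (perm_of n g k) = 1"
    unfolding h1
    using entry_nz[OF g ijk(1)] entry_nz[OF g ijk(2)] entry_nz[OF g ijk(3)] by (simp add: field_simps)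
  have "perm_of n ?x l = l \<and> entry n ?x l = 1"
    if "l < n" "l \<noteq> perm_of n g i" "l \<noteq> perm_of n g j" "l \<noteq> perm_of n g k" for l
  proof -
    obtain m where m: "m < n" "l = perm_of n g m"
      using perm_of_surj[OF Grn_monomial[OF g] \<open>l < n\<close>] by metis
    hence "perm_of n h m = m \<and> entry n h m = 1" using h that by (auto simp: cycles_def)
    thus ?thesis using c[OF m(1)] entry_nz[OF g m(1)] m by simp
  qed
  thus ?thesis using x 1 c(1)[OF ijk(1)] c(1)[OF ijk(2)] c(1)[OF ijk(3)] hi by (simp add: cycles_def)
qed

text \<open>Conjugation by the inverse of g gives the reverse inclusion. Equality of the two sets is
  what allows a sum over one to be reindexed as a sum over the other.\<close>

lemma refls_conj_image:
  assumes g: "g \<in> carrier G" and ij: "i < n" "j < n" "i \<noteq> j"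
  shows "(\<lambda>h. g * h * inv\<^bsub>G\<^esub> g) ` refls i j = refls (perm_of n g i) (perm_of n g j)"
proof
  show "(\<lambda>h. g * h * inv\<^bsub>G\<^esub> g) ` refls i j \<subseteq> refls (perm_of n g i) (perm_of n g j)"
    using refls_conj[OF g _ ij] by blast
  show "refls (perm_of n g i) (perm_of n g j) \<subseteq> (\<lambda>h. g * h * inv\<^bsub>G\<^esub> g) ` refls i j"
  proof
    fix x assume x: "x \<in> refls (perm_of n g i) (perm_of n g j)"
    have xG: "x \<in> carrier G" using x by (rule refls_Grn)
    have gi: "inv\<^bsub>G\<^esub> g \<in> carrier G" using g by simp
    have "inv\<^bsub>G\<^esub> g * x * inv\<^bsub>G\<^esub> (inv\<^bsub>G\<^esub> g) \<in> refls i j"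
      using refls_conj[OF gi x] ij g by (simp add: perm_inv perm_inj)
    moreover have "g * (inv\<^bsub>G\<^esub> g * x * inv\<^bsub>G\<^esub> (inv\<^bsub>G\<^esub> g)) * inv\<^bsub>G\<^esub> g = x"
      using g gi xG by (simp add: mult_assoc right_mult_one_mat[OF Grn_carrier_mat])
        (simp add: left_mult_one_mat[OF Grn_carrier_mat] flip: mult_assoc)
    ultimately show "x \<in> (\<lambda>h. g * h * inv\<^bsub>G\<^esub> g) ` refls i j" by (metis image_eqI)
  qed
qed

text \<open>The entry at j has to be the inverse of d. Together with \<open>refls_eqI\<close> this
  parametrizes the reflections over (i j) by the r-th roots of unity.\<close>

lemma refls_ex:
  assumes ij: "i < n" "j < n" "i \<noteq> j" and d: "d ^ r = 1"
  obtains x where "x \<in> refls i j" "entry n x i = d"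
proof -
  have d0: "d \<noteq> 0" using d r_pos by (auto simp: power_0_left)
  let ?x = "monomial n (Transposition.transpose i j) (\<lambda>k. if k = i then d else if k = j then inverse d else 1)"
  have "Transposition.transpose i j k < n" if "k < n" for k using that ij by (auto simp: transpose_def)
  moreover have "inj_on (Transposition.transpose i j) {..<n}"
    using permutes_inj_on by (metis inj_on_subset inj_transpose subset_UNIV)
  ultimately have "?x \<in> refls i j" "entry n ?x i = d"
    using monomial_Grn[of "Transposition.transpose i j" "\<lambda>k. if k = i then d else if k = j then inverse d else 1"]
      ij d d0 by (auto simp: refls_def power_inverse)
  thus ?thesis using that by blast
qed

lemma refls_eqI:
  assumes "x \<in> refls i j" "y \<in> refls i j" "entry n x i = entry n y i"
  shows "x = y"
proof (rule Grn_eqI)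
  fix k assume k: "k < n"
  show "entry n x k = entry n y k"
    using assms k unfolding refls_def by (cases "k = i"; cases "k = j")
      (auto, metis mult_cancel_left mult_zero_left zero_neq_one)
qed (use assms in \<open>auto simp: refls_def\<close>)

text \<open>A member of \<open>cycles i j k\<close> has two free entries, at i and at j. In a
  product x y the first is the entry of x at i and the second is the entry of y at j. So the factors
  can be recovered from the product, and they can be chosen to match any given member.\<close>

lemma mult_refls_image:
  assumes ijk: "i < n" "j < n" "k < n" "i \<noteq> j" "j \<noteq> k" "i \<noteq> k"
  shows "(\<Union>x\<in>refls i j. (\<lambda>y. x * y) ` refls j k) = cycles i j k"
    "\<And>x y x' y'. x \<in> refls i j \<Longrightarrow> y \<in> refls j k \<Longrightarrow> x' \<in> refls i j \<Longrightarrow> y' \<in> refls j k \<Longrightarrow>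
       x * y = x' * y' \<Longrightarrow> x = x' \<and> y = y'"
proof -
  have mult: "x * y \<in> cycles i j k \<and> entry n (x * y) i = entry n x i \<and> entry n (x * y) j = entry n y j"
    if x: "x \<in> refls i j" and y: "y \<in> refls j k" for x y
  proof -
    have xG: "x \<in> carrier G" and yG: "y \<in> carrier G" using x y by (auto intro: refls_Grn)
    have px: "perm_of n x l = Transposition.transpose i j l" if "l < n" for l using refls_perm[OF x that] .
    have py: "perm_of n y l = Transposition.transpose j k l" if "l < n" for l using refls_perm[OF y that] .
    have ex: "entry n x i * entry n x j = 1" "\<And>l. l < n \<Longrightarrow> l \<noteq> i \<Longrightarrow> l \<noteq> j \<Longrightarrow> entry n x l = 1"
      using x by (auto simp: refls_def)
    have ey: "entry n y j * entry n y k = 1" "\<And>l. l < n \<Longrightarrow> l \<noteq> j \<Longrightarrow> l \<noteq> k \<Longrightarrow> entry n y l = 1"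
      using y by (auto simp: refls_def)
    have "perm_of n (x * y) i = j" "perm_of n (x * y) j = k" "perm_of n (x * y) k = i"
      using ijk by (simp_all add: perm_mult[OF xG yG] px py)
    moreover have e: "entry n (x * y) i = entry n x i" "entry n (x * y) j = entry n y j"
      "entry n (x * y) k = entry n x j * entry n y k"
      using ijk by (simp_all add: entry_mult[OF xG yG] py ex ey)
    moreover have "perm_of n (x * y) l = l \<and> entry n (x * y) l = 1"
      if "l < n" "l \<noteq> i" "l \<noteq> j" "l \<noteq> k" for l
      using that ijk by (simp add: perm_mult[OF xG yG] entry_mult[OF xG yG] px py ex ey)
    moreover have "entry n x i * entry n y j * (entry n x j * entry n y k) = 1"
      using ex(1) ey(1) by (metis mult.assoc mult.left_commute mult_1)
    ultimately show ?thesis using xG yG by (simp add: cycles_def)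
  qed
  show "(\<Union>x\<in>refls i j. (\<lambda>y. x * y) ` refls j k) = cycles i j k"
  proof
    show "(\<Union>x\<in>refls i j. (\<lambda>y. x * y) ` refls j k) \<subseteq> cycles i j k" using mult by blast
    show "cycles i j k \<subseteq> (\<Union>x\<in>refls i j. (\<lambda>y. x * y) ` refls j k)"
    proof
      fix z assume z: "z \<in> cycles i j k"
      have zG: "z \<in> carrier G" using z by (rule cycles_Grn)
      obtain x where x: "x \<in> refls i j" "entry n x i = entry n z i"
        using refls_ex[OF ijk(1,2,4) entry_root[OF zG ijk(1)]] .
      obtain y where y: "y \<in> refls j k" "entry n y j = entry n z j"
        using refls_ex[OF ijk(2,3,5) entry_root[OF zG ijk(2)]] .
      note m = mult[OF x(1) y(1)]
      have "z = x * y"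
      proof (rule Grn_eqI)
        show "x * y \<in> carrier G" using m cycles_Grn by blast
        fix l assume l: "l < n"
        have c: "perm_of n u i = j" "perm_of n u j = k" "perm_of n u k = i"
            "entry n u i * entry n u j * entry n u k = 1"
            "l \<noteq> i \<Longrightarrow> l \<noteq> j \<Longrightarrow> l \<noteq> k \<Longrightarrow> perm_of n u l = l \<and> entry n u l = 1"
          if "u \<in> cycles i j k" for u
          using that l by (auto simp: cycles_def)
        have xy: "x * y \<in> cycles i j k" "entry n (x * y) i = entry n z i" "entry n (x * y) j = entry n z j"
          using m x(2) y(2) by simp_all
        show "perm_of n z l = perm_of n (x * y) l"
          using c[OF z] c[OF xy(1)] by metis
        have "entry n z i * entry n z j \<noteq> 0" using c(4)[OF z] by auto
        moreover have "entry n z i * entry n z j * entry n z k = entry n z i * entry n z j * entry n (x * y) k"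
          using c(4)[OF z] c(4)[OF xy(1)] unfolding xy(2,3) by simp
        ultimately have "entry n z k = entry n (x * y) k" by simp
        thus "entry n z l = entry n (x * y) l"
          using c(5)[OF z] c(5)[OF xy(1)] xy(2,3) by metis
      qed (rule zG)
      thus "z \<in> (\<Union>x\<in>refls i j. (\<lambda>y. x * y) ` refls j k)" using x y by blast
    qed
  qed
  show "x = x' \<and> y = y'"
    if x: "x \<in> refls i j" and y: "y \<in> refls j k" and x': "x' \<in> refls i j" and y': "y' \<in> refls j k"
      and eq: "x * y = x' * y'" for x y x' y'
    using mult[OF x y] mult[OF x' y'] eq refls_eqI[OF x x'] refls_eqI[OF y y'] by simp
qed


section \<open>The conjugates of the three-cycle\<close>

text \<open>Three transpositions put i, j and k in place one after the other; each later one fixes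
  the values already reached.\<close>

lemma ex_permutes_three:
  assumes "n \<ge> 3" "i < n" "j < n" "k < n" "i \<noteq> j" "j \<noteq> k" "i \<noteq> k"
  obtains \<pi> where "\<pi> permutes {..<n}" "\<pi> i = 0" "\<pi> j = 1" "\<pi> k = (2 :: nat)"
proof -
  define p where "p = Transposition.transpose i (0 :: nat)"
  have p: "p permutes {..<n}" "p i = 0" unfolding p_def using assms by (auto intro: permutes_swap_id)
  have pj: "p j < n" "p k < n" "p j \<noteq> 0" "p k \<noteq> 0" "p j \<noteq> p k"
    using assms by (auto simp: p_def transpose_def)
  define q where "q = Transposition.transpose (p j) 1"
  have q: "q permutes {..<n}" "q (p j) = 1" "q 0 = 0"
    unfolding q_def using assms pj by (auto intro: permutes_swap_id simp: transpose_def)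
  have qk: "q (p k) < n" "q (p k) \<noteq> 0" "q (p k) \<noteq> 1"
    using assms pj by (auto simp: q_def transpose_def)
  define s where "s = Transposition.transpose (q (p k)) 2"
  have s: "s permutes {..<n}" "s (q (p k)) = 2" "s 0 = 0" "s 1 = 1"
    unfolding s_def using assms qk by (auto intro: permutes_swap_id simp: transpose_def)
  have "(s \<circ> (q \<circ> p)) permutes {..<n}"
    by (rule permutes_compose[OF permutes_compose[OF p(1) q(1)] s(1)])
  thus ?thesis using that[of "s \<circ> (q \<circ> p)"] p q s by simp
qed

lemma entry_cyc3:
  assumes n: "n \<ge> 3" and k: "k < n"
  shows "entry n (cyc3 n) k = 1"
proof -
  note C = monomial_perm_mat[OF cyc3_perm(1)[OF n], folded cyc3_def]
  show ?thesis using C(2)[OF k] monomial_perm_of(1)[OF C(1) k] k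
    by (simp add: entry_def cyc3_def perm_mat_def del: cycle_of_list.simps)
qed

lemma cyc3_cycles:
  assumes n: "n \<ge> 3"
  shows "cyc3 n \<in> cycles 0 1 2"
proof -
  note c = cyc3_perm[OF n]
  note C = monomial_perm_mat[OF c(1), folded cyc3_def]
  show ?thesis
    using n c C perm_mat_in_Grn[OF c(1), folded cyc3_def] entry_cyc3[OF n]
    by (auto simp: cycles_def simp del: cycle_of_list.simps)
qed

text \<open>The forms are given for \<open>cyc3 n\<close> and transported by conjugation. The
  conjugator is therefore built with control over where it sends i and j, so that the form of g can
  be evaluated on these two basis vectors.\<close>

lemma cycles_conjugate:
  assumes n: "n \<ge> 3" and ijk: "i < n" "j < n" "k < n" "i \<noteq> j" "j \<noteq> k" "i \<noteq> k"
    and g: "g \<in> cycles i j k"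
  obtains h where "h \<in> carrier G" "g = inv\<^bsub>G\<^esub> h * cyc3 n * h" "perm_of n h i = 0" "perm_of n h j = 1"
proof -
  have gG: "g \<in> carrier G" using g by (rule cycles_Grn)
  have gi: "perm_of n g i = j" "perm_of n g j = k" "perm_of n g k = i"
    "entry n g i * entry n g j * entry n g k = 1"
    "\<And>l. l < n \<Longrightarrow> l \<noteq> i \<Longrightarrow> l \<noteq> j \<Longrightarrow> l \<noteq> k \<Longrightarrow> perm_of n g l = l \<and> entry n g l = 1"
    using g by (auto simp: cycles_def)
  have c: "cyc3 n \<in> cycles 0 1 2" by (rule cyc3_cycles[OF n])
  have cG: "cyc3 n \<in> carrier G" using c by (rule cycles_Grn)
  obtain \<pi> where \<pi>: "\<pi> permutes {..<n}" "\<pi> i = 0" "\<pi> j = 1" "\<pi> k = 2"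
    using ex_permutes_three[OF n ijk] .
  \<comment> \<open>These entries solve h g = c h, with c the standard cycle and entry 1 at i. The
    equation in column i forces the value at j, the one in column k forces the value at k, and the
    one in column j then holds because the three entries of g multiply to 1.\<close>
  let ?d = "\<lambda>l. if l = j then inverse (entry n g i) else if l = k then entry n g k else 1"
  let ?h = "monomial n \<pi> ?d"
  have "\<pi> l < n" if "l < n" for l using permutes_in_image[OF \<pi>(1)] that by simp
  moreover have "inj_on \<pi> {..<n}" using permutes_inj_on[OF \<pi>(1)] .
  moreover have "?d l ^ r = 1" if "l < n" for l using entry_root[OF gG] ijk by (auto simp: power_inverse)
  ultimately have h: "?h \<in> carrier G" "\<And>l. l < n \<Longrightarrow> perm_of n ?h l = \<pi> l"
    "\<And>l. l < n \<Longrightarrow> entry n ?h l = ?d l"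
    using monomial_Grn[of \<pi> ?d] by auto
  have \<pi>l: "\<pi> l \<noteq> 0" "\<pi> l \<noteq> 1" "\<pi> l \<noteq> 2" if "l \<noteq> i" "l \<noteq> j" "l \<noteq> k" for l
    using that \<pi> permutes_inj[OF \<pi>(1)] by (metis injD)+
  have "?h * g = cyc3 n * ?h"
  proof (rule Grn_eqI)
    fix l assume l: "l < n"
    have \<pi>n: "\<pi> l < n" using permutes_in_image[OF \<pi>(1)] l by simp
    show "perm_of n (?h * g) l = perm_of n (cyc3 n * ?h) l"
      unfolding perm_mult[OF h(1) gG l] perm_mult[OF cG h(1) l]
    proof -
      have c': "perm_of n (cyc3 n) 0 = 1" "perm_of n (cyc3 n) 1 = 2" "perm_of n (cyc3 n) 2 = 0"
        "l \<noteq> i \<Longrightarrow> l \<noteq> j \<Longrightarrow> l \<noteq> k \<Longrightarrow> perm_of n (cyc3 n) (\<pi> l) = \<pi> l"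
        using c \<pi>l[of l] \<pi>n by (simp_all add: cycles_def)
      consider "l = i" | "l = j" | "l = k" | "l \<noteq> i" "l \<noteq> j" "l \<noteq> k" by blast
      thus "perm_of n ?h (perm_of n g l) = perm_of n (cyc3 n) (perm_of n ?h l)"
        by cases (use c' gi \<pi> h(2) l ijk in simp_all)
    qed
    have nz: "entry n g i \<noteq> 0" using entry_nz[OF gG ijk(1)] .
    show "entry n (?h * g) l = entry n (cyc3 n * ?h) l"
      unfolding entry_mult[OF h(1) gG l] entry_mult[OF cG h(1) l] h(2)[OF l] entry_cyc3[OF n \<pi>n]
    proof -
      have e: "entry n ?h i = 1" "entry n ?h j = inverse (entry n g i)" "entry n ?h k = entry n g k"
        "l \<noteq> i \<Longrightarrow> l \<noteq> j \<Longrightarrow> l \<noteq> k \<Longrightarrow> entry n ?h l = 1"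
        using h(3)[OF ijk(1)] h(3)[OF ijk(2)] h(3)[OF ijk(3)] h(3)[OF l] ijk by simp_all
      have "entry n g i * (entry n g k * entry n g j) = 1"
        using gi(4) by (simp add: mult_ac)
      hence "entry n g k * entry n g j = inverse (entry n g i)"
        by (rule inverse_unique[symmetric])
      note eq = this e gi(1-3) gi(5)[OF l] nz
      consider "l = i" | "l = j" | "l = k" | "l \<noteq> i" "l \<noteq> j" "l \<noteq> k" by blast
      thus "entry n ?h (perm_of n g l) * entry n g l = 1 * entry n ?h l"
        by cases (use eq in simp_all)
    qed
  qed (use h gG cG in auto)
  hence "inv\<^bsub>G\<^esub> ?h * (?h * g) = inv\<^bsub>G\<^esub> ?h * (cyc3 n * ?h)" by simp
  hence "g = inv\<^bsub>G\<^esub> ?h * cyc3 n * ?h"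
    using h(1) gG cG by (simp add: mult_assoc) (simp add: left_mult_one_mat[OF Grn_carrier_mat] flip: mult_assoc)
  thus ?thesis using that h \<pi> ijk by simp
qed


section \<open>Generation by simple reflections and diagonal matrices\<close>

lemma primitive_root_inj:
  assumes "primitive_root_of_unity r \<xi>"
  shows "inj_on (\<lambda>a. \<xi> ^ a) {..<r}"
proof (rule linorder_inj_onI)
  fix a b assume ab: "a < b" "b \<in> {..<r}"
  have "\<xi> \<noteq> 0" using assms r_pos by (auto simp: primitive_root_of_unity_def power_0_left)
  moreover have "\<xi> ^ b = \<xi> ^ a * \<xi> ^ (b - a)" using ab by (simp flip: power_add)
  moreover have "\<xi> ^ (b - a) \<noteq> 1" using assms ab by (auto simp: primitive_root_of_unity_def)
  ultimately show "\<xi> ^ a \<noteq> \<xi> ^ b" by simp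
qed auto

text \<open>The powers with exponent below r are r distinct solutions of an equation with exactly r
  solutions.\<close>

lemma primitive_root_ex:
  assumes "primitive_root_of_unity r \<xi>" "z ^ r = 1"
  shows "\<exists>a<r. z = \<xi> ^ a"
proof -
  have \<xi>: "\<xi> ^ r = 1" "\<And>k. 0 < k \<Longrightarrow> k < r \<Longrightarrow> \<xi> ^ k \<noteq> 1"
    using assms by (auto simp: primitive_root_of_unity_def)
  have "card {z :: complex. z ^ r = 1} = r" using r_pos by (intro card_roots_unity_eq) auto
  moreover have "card ((\<lambda>a. \<xi> ^ a) ` {..<r}) = r"
    using primitive_root_inj[OF assms(1)] by (simp add: card_image)
  moreover have "(\<lambda>a. \<xi> ^ a) ` {..<r} \<subseteq> {z. z ^ r = 1}"
    using \<xi>(1) by (auto simp: power_commutes power_mult[symmetric]) (simp add: mult.commute[of _ r] power_mult)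
  moreover have "finite {z :: complex. z ^ r = 1}" using r_pos by (intro finite_roots_unity) auto
  ultimately have "(\<lambda>a. \<xi> ^ a) ` {..<r} = {z. z ^ r = 1}" by (intro card_subset_eq) auto
  thus ?thesis using assms(2) by blast
qed

lemma perm_mat_monomial: "perm_mat n \<sigma> = monomial n \<sigma> (\<lambda>_. 1)"
  by (simp add: perm_mat_def monomial_def)

lemma perm_mat_Grn:
  assumes "\<sigma> permutes {..<n}"
  shows "perm_mat n \<sigma> \<in> carrier G" "\<And>j. j < n \<Longrightarrow> perm_of n (perm_mat n \<sigma>) j = \<sigma> j"
    "\<And>j. j < n \<Longrightarrow> entry n (perm_mat n \<sigma>) j = 1"
  using monomial_Grn[of \<sigma> "\<lambda>_. 1"] permutes_in_image[OF assms] permutes_inj_on[OF assms]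
  by (auto simp: perm_mat_monomial)

lemma xi_mat_Grn:
  assumes "\<xi> ^ r = 1"
  shows "xi_mat n \<xi> i \<in> carrier G" "\<And>j. j < n \<Longrightarrow> perm_of n (xi_mat n \<xi> i) j = j"
    "\<And>j. j < n \<Longrightarrow> entry n (xi_mat n \<xi> i) j = (if j = i then \<xi> else 1)"
proof -
  have "xi_mat n \<xi> i = monomial n (\<lambda>j. j) (\<lambda>j. if j = i then \<xi> else 1)"
    by (rule eq_matI) (auto simp: xi_mat_def mat_diag_def monomial_def)
  thus "xi_mat n \<xi> i \<in> carrier G" "\<And>j. j < n \<Longrightarrow> perm_of n (xi_mat n \<xi> i) j = j"
    "\<And>j. j < n \<Longrightarrow> entry n (xi_mat n \<xi> i) j = (if j = i then \<xi> else 1)"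
    using monomial_Grn[of "\<lambda>j. j" "\<lambda>j. if j = i then \<xi> else 1"] assms by auto
qed

lemma perm_mat_comp:
  assumes "\<sigma> permutes {..<n}" "\<tau> permutes {..<n}"
  shows "perm_mat n (\<sigma> \<circ> \<tau>) = perm_mat n \<sigma> * perm_mat n \<tau>"
proof (rule Grn_eqI)
  note 1 = perm_mat_Grn[OF assms(1)] and 2 = perm_mat_Grn[OF assms(2)]
  note 3 = perm_mat_Grn[OF permutes_compose[OF assms(2,1)]]
  show "perm_mat n (\<sigma> \<circ> \<tau>) \<in> carrier G" "perm_mat n \<sigma> * perm_mat n \<tau> \<in> carrier G"
    using 1 2 3 by simp_all
  fix j assume j: "j < n"
  have \<tau>j: "\<tau> j < n" using permutes_in_image[OF assms(2)] j by simp
  show "perm_of n (perm_mat n (\<sigma> \<circ> \<tau>)) j = perm_of n (perm_mat n \<sigma> * perm_mat n \<tau>) j"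
    using 1(2)[OF \<tau>j] 2(2)[OF j] 3(2)[OF j] perm_mult[OF 1(1) 2(1) j] by simp
  show "entry n (perm_mat n (\<sigma> \<circ> \<tau>)) j = entry n (perm_mat n \<sigma> * perm_mat n \<tau>) j"
    using 1(3)[OF \<tau>j] 2(2,3)[OF j] 3(3)[OF j] entry_mult[OF 1(1) 2(1) j] by simp
qed

text \<open>Every element is a diagonal matrix times a permutation matrix; the former is a product
  of powers of the \<open>xi_mat n \<xi> i\<close>, the latter a product of transpositions. The
  relations of \<open>H_star\<close> between the group and the v_i concern only these generators,
  and this rule extends their consequences to the whole group.\<close>

lemma Grn_induct [consumes 2, case_names one xi simple mult]:
  assumes prim: "primitive_root_of_unity r \<xi>" and g: "g \<in> carrier G"
    and one: "P (1\<^sub>m n)" and xi: "\<And>i. i < n \<Longrightarrow> P (xi_mat n \<xi> i)"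
    and simple: "\<And>i. Suc i < n \<Longrightarrow> P (simple_refl n i)"
    and mult: "\<And>g h. g \<in> carrier G \<Longrightarrow> h \<in> carrier G \<Longrightarrow> P g \<Longrightarrow> P h \<Longrightarrow> P (g * h)"
  shows "P g"
proof -
  have \<xi>: "\<xi> ^ r = 1" using prim by (simp add: primitive_root_of_unity_def)
  let ?D = "\<lambda>d. monomial n (\<lambda>j. j) d"
  have D: "?D d \<in> carrier G" "j < n \<Longrightarrow> perm_of n (?D d) j = j" "j < n \<Longrightarrow> entry n (?D d) j = d j"
    if "\<And>j. j < n \<Longrightarrow> d j ^ r = 1" for d j
    using monomial_Grn[of "\<lambda>j. j" d] that by auto
  have Dmult: "?D d * ?D e = ?D (\<lambda>j. d j * e j)"
    if "\<And>j. j < n \<Longrightarrow> d j ^ r = 1" "\<And>j. j < n \<Longrightarrow> e j ^ r = 1" for d e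
    using that D[of d] D[of e] D[of "\<lambda>j. d j * e j"]
    by (intro Grn_eqI) (simp_all add: perm_mult entry_mult power_mult_distrib)
  have D1: "?D (\<lambda>j. 1) = 1\<^sub>m n"
    using D[of "\<lambda>j. 1"] by (intro Grn_eqI) simp_all
  have pow: "(\<xi> ^ a) ^ r = 1" for a
    using \<xi> by (metis mult.commute power_mult power_one)
  have single: "P (?D (\<lambda>j. if j = i then \<xi> ^ a else 1))" if "i < n" for i a
  proof (induction a)
    case 0
    have "(\<lambda>j. if j = i then \<xi> ^ 0 else 1) = (\<lambda>j. 1)" by auto
    thus ?case using one D1 by simp
  next
    case (Suc a)
    have "xi_mat n \<xi> i = ?D (\<lambda>j. if j = i then \<xi> else 1)"
      by (rule eq_matI) (auto simp: xi_mat_def mat_diag_def monomial_def)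
    moreover have "(\<lambda>j. (if j = i then \<xi> else 1) * (if j = i then \<xi> ^ a else 1)) =
        (\<lambda>j. if j = i then \<xi> ^ Suc a else 1)" by auto
    ultimately have "?D (\<lambda>j. if j = i then \<xi> ^ Suc a else 1) =
        xi_mat n \<xi> i * ?D (\<lambda>j. if j = i then \<xi> ^ a else 1)"
      using Dmult[of "\<lambda>j. if j = i then \<xi> else 1" "\<lambda>j. if j = i then \<xi> ^ a else 1"] \<xi> pow by simp
    thus ?case using mult[OF xi_mat_Grn(1)[OF \<xi>] D(1) xi[OF that] Suc] pow by simp
  qed
  have diag_upto: "P (?D (\<lambda>j. if j < m then d j else 1))"
    if d: "\<And>j. j < n \<Longrightarrow> d j ^ r = 1" and m: "m \<le> n" for d m
    using m
  proof (induction m)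
    case 0
    thus ?case using one D1 by simp
  next
    case (Suc m)
    obtain a where a: "d m = \<xi> ^ a" using primitive_root_ex[OF prim d[of m]] Suc by auto
    have "(\<lambda>j. (if j = m then \<xi> ^ a else 1) * (if j < m then d j else 1)) =
        (\<lambda>j. if j < Suc m then d j else 1)" using a by (auto simp: less_Suc_eq)
    hence eq: "?D (\<lambda>j. if j < Suc m then d j else 1) =
        ?D (\<lambda>j. if j = m then \<xi> ^ a else 1) * ?D (\<lambda>j. if j < m then d j else 1)"
      using Dmult[of "\<lambda>j. if j = m then \<xi> ^ a else 1" "\<lambda>j. if j < m then d j else 1"] d pow by simp
    show ?case unfolding eq
      by (rule mult[OF D(1) D(1)]) (use single[of m a] Suc d pow in auto)
  qed
  have diag: "P (?D d)" if d: "\<And>j. j < n \<Longrightarrow> d j ^ r = 1" for d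
  proof -
    have "?D d = ?D (\<lambda>j. if j < n then d j else 1)" by (rule eq_matI) (auto simp: monomial_def)
    thus ?thesis using diag_upto[OF d, where m = n] by simp
  qed
  have swap: "Transposition.transpose a b permutes {..<n}" if "a < n" "b < n" for a b
    using that by (auto intro: permutes_swap_id)
  have adj: "P (perm_mat n (Transposition.transpose a (a + Suc d)))" if "a + Suc d < n" for a d
    using that
  proof (induction d)
    case 0
    thus ?case using simple[of a] by (simp add: simple_refl_def)
  next
    case (Suc d)
    let ?b = "a + Suc d"
    let ?t = "Transposition.transpose ?b (Suc ?b)" and ?u = "Transposition.transpose a ?b"
    have perms: "?t permutes {..<n}" "?u permutes {..<n}" using Suc.prems by (auto intro!: swap)
    \<comment> \<open>Conjugating (a b) by the simple transposition of b and b + 1 moves its upper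
      end one step further.\<close>
    have "Transposition.transpose a (a + Suc (Suc d)) = ?t \<circ> (?u \<circ> ?t)"
      by (auto simp: fun_eq_iff transpose_def)
    moreover have "P (perm_mat n (?t \<circ> (?u \<circ> ?t)))"
      unfolding perm_mat_comp[OF perms(1) permutes_compose[OF perms(1,2)]] perm_mat_comp[OF perms(2,1)]
      using Suc simple[of ?b] perm_mat_Grn(1)[OF perms(1)] perm_mat_Grn(1)[OF perms(2)]
      by (intro mult mult_closed) (auto simp: simple_refl_def)
    ultimately show ?case by (rule ssubst[where P = "\<lambda>x. P (perm_mat n x)"])
  qed
  have trans: "P (perm_mat n (Transposition.transpose a b))" if ab: "a < n" "b < n" "a \<noteq> b" for a b
  proof (cases "a < b")
    case True
    thus ?thesis using adj[of a "b - Suc a"] ab by simp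
  next
    case False
    thus ?thesis using adj[of b "a - Suc b"] ab by (simp add: transpose_commute)
  qed
  have perm: "P (perm_mat n \<sigma>)" if "\<sigma> permutes {..<n}" for \<sigma>
    using that finite_lessThan
  proof (induction \<sigma> rule: permutes_induct)
    case id
    have "perm_mat n id = 1\<^sub>m n" by (rule eq_matI) (auto simp: perm_mat_def)
    thus ?case using one by (simp add: id_def)
  next
    case (swap a b p)
    have t: "Transposition.transpose a b permutes {..<n}" using swap by (intro permutes_swap_id) auto
    have p: "p permutes {..<n}" by fact
    show ?case unfolding perm_mat_comp[OF t p]
      using trans[of a b] swap perm_mat_Grn(1)[OF t] perm_mat_Grn(1)[OF p] by (intro mult) auto
  qed
  define \<sigma> where "\<sigma> k = (if k < n then perm_of n g k else k)" for k
  have "inj_on \<sigma> {..<n}" using g by (auto simp: inj_on_def \<sigma>_def perm_inj)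
  moreover have "\<sigma> ` {..<n} \<subseteq> {..<n}" using g by (auto simp: \<sigma>_def)
  ultimately have "bij_betw \<sigma> {..<n} {..<n}"
    using endo_inj_surj[of "{..<n}" \<sigma>] by (simp add: bij_betw_def)
  hence \<sigma>: "\<sigma> permutes {..<n}" by (rule bij_imp_permutes) (simp add: \<sigma>_def)
  \<comment> \<open>The diagonal factor stands on the left and acts after the permutation. Its
    entries are indexed by the image of a column, hence the inverse of g.\<close>
  define d where "d i = entry n g (perm_of n (inv\<^bsub>G\<^esub> g) i)" for i
  have d: "d i ^ r = 1" if "i < n" for i
    unfolding d_def using g that by (intro entry_root) auto
  have Dd: "?D d \<in> carrier G" "\<And>j. j < n \<Longrightarrow> perm_of n (?D d) j = j"
    "\<And>j. j < n \<Longrightarrow> entry n (?D d) j = d j"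
    using D[where d = d, OF d] by blast+
  note S = perm_mat_Grn[OF \<sigma>]
  have "g = ?D d * perm_mat n \<sigma>"
  proof (rule Grn_eqI)
    fix j assume j: "j < n"
    have \<sigma>j: "\<sigma> j = perm_of n g j" "\<sigma> j < n" using g j by (simp_all add: \<sigma>_def)
    show "perm_of n g j = perm_of n (?D d * perm_mat n \<sigma>) j"
      using perm_mult[OF Dd(1) S(1) j] S(2)[OF j] Dd(2)[OF \<sigma>j(2)] \<sigma>j by simp
    show "entry n g j = entry n (?D d * perm_mat n \<sigma>) j"
      using entry_mult[OF Dd(1) S(1) j] S(2,3)[OF j] Dd(3)[OF \<sigma>j(2)] \<sigma>j g j
      by (simp add: d_def perm_inv)
  qed (use g Dd S in auto)
  moreover have "P (?D d * perm_mat n \<sigma>)"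
    by (rule mult[OF Dd(1) S(1) diag[OF d] perm[OF \<sigma>]])
  ultimately show "P g" by (rule ssubst)
qed

lemma diag_pow:
  assumes x: "x \<in> carrier G" "\<And>j. j < n \<Longrightarrow> perm_of n x j = j" and j: "j < n"
  shows "perm_of n (x [^]\<^bsub>G\<^esub> a) j = j \<and> entry n (x [^]\<^bsub>G\<^esub> a) j = entry n x j ^ (a :: nat)"
proof (induction a)
  case (Suc a)
  have "x [^]\<^bsub>G\<^esub> a \<in> carrier G" using x by simp
  thus ?case using Suc x j by (simp add: perm_mult entry_mult)
qed (use j in simp)

text \<open>For \<open>j = i + 1\<close> this is the \<open>a\<close>-th summand of the relation for \<open>s\<^sub>i v\<^sub>i\<^sub>+\<^sub>1\<close>, times \<open>s\<^sub>i\<close>.\<close>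

definition twisted_refl :: "complex \<Rightarrow> nat \<Rightarrow> nat \<Rightarrow> nat \<Rightarrow> complex mat" where
  "twisted_refl \<xi> i j a = (xi_mat n \<xi> i [^]\<^bsub>G\<^esub> a) * ((inv\<^bsub>G\<^esub> (xi_mat n \<xi> j)) [^]\<^bsub>G\<^esub> a) *
     perm_mat n (Transposition.transpose i j)"

text \<open>The transposition acts first and moves j to i, where the power of
  \<open>xi_mat n \<xi> i\<close> contributes; so the entry at j is \<xi> to the power a. A
  reflection is determined by this entry, and the powers of \<xi> below r run through all r-th roots
  of unity once.\<close>

lemma bij_twisted_refl:
  assumes prim: "primitive_root_of_unity r \<xi>" and ij: "i < n" "j < n" "i \<noteq> j"
  shows "bij_betw (twisted_refl \<xi> i j) {..<r} (refls i j)"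
proof -
  have \<xi>: "\<xi> ^ r = 1" using prim by (simp add: primitive_root_of_unity_def)
  have \<xi>0: "\<xi> \<noteq> 0" using \<xi> r_pos by (auto simp: power_0_left)
  let ?x = "xi_mat n \<xi> i" and ?y = "inv\<^bsub>G\<^esub> (xi_mat n \<xi> j)"
  note xi = xi_mat_Grn[OF \<xi>]
  have y: "?y \<in> carrier G" using xi(1) by simp
  have py: "perm_of n ?y k = k" if "k < n" for k using perm_inv(1)[OF xi(1)[of j] that] xi(2)[OF that] by simp
  have ey: "entry n ?y k = (if k = j then inverse \<xi> else 1)" if "k < n" for k
    using entry_inv[OF xi(1)[of j] that] xi(2,3)[OF that] by simp
  note px = diag_pow[OF xi(1)[of i] xi(2)] and qy = diag_pow[OF y py]
  have c: "?x [^]\<^bsub>G\<^esub> a \<in> carrier G" "?y [^]\<^bsub>G\<^esub> a \<in> carrier G" for a :: nat using xi(1) y by simp_all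
  have t: "Transposition.transpose i j permutes {..<n}" using ij by (intro permutes_swap_id) auto
  note pt = perm_mat_Grn[OF t]
  have tl: "Transposition.transpose i j k < n" if "k < n" for k using that ij by (auto simp: transpose_def)
  have tw: "twisted_refl \<xi> i j a \<in> carrier G"
    "k < n \<Longrightarrow> perm_of n (twisted_refl \<xi> i j a) k = Transposition.transpose i j k"
    "k < n \<Longrightarrow> entry n (twisted_refl \<xi> i j a) k =
      (if k = j then \<xi> ^ a else if k = i then inverse \<xi> ^ a else 1)" for a k
    unfolding twisted_refl_def using ij c[of a] pt tl px qy xi(3) ey
    by (simp_all add: perm_mult entry_mult)
  have mem: "twisted_refl \<xi> i j a \<in> refls i j" for a
    using tw[where a = a] ij \<xi>0 by (auto simp: refls_def simp flip: power_mult_distrib)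
  show ?thesis
    unfolding bij_betw_def
  proof
    show "inj_on (twisted_refl \<xi> i j) {..<r}"
    proof (rule inj_onI)
      fix a b assume ab: "a \<in> {..<r}" "b \<in> {..<r}" "twisted_refl \<xi> i j a = twisted_refl \<xi> i j b"
      hence "\<xi> ^ a = \<xi> ^ b"
        using tw(3)[OF ij(2), where a = a] tw(3)[OF ij(2), where a = b] by simp
      thus "a = b" using inj_onD[OF primitive_root_inj[OF prim]] ab by blast
    qed
    show "twisted_refl \<xi> i j ` {..<r} = refls i j"
    proof
      show "twisted_refl \<xi> i j ` {..<r} \<subseteq> refls i j" using mem by blast
      show "refls i j \<subseteq> twisted_refl \<xi> i j ` {..<r}"
      proof
        fix x assume x: "x \<in> refls i j"
        obtain a where a: "a < r" "entry n x j = \<xi> ^ a"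
          using primitive_root_ex[OF prim entry_root[OF refls_Grn[OF x] ij(2)]] by blast
        have "x = twisted_refl \<xi> i j a"
          using x mem[of a] a tw(3)[OF ij(2), where a = a] unfolding refls_commute[of i j]
          by (intro refls_eqI[of x j i]) simp_all
        thus "x \<in> twisted_refl \<xi> i j ` {..<r}" using a by blast
      qed
    qed
  qed
qed

end


section \<open>Computations in a representation of \<open>G(r,1,n)\<close> in an algebra\<close>

locale Grn_rep = complex_algebra R + Grn_group r n
  for R :: "(complex, 'a, 'm) module_scheme" (structure) and r n +
  fixes T :: "complex mat \<Rightarrow> 'a"
  assumes T_closed [simp]: "g \<in> carrier (Grn r n) \<Longrightarrow> T g \<in> carrier R"
    and T_one: "T (1\<^sub>m n) = \<one>"
    and T_mult: "g \<in> carrier (Grn r n) \<Longrightarrow> h \<in> carrier (Grn r n) \<Longrightarrow> T (g * h) = T g \<otimes> T h"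
begin

section \<open>Sums of reflections and their products\<close>

definition S :: "nat \<Rightarrow> nat \<Rightarrow> 'a" where
  "S i j = (\<Oplus>g\<in>refls i j. T g)"

lemma finite_refls: "finite (refls i j)"
  by (rule finite_subset[OF _ finite_Grn]) (auto simp: refls_def)

lemma finite_cycles: "finite (cycles i j k)"
  by (rule finite_subset[OF _ finite_Grn]) (auto simp: cycles_def)

lemma S_closed [simp]: "S i j \<in> carrier R"
  unfolding S_def by (intro finsum_closed) (auto intro: T_closed refls_Grn)

lemma S_commute: "S i j = S j i"
  unfolding S_def by (simp add: refls_commute)

lemma T_S:
  assumes g: "g \<in> carrier G" and ij: "i < n" "j < n" "i \<noteq> j"
  shows "T g \<otimes> S i j = S (perm_of n g i) (perm_of n g j) \<otimes> T g"
proof -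
  let ?c = "\<lambda>h. g * h * inv\<^bsub>G\<^esub> g"
  have Th: "T h \<in> carrier R" if "h \<in> refls k l" for h k l using that by (intro T_closed refls_Grn)
  have cG: "?c h \<in> carrier G" if "h \<in> refls i j" for h
    using g refls_Grn[OF that] by simp
  have eq: "?c h * g = g * h" if "h \<in> refls i j" for h
    using that g refls_Grn[OF that] by (simp add: mult_assoc right_mult_one_mat[OF Grn_carrier_mat])
  have inj: "inj_on ?c (refls i j)"
  proof (rule inj_onI)
    fix h k assume hk: "h \<in> refls i j" "k \<in> refls i j" "?c h = ?c k"
    have "g * h = g * k"
      using eq[OF hk(1)] eq[OF hk(2)] unfolding hk(3) by (rule trans[OF sym])
    hence "g \<otimes>\<^bsub>G\<^esub> h = g \<otimes>\<^bsub>G\<^esub> k" unfolding Grn_simps .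
    thus "h = k" using inj_onD[OF G.inj_on_cmult[OF g]] refls_Grn hk by blast
  qed
  have "S (perm_of n g i) (perm_of n g j) = (\<Oplus>h\<in>refls i j. T (?c h))"
    unfolding S_def refls_conj_image[OF g ij, symmetric] using cG inj
    by (intro finsum_reindex) (auto intro: T_closed)
  moreover have "(\<Oplus>h\<in>refls i j. T (?c h)) \<otimes> T g = (\<Oplus>h\<in>refls i j. T (?c h) \<otimes> T g)"
    using g finite_refls cG by (intro finsum_ldistr) (auto intro: T_closed)
  ultimately have "S (perm_of n g i) (perm_of n g j) \<otimes> T g = (\<Oplus>h\<in>refls i j. T (?c h) \<otimes> T g)"
    by simp
  also have "\<dots> = (\<Oplus>h\<in>refls i j. T g \<otimes> T h)"
  proof (intro finsum_cong' refl)
    fix h assume h: "h \<in> refls i j"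
    have "?c h \<in> carrier G" using g refls_Grn[OF h] by simp
    thus "T (?c h) \<otimes> T g = T g \<otimes> T h"
      using T_mult[of "?c h" g] T_mult[OF g refls_Grn[OF h]] eq[OF h] g by simp
  qed (use g Th in auto)
  also have "\<dots> = T g \<otimes> S i j"
    unfolding S_def using g Th finite_refls by (subst finsum_rdistr) auto
  finally show ?thesis by simp
qed

text \<open>The element y must be the same for every reflection in the sum. This is available
  because all members of \<open>refls i j\<close> lie over one transposition, so that S i j permutes
  indexed families just as that transposition does.\<close>

lemma S_intertwine:
  assumes x: "x \<in> carrier R" and y: "y \<in> carrier R"
    and eq: "\<And>g. g \<in> refls i j \<Longrightarrow> T g \<otimes> x = y \<otimes> T g"
  shows "S i j \<otimes> x = y \<otimes> S i j"
proof -
  have T: "T \<in> refls i j \<rightarrow> carrier R" by (auto intro: T_closed refls_Grn)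
  have "S i j \<otimes> x = (\<Oplus>g\<in>refls i j. T g \<otimes> x)"
    unfolding S_def using T x finite_refls by (intro finsum_ldistr) auto
  also have "\<dots> = (\<Oplus>g\<in>refls i j. y \<otimes> T g)"
    using T y eq by (intro finsum_cong') auto
  also have "\<dots> = y \<otimes> S i j"
    unfolding S_def using T y finite_refls by (intro finsum_rdistr[symmetric]) auto
  finally show ?thesis .
qed

lemma S_S:
  assumes ij: "i < n" "j < n" "i \<noteq> j" and kl: "k < n" "l < n" "k \<noteq> l"
  shows "S i j \<otimes> S k l = S (Transposition.transpose i j k) (Transposition.transpose i j l) \<otimes> S i j"
  using T_S[OF refls_Grn kl] refls_perm kl by (intro S_intertwine) auto

text \<open>The transposition (i j) conjugates (j k) to (i k). Applied repeatedly, this reduces all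
  products of two different sums among S i j, S j k, S i k to just two elements, one for each
  orientation of the triangle.\<close>

lemma S_rotate:
  assumes "i < n" "j < n" "k < n" "i \<noteq> j" "j \<noteq> k" "i \<noteq> k"
  shows "S i j \<otimes> S j k = S k i \<otimes> S i j"
  using S_S[of i j j k] assms by (simp add: S_commute)

lemma S_disjoint:
  assumes "i < n" "j < n" "k < n" "l < n" "i \<noteq> j" "k \<noteq> l" "i \<noteq> k" "i \<noteq> l" "j \<noteq> k" "j \<noteq> l"
  shows "S i j \<otimes> S k l = S k l \<otimes> S i j"
  using S_S[of i j k l] assms by simp

text \<open>The factorization in \<open>mult_refls_image\<close> is unique, so the expanded product
  meets every cycle exactly once.\<close>

lemma S_mult_cycles:
  assumes ijk: "i < n" "j < n" "k < n" "i \<noteq> j" "j \<noteq> k" "i \<noteq> k"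
  shows "S i j \<otimes> S j k = (\<Oplus>g\<in>cycles i j k. T g)"
proof -
  note im = mult_refls_image[OF ijk]
  have T: "T \<in> refls a b \<rightarrow> carrier R" for a b by (auto intro: T_closed refls_Grn)
  have Tm: "T (x * y) = T x \<otimes> T y" if "x \<in> refls i j" "y \<in> refls j k" for x y
    using that by (intro T_mult refls_Grn)
  have "(\<Oplus>g\<in>cycles i j k. T g) = (\<Oplus>x\<in>refls i j. \<Oplus>g\<in>(\<lambda>y. x * y) ` refls j k. T g)"
    unfolding im(1)[symmetric]
  proof (rule add.finprod_UN_disjoint)
    show "pairwise (\<lambda>x x'. disjnt ((\<lambda>y. x * y) ` refls j k) ((\<lambda>y. x' * y) ` refls j k)) (refls i j)"
      unfolding pairwise_def disjnt_def using im(2) by blast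
  qed (use finite_refls refls_Grn in \<open>auto intro!: T_closed mult_closed\<close>)
  also have "\<dots> = (\<Oplus>x\<in>refls i j. \<Oplus>y\<in>refls j k. T x \<otimes> T y)"
  proof (rule finsum_cong'[OF refl])
    fix x assume x: "x \<in> refls i j"
    have "(\<Oplus>g\<in>(\<lambda>y. x * y) ` refls j k. T g) = (\<Oplus>y\<in>refls j k. T (x * y))"
      using x im(2)[OF x _ x] refls_Grn
      by (intro finsum_reindex) (auto intro!: T_closed mult_closed inj_onI)
    also have "\<dots> = (\<Oplus>y\<in>refls j k. T x \<otimes> T y)"
      using x T Tm by (intro finsum_cong') auto
    finally show "(\<Oplus>g\<in>(\<lambda>y. x * y) ` refls j k. T g) = (\<Oplus>y\<in>refls j k. T x \<otimes> T y)" .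
  qed (use T in \<open>auto intro!: finsum_closed\<close>)
  also have "\<dots> = (\<Oplus>x\<in>refls i j. T x \<otimes> S j k)"
    unfolding S_def using T finite_refls
    by (intro finsum_cong') (auto intro!: finsum_rdistr[symmetric] finsum_closed)
  also have "\<dots> = S i j \<otimes> S j k"
    unfolding S_def[of i j] using T finite_refls by (intro finsum_ldistr[symmetric]) auto
  finally show ?thesis ..
qed

section \<open>The elements M_i and their commutators\<close>

definition eps :: "nat \<Rightarrow> nat \<Rightarrow> complex" where
  "eps i l = (if i < l then 1/2 else if l < i then - 1/2 else 0)"

text \<open>The weight 0 on the diagonal discards \<open>S i i\<close>, which is not a sum of
  reflections: for i < n the set \<open>refls i i\<close> contains the identity.\<close>

definition M :: "nat \<Rightarrow> 'a" where
  "M i = (\<Oplus>l\<in>{..<n}. eps i l \<odot> S i l)"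

definition comm :: "'a \<Rightarrow> 'a \<Rightarrow> 'a" where
  "comm x y = x \<otimes> y \<ominus> y \<otimes> x"

text \<open>For distinct i, j < n this is the sum of the conjugates of the three-cycle that send i
  to j, minus the sum of those that send j to i. Both the commutators of the M's and the right-hand
  sides of the relations of A are multiples of it.\<close>

definition C :: "nat \<Rightarrow> nat \<Rightarrow> 'a" where
  "C i j = (\<Oplus>k\<in>{..<n} - {i, j}. comm (S i j) (S j k))"

lemma M_closed [simp]: "M i \<in> carrier R"
  unfolding M_def by (intro finsum_closed) auto

lemma comm_closed [simp]: "x \<in> carrier R \<Longrightarrow> y \<in> carrier R \<Longrightarrow> comm x y \<in> carrier R"
  by (simp add: comm_def)

lemma C_closed [simp]: "C i j \<in> carrier R"
  unfolding C_def by (intro finsum_closed) auto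

lemma comm_smult:
  "x \<in> carrier R \<Longrightarrow> y \<in> carrier R \<Longrightarrow> comm (c \<odot> x) (d \<odot> y) = (c * d) \<odot> comm x y"
  by (simp add: comm_def smult_mult_left smult_mult_right smult_smult smult_diff_right mult.commute)

lemma comm_eq_0: "x \<in> carrier R \<Longrightarrow> y \<in> carrier R \<Longrightarrow> x \<otimes> y = y \<otimes> x \<Longrightarrow> comm x y = \<zero>"
  by (simp add: comm_def a_minus_def r_neg)

lemma comm_finsum_left:
  assumes "finite I" "f \<in> I \<rightarrow> carrier R" "y \<in> carrier R"
  shows "comm (\<Oplus>i\<in>I. f i) y = (\<Oplus>i\<in>I. comm (f i) y)"
proof -
  have "comm (\<Oplus>i\<in>I. f i) y = (\<Oplus>i\<in>I. f i \<otimes> y) \<ominus> (\<Oplus>i\<in>I. y \<otimes> f i)"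
    unfolding comm_def using finsum_ldistr[of I y f] finsum_rdistr[of I y f] assms by simp
  also have "\<dots> = (\<Oplus>i\<in>I. f i \<otimes> y \<ominus> y \<otimes> f i)"
    using assms by (intro finsum_diff[symmetric]) auto
  finally show ?thesis by (simp add: comm_def)
qed

lemma comm_finsum_right:
  assumes "finite I" "f \<in> I \<rightarrow> carrier R" "y \<in> carrier R"
  shows "comm y (\<Oplus>i\<in>I. f i) = (\<Oplus>i\<in>I. comm y (f i))"
proof -
  have "comm y (\<Oplus>i\<in>I. f i) = (\<Oplus>i\<in>I. y \<otimes> f i) \<ominus> (\<Oplus>i\<in>I. f i \<otimes> y)"
    unfolding comm_def using finsum_ldistr[of I y f] finsum_rdistr[of I y f] assms by simp
  also have "\<dots> = (\<Oplus>i\<in>I. y \<otimes> f i \<ominus> f i \<otimes> y)"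
    using assms by (intro finsum_diff[symmetric]) auto
  finally show ?thesis by (simp add: comm_def)
qed

lemma comm_swap: "x \<in> carrier R \<Longrightarrow> y \<in> carrier R \<Longrightarrow> comm y x = \<ominus> comm x y"
  by (simp add: comm_def a_minus_def minus_add a_comm)

text \<open>Put x = sgn(j - i), y = sgn(k - j) and z = sgn(i - k). In a linear order these three
  signs are not all equal, so x + y + z is 1 or -1, and squaring gives xy + yz + zx = -1. The
  left-hand side is a quarter of this.\<close>

lemma eps_identity:
  assumes "i \<noteq> j" "j \<noteq> k" "i \<noteq> k"
  shows "eps i j * eps j k + eps i k * eps j i - eps i k * eps j k = - 1/4"
  using assms by (auto simp: eps_def)

lemma eps_self [simp]: "eps i i = 0" by (simp add: eps_def)

lemma finsum_only:
  assumes "finite I" "J \<subseteq> I" "f \<in> I \<rightarrow> carrier R" "\<And>i. i \<in> I - J \<Longrightarrow> f i = \<zero>"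
  shows "(\<Oplus>i\<in>I. f i) = (\<Oplus>i\<in>J. f i)"
  using assms by (intro add.finprod_mono_neutral_cong_right) auto

text \<open>After expansion, each third index k contributes the index pairs (j, k), (k, k) and (k,
  i). By \<open>S_rotate\<close> all three commutators equal the one of S i j and S j k up to sign,
  and \<open>eps_identity\<close> adds up their weights.\<close>

lemma comm_M_M:
  assumes ij: "i < n" "j < n" "i \<noteq> j"
  shows "comm (M i) (M j) = (- 1/4) \<odot> C i j"
proof -
  define b where "b k l = comm (eps i k \<odot> S i k) (eps j l \<odot> S j l)" for k l
  let ?K = "{..<n} - {i, j}"
  have b: "b k l = (eps i k * eps j l) \<odot> comm (S i k) (S j l)" for k l
    by (simp add: b_def comm_smult)
  have bc [simp]: "b k l \<in> carrier R" for k l by (simp add: b)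
  \<comment> \<open>A weight vanishes if k = i or l = j. Otherwise either {i, k} and {j, l} are
    disjoint, so that the two sums commute, or k = j and l = i, where the two sums coincide.\<close>
  have b0: "b k l = \<zero>" if "k < n" "l < n" "k \<noteq> l" "k \<noteq> j \<or> l = i" "l \<noteq> i \<or> k = j" for k l
  proof (cases "k = i \<or> l = j")
    case True
    thus ?thesis by (auto simp: b)
  next
    case False
    hence "S i k \<otimes> S j l = S j l \<otimes> S i k"
      using that S_disjoint[of i k j l] ij S_commute[of i j] by (cases "k = j") auto
    thus ?thesis by (simp add: b comm_eq_0)
  qed
  have "comm (M i) (M j) = (\<Oplus>k\<in>{..<n}. \<Oplus>l\<in>{..<n}. b k l)"
    unfolding M_def[of i] b_def
    by (subst comm_finsum_left) (auto simp: M_def intro!: finsum_cong' comm_finsum_right)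
  also have "\<dots> = (\<Oplus>k\<in>insert i (insert j ?K). \<Oplus>l\<in>{..<n}. b k l)"
    using ij by (intro finsum_cong') (auto intro!: finsum_closed)
  also have "\<dots> = (\<Oplus>l\<in>{..<n}. b i l) \<oplus> ((\<Oplus>l\<in>{..<n}. b j l) \<oplus> (\<Oplus>k\<in>?K. \<Oplus>l\<in>{..<n}. b k l))"
    using ij by (subst finsum_insert, simp, simp, simp, simp, subst finsum_insert) auto
  also have "(\<Oplus>l\<in>{..<n}. b i l) = \<zero>"
    by (simp add: b)
  also have "(\<Oplus>l\<in>{..<n}. b j l) = (\<Oplus>k\<in>?K. b j k)"
    using b0[of j] ij by (intro finsum_only) (auto simp: b)
  also have "(\<Oplus>k\<in>?K. \<Oplus>l\<in>{..<n}. b k l) = (\<Oplus>k\<in>?K. b k k \<oplus> b k i)"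
  proof (intro finsum_cong' refl)
    fix k assume k: "k \<in> ?K"
    have "(\<Oplus>l\<in>{..<n}. b k l) = (\<Oplus>l\<in>{k, i}. b k l)"
      using b0[of k] k ij by (intro finsum_only) auto
    thus "(\<Oplus>l\<in>{..<n}. b k l) = b k k \<oplus> b k i" using k by simp
  qed auto
  also have "\<zero> \<oplus> ((\<Oplus>k\<in>?K. b j k) \<oplus> (\<Oplus>k\<in>?K. b k k \<oplus> b k i)) = (\<Oplus>k\<in>?K. b j k \<oplus> (b k k \<oplus> b k i))"
    by (subst finsum_addf) (auto intro!: finsum_closed)
  also have "\<dots> = (\<Oplus>k\<in>?K. (- 1/4) \<odot> comm (S i j) (S j k))"
  proof (intro finsum_cong' refl)
    fix k assume "k \<in> ?K"
    hence k: "k < n" "j \<noteq> k" "i \<noteq> k" by auto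
    \<comment> \<open>Four rotations bring the products that occur into the two forms S i j S j k
      and S j k S i j.\<close>
    note rot = S_rotate[OF ij(1,2) k(1) ij(3) k(2,3)]
      S_rotate[OF k(1) ij(1,2) k(3)[symmetric] ij(3) k(2)[symmetric]]
      S_rotate[OF k(1) ij(2,1) k(2)[symmetric] ij(3)[symmetric] k(3)[symmetric]]
      S_rotate[OF ij(1) k(1) ij(2) k(3) k(2)[symmetric] ij(3)]
    have P: "S i k \<otimes> S i j = S i j \<otimes> S j k" "S j k \<otimes> S i k = S i j \<otimes> S j k"
      using rot(1,2) by (simp_all add: S_commute)
    have Q: "S i k \<otimes> S j k = S j k \<otimes> S i j" "S i j \<otimes> S i k = S j k \<otimes> S i j"
      using rot(3,4) by (simp_all add: S_commute)
    have "comm (S i k) (S j i) = comm (S i j) (S j k)"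
      using P(1) Q(2) by (simp add: comm_def S_commute[of j i])
    moreover have "comm (S i k) (S j k) = (- 1) \<odot> comm (S i j) (S j k)"
      unfolding smult_minus_1[OF comm_closed[OF S_closed S_closed]]
      using P(2) Q(1) comm_swap[of "S i j" "S j k"] by (simp add: comm_def)
    ultimately have "b j k \<oplus> (b k k \<oplus> b k i) = (eps i j * eps j k) \<odot> comm (S i j) (S j k) \<oplus>
        ((- (eps i k * eps j k)) \<odot> comm (S i j) (S j k) \<oplus> (eps i k * eps j i) \<odot> comm (S i j) (S j k))"
      by (simp add: b smult_smult)
    also have "\<dots> = (eps i j * eps j k + (- (eps i k * eps j k) + eps i k * eps j i))
        \<odot> comm (S i j) (S j k)"
      by (simp only: smult_add_left comm_closed S_closed)
    also have "eps i j * eps j k + (- (eps i k * eps j k) + eps i k * eps j i) = - 1/4"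
      using eps_identity[OF ij(3) k(2,3)] by (simp add: algebra_simps)
    finally show "b j k \<oplus> (b k k \<oplus> b k i) = (- 1/4) \<odot> comm (S i j) (S j k)" .
  qed auto
  also have "\<dots> = (- 1/4) \<odot> C i j"
    unfolding C_def by (intro smult_finsum[symmetric]) auto
  finally show ?thesis .
qed

section \<open>Moving group elements past M_i\<close>

lemma T_M:
  assumes g: "g \<in> carrier G" and k: "k < n"
  shows "T g \<otimes> M k = (\<Oplus>l\<in>{..<n}. eps k l \<odot> S (perm_of n g k) (perm_of n g l)) \<otimes> T g"
proof -
  have "T g \<otimes> M k = (\<Oplus>l\<in>{..<n}. T g \<otimes> (eps k l \<odot> S k l))"
    unfolding M_def using g by (intro finsum_rdistr) auto
  also have "\<dots> = (\<Oplus>l\<in>{..<n}. (eps k l \<odot> S (perm_of n g k) (perm_of n g l)) \<otimes> T g)"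
  proof (intro finsum_cong' refl)
    fix l assume l: "l \<in> {..<n}"
    show "T g \<otimes> (eps k l \<odot> S k l) = (eps k l \<odot> S (perm_of n g k) (perm_of n g l)) \<otimes> T g"
      using T_S[OF g k, of l] g l
      by (cases "l = k") (auto simp: smult_mult_left smult_mult_right)
  qed (use g in auto)
  also have "\<dots> = (\<Oplus>l\<in>{..<n}. eps k l \<odot> S (perm_of n g k) (perm_of n g l)) \<otimes> T g"
    using g by (intro finsum_ldistr[symmetric]) auto
  finally show ?thesis .
qed

lemma T_M_id:
  assumes g: "g \<in> carrier G" and k: "k < n" and id: "\<And>l. l < n \<Longrightarrow> perm_of n g l = l"
  shows "T g \<otimes> M k = M k \<otimes> T g"
proof -
  have "(\<Oplus>l\<in>{..<n}. eps k l \<odot> S (perm_of n g k) (perm_of n g l)) = M k"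
    unfolding M_def using id k by (intro finsum_cong') auto
  thus ?thesis using T_M[OF g k] by simp
qed

lemma simple_refl_Grn:
  assumes "Suc i < n"
  shows "simple_refl n i \<in> carrier G"
    "\<And>l. l < n \<Longrightarrow> perm_of n (simple_refl n i) l = Transposition.transpose i (Suc i) l"
proof -
  have "Transposition.transpose i (Suc i) permutes {..<n}" using assms by (intro permutes_swap_id) auto
  thus "simple_refl n i \<in> carrier G"
    "\<And>l. l < n \<Longrightarrow> perm_of n (simple_refl n i) l = Transposition.transpose i (Suc i) l"
    using perm_mat_Grn by (simp_all add: simple_refl_def)
qed

text \<open>The reflection moves the indices of the sums while the weights stay behind. Reindexing
  by the transposition transfers the discrepancy to the weights, where it can be compared with those
  of an M.\<close>

lemma T_simple_M:
  assumes i: "Suc i < n" and k: "k < n"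
  shows "T (simple_refl n i) \<otimes> M k =
    (\<Oplus>l\<in>{..<n}. eps k (Transposition.transpose i (Suc i) l) \<odot> S (Transposition.transpose i (Suc i) k) l)
      \<otimes> T (simple_refl n i)"
proof -
  let ?t = "Transposition.transpose i (Suc i)"
  note s = simple_refl_Grn[OF i]
  have "?t permutes {..<n}" using i by (intro permutes_swap_id) auto
  hence t: "?t ` {..<n} = {..<n}" "inj_on ?t {..<n}" by (auto simp: permutes_image permutes_inj_on)
  have "(\<Oplus>l\<in>?t ` {..<n}. eps k (?t l) \<odot> S (?t k) l) = (\<Oplus>l\<in>{..<n}. eps k (?t (?t l)) \<odot> S (?t k) (?t l))"
    using t(2) by (intro finsum_reindex) auto
  also have "\<dots> = (\<Oplus>l\<in>{..<n}. eps k l \<odot> S (perm_of n (simple_refl n i) k) (perm_of n (simple_refl n i) l))"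
    using s(2) k by (intro finsum_cong') auto
  finally show ?thesis using T_M[OF s(1) k] t(1) by simp
qed

text \<open>Exchanging the neighbours i and i + 1 does not alter their order relative to a third
  index, so no weight changes.\<close>

lemma T_simple_M_other:
  assumes i: "Suc i < n" and k: "k < n" "k \<noteq> i" "k \<noteq> Suc i"
  shows "T (simple_refl n i) \<otimes> M k = M k \<otimes> T (simple_refl n i)"
proof -
  have "eps k (Transposition.transpose i (Suc i) l) = eps k l" for l
    using k by (auto simp: eps_def transpose_def)
  thus ?thesis using T_simple_M[OF i k(1)] k by (simp add: M_def)
qed

text \<open>Compared with M i, only the weight of the exchanged pair itself differs: it is - 1/2
  instead of 1/2, which costs one copy of \<open>S i (Suc i)\<close>.\<close>

lemma T_simple_M_Suc:
  assumes i: "Suc i < n"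
  shows "T (simple_refl n i) \<otimes> M (Suc i) = (M i \<ominus> S i (Suc i)) \<otimes> T (simple_refl n i)"
proof -
  let ?t = "Transposition.transpose i (Suc i)"
  have "eps (Suc i) (?t l) \<odot> S i l = eps i l \<odot> S i l \<ominus> (if l = Suc i then S i l else \<zero>)" for l
  proof (cases "l = Suc i")
    case True
    have "- 1/2 = (1/2 :: complex) + (- 1)" by simp
    hence "(- 1/2 :: complex) \<odot> S i l = (1/2) \<odot> S i l \<oplus> (- 1) \<odot> S i l"
      using smult_add_left[OF S_closed, of "1/2" "- 1"] by metis
    thus ?thesis using True by (simp add: eps_def a_minus_def smult_minus_1)
  next
    case False
    have "eps (Suc i) (?t l) = eps i l"
      using False by (auto simp: eps_def transpose_def)
    thus ?thesis using False by (simp add: a_minus_def)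
  qed
  hence "(\<Oplus>l\<in>{..<n}. eps (Suc i) (?t l) \<odot> S i l) =
      (\<Oplus>l\<in>{..<n}. eps i l \<odot> S i l \<ominus> (if l = Suc i then S i l else \<zero>))" by simp
  also have "\<dots> = M i \<ominus> (\<Oplus>l\<in>{..<n}. if l = Suc i then S i l else \<zero>)"
    unfolding M_def by (intro finsum_diff) auto
  also have "(\<Oplus>l\<in>{..<n}. if l = Suc i then S i l else \<zero>) = S i (Suc i)"
    using i by (intro finsum_delta) auto
  finally show ?thesis using T_simple_M[OF i i] by simp
qed

lemma T_simple_simple:
  assumes i: "Suc i < n"
  shows "T (simple_refl n i) \<otimes> T (simple_refl n i) = \<one>"
proof -
  let ?s = "simple_refl n i"
  have "perm_mat n (Transposition.transpose i (Suc i) \<circ> Transposition.transpose i (Suc i)) = ?s * ?s"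
    unfolding simple_refl_def using i by (intro perm_mat_comp permutes_swap_id) auto
  moreover have "perm_mat n id = 1\<^sub>m n" by (rule eq_matI) (auto simp: perm_mat_def)
  ultimately have "?s * ?s = 1\<^sub>m n" unfolding transpose_comp_involutory by (rule trans[OF sym])
  thus ?thesis
    using T_mult[OF simple_refl_Grn(1)[OF i] simple_refl_Grn(1)[OF i]] T_one by simp
qed

text \<open>Since the simple reflection squares to 1, each summand is a member of
  \<open>refls i (Suc i)\<close> times it, and every member occurs once. So the inhomogeneous term
  in the last relation of \<open>H_star\<close> is the same as the defect in
  \<open>T_simple_M_Suc\<close>.\<close>

lemma sum_twisted:
  assumes prim: "primitive_root_of_unity r \<xi>" and i: "Suc i < n"
  shows "(\<Oplus>a\<in>{..<r}. (T (xi_mat n \<xi> i) [^] a) \<otimes> (T (inv\<^bsub>G\<^esub> (xi_mat n \<xi> (Suc i))) [^] a)) =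
    S i (Suc i) \<otimes> T (simple_refl n i)"
proof -
  have \<xi>: "\<xi> ^ r = 1" using prim by (simp add: primitive_root_of_unity_def)
  let ?s = "simple_refl n i" and ?x = "xi_mat n \<xi> i" and ?y = "inv\<^bsub>G\<^esub> (xi_mat n \<xi> (Suc i))"
  note s = simple_refl_Grn(1)[OF i]
  have x: "?x \<in> carrier G" and y: "?y \<in> carrier G" using xi_mat_Grn(1)[OF \<xi>] by simp_all
  have pow: "T (g [^]\<^bsub>G\<^esub> a) = T g [^] a" if "g \<in> carrier G" for g and a :: nat
    using that by (induction a) (auto simp: T_one T_mult)
  note inv = T_simple_simple[OF i]
  have tw: "T (twisted_refl \<xi> i (Suc i) a) \<otimes> T ?s = (T ?x [^] a) \<otimes> (T ?y [^] a)" for a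
  proof -
    have "twisted_refl \<xi> i (Suc i) a = (?x [^]\<^bsub>G\<^esub> a) * (?y [^]\<^bsub>G\<^esub> a) * ?s"
      by (simp add: twisted_refl_def simple_refl_def)
    hence "T (twisted_refl \<xi> i (Suc i) a) = T ?x [^] a \<otimes> T ?y [^] a \<otimes> T ?s"
      using x y s by (simp add: T_mult pow)
    thus ?thesis using x y s inv by (simp add: m_assoc)
  qed
  note bij = bij_twisted_refl[OF prim _ i, of i]
  have b: "inj_on (twisted_refl \<xi> i (Suc i)) {..<r}" "twisted_refl \<xi> i (Suc i) ` {..<r} = refls i (Suc i)"
    using bij i by (auto simp: bij_betw_def)
  have tG: "twisted_refl \<xi> i (Suc i) a \<in> carrier G" if "a < r" for a
    using b(2) that refls_Grn by blast
  have "S i (Suc i) = (\<Oplus>a\<in>{..<r}. T (twisted_refl \<xi> i (Suc i) a))"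
    unfolding S_def b(2)[symmetric] using b(1) tG by (intro finsum_reindex) auto
  hence "S i (Suc i) \<otimes> T ?s = (\<Oplus>a\<in>{..<r}. T (twisted_refl \<xi> i (Suc i) a) \<otimes> T ?s)"
    using s tG by (simp, subst finsum_ldistr) auto
  thus ?thesis by (simp add: tw)
qed

section \<open>Families permuted by the group\<close>

definition equivariant :: "(nat \<Rightarrow> 'a) \<Rightarrow> bool" where
  "equivariant u \<longleftrightarrow> (\<forall>i<n. u i \<in> carrier R) \<and>
     (\<forall>g\<in>carrier G. \<forall>i<n. T g \<otimes> u i = u (perm_of n g i) \<otimes> T g)"

lemma S_equivariant:
  assumes u: "equivariant u" and ijk: "i < n" "j < n" "i \<noteq> j" "k < n"
  shows "S i j \<otimes> u k = u (Transposition.transpose i j k) \<otimes> S i j"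
proof (rule S_intertwine)
  show "u k \<in> carrier R" using u ijk by (simp add: equivariant_def)
  have "Transposition.transpose i j k < n" using ijk by (auto simp: transpose_def)
  thus "u (Transposition.transpose i j k) \<in> carrier R" using u by (simp add: equivariant_def)
  show "T g \<otimes> u k = u (Transposition.transpose i j k) \<otimes> T g" if "g \<in> refls i j" for g
    using u refls_Grn[OF that] refls_perm[OF that ijk(4)] ijk by (simp add: equivariant_def)
qed

text \<open>For l different from i and j, the transposition (i l) fixes j, so S i l commutes with u
  j; for l = i the weight is 0. Only l = j is left, where moving across S i j replaces u j by u
  i.\<close>

lemma comm_M_equivariant:
  assumes u: "equivariant u" and ij: "i < n" "j < n" "i \<noteq> j"
  shows "comm (M i) (u j) = eps i j \<odot> ((u i \<ominus> u j) \<otimes> S i j)"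
proof -
  have uc: "u k \<in> carrier R" if "k < n" for k using u that by (simp add: equivariant_def)
  have "comm (M i) (u j) = (\<Oplus>l\<in>{..<n}. comm (eps i l \<odot> S i l) (u j))"
    unfolding M_def using uc ij by (intro comm_finsum_left) auto
  also have "\<dots> = (\<Oplus>l\<in>{..<n}. if l = j then comm (eps i l \<odot> S i l) (u j) else \<zero>)"
  proof (intro finsum_cong' refl)
    fix l assume l: "l \<in> {..<n}"
    show "comm (eps i l \<odot> S i l) (u j) = (if l = j then comm (eps i l \<odot> S i l) (u j) else \<zero>)"
    proof (cases "l = j \<or> l = i")
      case True
      thus ?thesis using uc ij by (auto simp: comm_def a_minus_def)
    next
      case False
      hence "S i l \<otimes> u j = u j \<otimes> S i l" using S_equivariant[OF u, of i l j] l ij by auto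
      thus ?thesis using False uc ij comm_smult[of "S i l" "u j" "eps i l" 1] by (simp add: comm_eq_0)
    qed
  qed (use uc ij in auto)
  also have "\<dots> = comm (eps i j \<odot> S i j) (u j)"
    using uc ij by (intro finsum_delta) auto
  also have "\<dots> = eps i j \<odot> comm (S i j) (u j)"
    using uc ij comm_smult[of "S i j" "u j" "eps i j" 1] by simp
  also have "comm (S i j) (u j) = (u i \<ominus> u j) \<otimes> S i j"
    using S_equivariant[OF u ij ij(2)] uc ij by (simp add: comm_def a_minus_def l_distr l_minus)
  finally show ?thesis .
qed

text \<open>The value found in \<open>comm_M_equivariant\<close> is symmetric in i and j: the weight
  and the difference of the u's both change sign, while S i j does not. Hence the mixed terms agree
  and drop out, and only the commutator of the M's remains as a correction.\<close>

lemma comm_shift: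
  assumes u: "equivariant u" and ij: "i < n" "j < n" "i \<noteq> j"
  shows "comm (u i \<ominus> M i) (u j \<ominus> M j) = comm (u i) (u j) \<ominus> (1/4) \<odot> C i j"
proof -
  have uc: "u i \<in> carrier R" "u j \<in> carrier R" using u ij by (simp_all add: equivariant_def)
  have "comm (M j) (u i) = eps j i \<odot> ((u j \<ominus> u i) \<otimes> S i j)"
    using comm_M_equivariant[OF u ij(2,1) ij(3)[symmetric]] by (simp add: S_commute)
  also have "eps j i = - eps i j" by (simp add: eps_def)
  also have "(u j \<ominus> u i) \<otimes> S i j = \<ominus> ((u i \<ominus> u j) \<otimes> S i j)"
    using uc by (simp add: a_minus_def l_distr l_minus minus_add a_comm)
  also have "- eps i j \<odot> \<ominus> ((u i \<ominus> u j) \<otimes> S i j) = eps i j \<odot> ((u i \<ominus> u j) \<otimes> S i j)"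
    using uc by (simp add: smult_uminus_left smult_uminus_right)
  also have "\<dots> = comm (M i) (u j)" using comm_M_equivariant[OF u ij] by simp
  finally have mixed: "comm (M j) (u i) = comm (M i) (u j)" .
  have "comm (u i \<ominus> M i) (u j \<ominus> M j) =
      comm (u i) (u j) \<oplus> comm (M i) (M j) \<oplus> (comm (M j) (u i) \<ominus> comm (M i) (u j))"
    using uc unfolding comm_def a_minus_def
    by (simp add: l_distr r_distr l_minus r_minus minus_add minus_minus a_ac)
  thus ?thesis
    unfolding mixed comm_M_M[OF ij] using uc
    by (simp add: a_minus_def smult_uminus_left[symmetric] r_neg)
qed

end


section \<open>The forms \<open>a\<^sub>g\<close> on the standard basis\<close>

lemma (in Grn_group) rho_unit_vec:
  assumes h: "h \<in> carrier (Grn r n)" and i: "i < n"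
  shows "rho n h *\<^sub>v unit_vec n i = unit_vec n (perm_of n h i)"
proof (rule eq_vecI)
  have d: "dim_row (rho n h) = n" by (simp add: rho_def perm_mat_def)
  thus "dim_vec (rho n h *\<^sub>v unit_vec n i) = dim_vec (unit_vec n (perm_of n h i))" by simp
  fix l assume "l < dim_vec (unit_vec n (perm_of n h i))"
  hence "l < n" by simp
  then obtain k where k: "k < n" "l = perm_of n h k"
    using perm_of_surj[OF Grn_monomial[OF h]] by metis
  show "(rho n h *\<^sub>v unit_vec n i) $ l = unit_vec n (perm_of n h i) $ l"
    using rho_index[OF Grn_monomial[OF h] unit_vec_carrier k(1), of i] k i h by (auto simp: perm_inj)
qed

locale hecke_form_family = Grn_group r n for r n +
  fixes a :: "complex mat \<Rightarrow> complex vec \<Rightarrow> complex vec \<Rightarrow> complex"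
  assumes n3: "n \<ge> 3" and forms: "hecke_forms r n a"
begin

lemma cyc3_Grn: "cyc3 n \<in> carrier G"
  using cyc3_cycles[OF n3] by (rule cycles_Grn)

lemma form_skew: "g \<in> carrier G \<Longrightarrow> skew_bilinear n (a g)"
  using forms by (simp add: hecke_forms_def Let_def)

lemma form_lin:
  assumes "g \<in> carrier G" "u \<in> carrier_vec n" "v \<in> carrier_vec n" "w \<in> carrier_vec n"
  shows "a g (u + v) w = a g u w + a g v w" "a g (c \<cdot>\<^sub>v u) w = c * a g u w"
    "a g w (u + v) = a g w u + a g w v" "a g w (c \<cdot>\<^sub>v u) = c * a g w u" "a g u v = - a g v u"
  using form_skew[OF assms(1)] assms(2-4) unfolding skew_bilinear_def by blast+

lemma form_diff:
  assumes "g \<in> carrier G" "u \<in> carrier_vec n" "v \<in> carrier_vec n" "w \<in> carrier_vec n"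
  shows "a g (u - v) w = a g u w - a g v w" "a g w (u - v) = a g w u - a g w v"
proof -
  have *: "u - v = u + (- 1) \<cdot>\<^sub>v v" using assms by (intro eq_vecI) auto
  have v: "(- 1) \<cdot>\<^sub>v v \<in> carrier_vec n" using assms by simp
  show "a g (u - v) w = a g u w - a g v w" "a g w (u - v) = a g w u - a g w v"
    unfolding * form_lin(1)[OF assms(1,2) v assms(4)] form_lin(3)[OF assms(1,2) v assms(4)]
      form_lin(2)[OF assms(1,3,3,4)] form_lin(4)[OF assms(1,3,3,4)] by simp_all
qed

lemma form_alt: "g \<in> carrier G \<Longrightarrow> v \<in> carrier_vec n \<Longrightarrow> a g v v = 0"
  using form_lin(5)[of g v v v] by simp

lemma form_conj:
  assumes "h \<in> carrier G" "i < n" "j < n"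
  shows "a (inv\<^bsub>G\<^esub> h * cyc3 n * h) (unit_vec n i) (unit_vec n j) =
    a (cyc3 n) (unit_vec n (perm_of n h i)) (unit_vec n (perm_of n h j))"
  using forms assms rho_unit_vec by (simp add: hecke_forms_def Let_def)

lemma cyc3_form_fixed:
  assumes "v \<in> fixed_space n (cyc3 n)" "w \<in> carrier_vec n"
  shows "a (cyc3 n) v w = 0" "a (cyc3 n) w v = 0"
proof -
  show 1: "a (cyc3 n) v w = 0" using forms assms by (simp add: hecke_forms_def Let_def)
  have "v \<in> carrier_vec n" using assms by (simp add: fixed_space_def)
  thus "a (cyc3 n) w v = 0" using form_lin(5)[OF cyc3_Grn assms(2), of v w] 1 assms by simp
qed

lemma cyc3_form_outside:
  assumes i: "3 \<le> i" "i < n" and w: "w \<in> carrier_vec n"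
  shows "a (cyc3 n) (unit_vec n i) w = 0" "a (cyc3 n) w (unit_vec n i) = 0"
proof -
  have "perm_of n (cyc3 n) i = i" using cyc3_cycles[OF n3] i by (simp add: cycles_def)
  hence "unit_vec n i \<in> fixed_space n (cyc3 n)"
    using rho_unit_vec[OF cyc3_Grn i(2)] by (simp add: fixed_space_def)
  thus "a (cyc3 n) (unit_vec n i) w = 0" "a (cyc3 n) w (unit_vec n i) = 0"
    using cyc3_form_fixed w by blast+
qed

text \<open>The vector e_0 + e_1 + e_2 is fixed by the cycle, so the form vanishes on it. Pairing it
  with e_0 and e_1 shows that the values on (e_0, e_1), (e_1, e_2) and (e_2, e_0) coincide, and the
  normalization expands to their sum, which is 1.\<close>

lemma cyc3_form_01: "a (cyc3 n) (unit_vec n 0) (unit_vec n 1) = 1/3"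
proof -
  let ?e = "unit_vec n :: nat \<Rightarrow> complex vec" and ?a = "a (cyc3 n)"
  let ?f = "?e 0 + (?e 1 + ?e 2)"
  note cG = cyc3_Grn
  have p: "perm_of n (cyc3 n) 0 = 1" "perm_of n (cyc3 n) 1 = 2" "perm_of n (cyc3 n) 2 = 0"
    using cyc3_cycles[OF n3] by (simp_all add: cycles_def)
  have r: "rho n (cyc3 n) \<in> carrier_mat n n" by (simp add: rho_def perm_mat_def)
  have "rho n (cyc3 n) *\<^sub>v ?f = ?e 1 + (?e 2 + ?e 0)"
    using n3 r p rho_unit_vec[OF cG] by (simp add: mult_add_distrib_mat_vec[OF r])
  also have "\<dots> = ?f" by (intro eq_vecI) auto
  finally have f: "?f \<in> fixed_space n (cyc3 n)" by (simp add: fixed_space_def)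
  have lin: "?a ?f w = ?a (?e 0) w + (?a (?e 1) w + ?a (?e 2) w)" if "w \<in> carrier_vec n" for w
    using that form_lin(1)[OF cG] by simp
  have al: "?a (?e k) (?e k) = 0" for k using form_alt[OF cG] by simp
  have sk: "?a (?e k) (?e l) = - ?a (?e l) (?e k)" for k l
    using form_lin(5)[OF cG, of "?e k" "?e l" "?e k"] by simp
  have 0: "?a (?e 1) (?e 0) + ?a (?e 2) (?e 0) = 0" "?a (?e 0) (?e 1) + ?a (?e 2) (?e 1) = 0"
    using cyc3_form_fixed(1)[OF f, of "?e 0"] cyc3_form_fixed(1)[OF f, of "?e 1"]
      lin[of "?e 0"] lin[of "?e 1"] al by simp_all
  have "?a (?e 0 - ?e 1) (?e 1 - ?e 2) = 1"
    using forms by (simp add: hecke_forms_def Let_def)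
  hence "?a (?e 0) (?e 1) - ?a (?e 0) (?e 2) + ?a (?e 1) (?e 2) = 1"
    using form_diff[OF cG] al by (simp add: algebra_simps)
  thus ?thesis using 0 sk[of 1 0] sk[of 2 1] sk[of 2 0] by (simp add: algebra_simps)
qed

lemma form_cycles:
  assumes ijk: "i < n" "j < n" "k < n" "i \<noteq> j" "j \<noteq> k" "i \<noteq> k" and g: "g \<in> cycles i j k"
  shows "a g (unit_vec n i) (unit_vec n j) = 1/3"
proof -
  obtain h where h: "h \<in> carrier G" "g = inv\<^bsub>G\<^esub> h * cyc3 n * h" "perm_of n h i = 0" "perm_of n h j = 1"
    using cycles_conjugate[OF n3 ijk g] .
  thus ?thesis using form_conj[OF h(1) ijk(1,2)] cyc3_form_01 by simp
qed

text \<open>A conjugate of the standard cycle is again a cycle on three indices. If i and j were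
  both among them, g would send i to j or j to i and belong to an excluded set. So the conjugator
  carries one of the two basis vectors into the fixed space of \<open>cyc3 n\<close>, where the form
  vanishes.\<close>

lemma form_not_cycles:
  assumes ij: "i < n" "j < n" "i \<noteq> j" and g: "g \<in> carrier G"
    and not: "\<And>k. k < n \<Longrightarrow> k \<noteq> i \<Longrightarrow> k \<noteq> j \<Longrightarrow> g \<notin> cycles i j k \<and> g \<notin> cycles j i k"
  shows "a g (unit_vec n i) (unit_vec n j) = 0"
proof (cases "\<exists>h. h \<in> carrier G \<and> g = inv\<^bsub>G\<^esub> h * cyc3 n * h")
  case False
  thus ?thesis using forms g by (simp add: hecke_forms_def Let_def)
next
  case True
  then obtain h where h: "h \<in> carrier G" "g = inv\<^bsub>G\<^esub> h * cyc3 n * h" by blast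
  let ?p = "perm_of n (inv\<^bsub>G\<^esub> h)"
  have hi: "inv\<^bsub>G\<^esub> h \<in> carrier G" using h by simp
  have "g \<in> cycles (?p 0) (?p 1) (?p 2)"
    using cycles_conj[OF hi cyc3_cycles[OF n3]] h n3 by simp
  hence cyc: "g \<in> cycles (?p 0) (?p 1) (?p 2)" "g \<in> cycles (?p 1) (?p 2) (?p 0)"
    "g \<in> cycles (?p 2) (?p 0) (?p 1)" using cycles_rotate by blast+
  have pi: "?p (perm_of n h i) = i" "?p (perm_of n h j) = j" using perm_inv[OF h(1)] ij by simp_all
  have "perm_of n h i \<noteq> perm_of n h j" using perm_inj[OF h(1)] ij by simp
  have k: "?p m < n \<and> (m \<noteq> perm_of n h i \<longrightarrow> ?p m \<noteq> i) \<and> (m \<noteq> perm_of n h j \<longrightarrow> ?p m \<noteq> j)" if "m < 3" for m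
    using that n3 hi perm_inj[OF hi, of m "perm_of n h i"] perm_inj[OF hi, of m "perm_of n h j"] h ij pi by auto
  have "perm_of n h i \<ge> 3 \<or> perm_of n h j \<ge> 3"
  proof (rule ccontr)
    assume "\<not> ?thesis"
    hence "perm_of n h i \<in> {0, 1, 2}" "perm_of n h j \<in> {0, 1, 2}" by auto
    thus False
      using pi cyc not[of "?p 0"] not[of "?p 1"] not[of "?p 2"] k[of 0] k[of 1] k[of 2]
        \<open>perm_of n h i \<noteq> perm_of n h j\<close> cycles_rotate by (elim insertE emptyE) auto
  qed
  thus ?thesis
    using form_conj[OF h(1) ij(1,2)] h cyc3_form_outside ij by auto
qed

end

locale hecke_rep = Grn_rep R r n T + hecke_form_family r n a
  for R :: "(complex, 'a, 'm) module_scheme" (structure) and r n T a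
begin

text \<open>The sets are disjoint for different k, because k is the image of j.\<close>

lemma finsum_cycles:
  assumes ij: "i < n" "j < n" "i \<noteq> j"
  shows "(\<Oplus>k\<in>{..<n} - {i, j}. S i j \<otimes> S j k) = (\<Oplus>g\<in>(\<Union>k\<in>{..<n} - {i, j}. cycles i j k). T g)"
proof -
  have "(\<Oplus>g\<in>(\<Union>k\<in>{..<n} - {i, j}. cycles i j k). T g) =
      (\<Oplus>k\<in>{..<n} - {i, j}. \<Oplus>g\<in>cycles i j k. T g)"
  proof (rule add.finprod_UN_disjoint)
    show "pairwise (\<lambda>k l. disjnt (cycles i j k) (cycles i j l)) ({..<n} - {i, j})"
      by (auto simp: pairwise_def disjnt_def cycles_def)
  qed (auto simp: finite_cycles intro: T_closed dest: cycles_Grn)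
  also have "\<dots> = (\<Oplus>k\<in>{..<n} - {i, j}. S i j \<otimes> S j k)"
    using S_mult_cycles[OF ij(1,2) _ ij(3)] by (intro finsum_cong') auto
  finally show ?thesis ..
qed

lemma finsum_indicator:
  assumes "X \<subseteq> carrier G"
  shows "(\<Oplus>g\<in>carrier G. (if g \<in> X then c else 0) \<odot> T g) = c \<odot> (\<Oplus>g\<in>X. T g)"
proof -
  have "(\<Oplus>g\<in>carrier G. (if g \<in> X then c else 0) \<odot> T g) = (\<Oplus>g\<in>X. (if g \<in> X then c else 0) \<odot> T g)"
    using assms finite_Grn by (intro finsum_only) auto
  also have "\<dots> = (\<Oplus>g\<in>X. c \<odot> T g)" using assms by (intro finsum_cong') auto
  also have "\<dots> = c \<odot> (\<Oplus>g\<in>X. T g)" using assms by (intro smult_finsum[symmetric]) auto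
  finally show ?thesis .
qed

text \<open>The value of the form is 1/3 for cycles sending i to j, - 1/3 by skew symmetry for those
  sending j to i, and 0 for all other elements. The two families give the two products in the
  commutators that make up \<open>C i j\<close>.\<close>

lemma finsum_forms:
  assumes ij: "i < n" "j < n" "i \<noteq> j"
  shows "(\<Oplus>g\<in>carrier G. a g (unit_vec n i) (unit_vec n j) \<odot> T g) = (1/3) \<odot> C i j"
proof -
  let ?K = "{..<n} - {i, j}"
  let ?X = "\<Union>k\<in>?K. cycles i j k" and ?Y = "\<Union>k\<in>?K. cycles j i k"
  have XY: "?X \<subseteq> carrier G" "?Y \<subseteq> carrier G" by (auto dest: cycles_Grn)
  have a: "a g (unit_vec n i) (unit_vec n j) = (if g \<in> ?X then 1/3 else 0) - (if g \<in> ?Y then 1/3 else 0)"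
    if g: "g \<in> carrier G" for g
  proof -
    consider k where "k \<in> ?K" "g \<in> cycles i j k" | k where "k \<in> ?K" "g \<in> cycles j i k" | "g \<notin> ?X" "g \<notin> ?Y"
      by blast
    thus ?thesis
    proof cases
      case (1 k)
      hence "g \<notin> ?Y" by (auto simp: cycles_def)
      moreover have "g \<in> ?X" using 1 by blast
      ultimately show ?thesis using form_cycles[OF ij(1,2) _ ij(3) _ _ 1(2)] 1(1) by auto
    next
      case (2 k)
      hence "g \<notin> ?X" by (auto simp: cycles_def)
      moreover have "g \<in> ?Y" using 2 by blast
      moreover have "a g (unit_vec n i) (unit_vec n j) = - a g (unit_vec n j) (unit_vec n i)"
        using form_lin(5)[OF g, of "unit_vec n i" "unit_vec n j" "unit_vec n i"] by simp
      ultimately show ?thesis using form_cycles[OF ij(2,1) _ ij(3)[symmetric] _ _ 2(2)] 2(1) by auto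
    next
      case 3
      thus ?thesis using form_not_cycles[OF ij g] by auto
    qed
  qed
  have "(\<Oplus>g\<in>carrier G. a g (unit_vec n i) (unit_vec n j) \<odot> T g) =
      (\<Oplus>g\<in>carrier G. (if g \<in> ?X then 1/3 else 0) \<odot> T g \<ominus> (if g \<in> ?Y then 1/3 else 0) \<odot> T g)"
  proof (rule finsum_cong'[OF refl])
    fix g assume g: "g \<in> carrier G"
    have "(x - y) \<odot> T g = x \<odot> T g \<ominus> y \<odot> T g" for x y
      using smult_add_left[OF T_closed[OF g], of x "- y"] smult_uminus_left[OF T_closed[OF g]]
      by (simp add: a_minus_def)
    thus "a g (unit_vec n i) (unit_vec n j) \<odot> T g =
        (if g \<in> ?X then 1/3 else 0) \<odot> T g \<ominus> (if g \<in> ?Y then 1/3 else 0) \<odot> T g"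
      unfolding a[OF g] by blast
  qed auto
  also have "\<dots> = (1/3) \<odot> (\<Oplus>g\<in>?X. T g) \<ominus> (1/3) \<odot> (\<Oplus>g\<in>?Y. T g)"
    unfolding finsum_indicator[OF XY(1), symmetric] finsum_indicator[OF XY(2), symmetric]
    by (rule finsum_diff) auto
  also have "\<dots> = (1/3) \<odot> ((\<Oplus>k\<in>?K. S i j \<otimes> S j k) \<ominus> (\<Oplus>k\<in>?K. S j i \<otimes> S i k))"
    using finsum_cycles[OF ij] finsum_cycles[OF ij(2,1) ij(3)[symmetric]]
    by (subst smult_diff_right) (auto simp: insert_commute intro!: finsum_closed T_closed intro: cycles_Grn)
  also have "(\<Oplus>k\<in>?K. S j i \<otimes> S i k) = (\<Oplus>k\<in>?K. S j k \<otimes> S i j)"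
  proof (rule finsum_cong'[OF refl])
    fix k assume "k \<in> ?K"
    thus "S j i \<otimes> S i k = S j k \<otimes> S i j"
      using S_rotate[OF ij(2,1) _ ij(3)[symmetric], of k] by (auto simp: S_commute)
  qed auto
  also have "(\<Oplus>k\<in>?K. S i j \<otimes> S j k) \<ominus> (\<Oplus>k\<in>?K. S j k \<otimes> S i j) = C i j"
    unfolding C_def comm_def by (rule finsum_diff[symmetric]) auto
  finally show ?thesis .
qed

end


section \<open>Representations of the two algebras\<close>

lemma carrier_vec_induct [consumes 2, case_names unit smult add]:
  fixes v :: "complex vec"
  assumes v: "v \<in> carrier_vec n" and n: "n > 0"
    and unit: "\<And>i. i < n \<Longrightarrow> P (unit_vec n i)"
    and smult: "\<And>c u. u \<in> carrier_vec n \<Longrightarrow> P u \<Longrightarrow> P (c \<cdot>\<^sub>v u)"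
    and add: "\<And>u w. u \<in> carrier_vec n \<Longrightarrow> w \<in> carrier_vec n \<Longrightarrow> P u \<Longrightarrow> P w \<Longrightarrow> P (u + w)"
  shows "P v"
proof -
  let ?v = "\<lambda>m. Matrix.vec n (\<lambda>i. if i < m then v $ i else 0)"
  have "P (?v m)" if "m \<le> n" for m
    using that
  proof (induction m)
    case 0
    \<comment> \<open>The zero vector is reached as a multiple of some unit vector, for which n has
      to be positive.\<close>
    have "?v 0 = 0 \<cdot>\<^sub>v unit_vec n 0" by (intro eq_vecI) auto
    thus ?case using smult[OF unit_vec_carrier unit[OF n], of 0] by simp
  next
    case (Suc m)
    have "?v (Suc m) = v $ m \<cdot>\<^sub>v unit_vec n m + ?v m"
      using Suc.prems by (intro eq_vecI) (auto simp: less_Suc_eq)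
    moreover have "P (v $ m \<cdot>\<^sub>v unit_vec n m + ?v m)"
      using Suc by (intro add smult unit) auto
    ultimately show ?case by simp
  qed
  moreover have "?v n = v" using v by (intro eq_vecI) auto
  ultimately show ?thesis by (metis order_refl)
qed

lemma vec_in_tensor_closed: "vec_in_tensor n v \<in> carrier (tensor_algebra n)"
proof -
  have "w \<in> (\<lambda>i. [i]) ` {..<n}" if "vec_in_tensor n v w \<noteq> 0" for w
    using that by (cases w) (auto simp: vec_in_tensor_def split: if_splits)
  moreover have "finite ((\<lambda>i. [i]) ` {..<n})" "(\<lambda>i. [i]) ` {..<n} \<subseteq> lists {..<n}" by auto
  ultimately show ?thesis
    unfolding tensor_algebra_def free_algebra_simps by (blast intro: finite_subset)
qed

lemma vec_in_tensor_simps: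
  "u \<in> carrier_vec n \<Longrightarrow> v \<in> carrier_vec n \<Longrightarrow>
    vec_in_tensor n (u + v) = vec_in_tensor n u \<oplus>\<^bsub>tensor_algebra n\<^esub> vec_in_tensor n v"
  "v \<in> carrier_vec n \<Longrightarrow> vec_in_tensor n (c \<cdot>\<^sub>v v) = c \<odot>\<^bsub>tensor_algebra n\<^esub> vec_in_tensor n v"
  "i < n \<Longrightarrow> vec_in_tensor n (unit_vec n i) = free_gen i"
  unfolding tensor_algebra_def free_algebra_simps
  by (auto simp: vec_in_tensor_def free_gen_def fun_eq_iff length_Suc_conv)

text \<open>
  \<open>v\<^sub>i\<close> in \<open>A\<close> corresponds to \<open>v\<^sub>i + M\<^sub>i\<close> in \<open>H\<^sup>*\<close> divided by \<open>scale\<close>: the commutators of the latter are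
  \<open>C i j / 4\<close>, those required in \<open>A\<close> are \<open>C i j / 3\<close>.
\<close>

definition scale :: complex where "scale = complex_of_real (sqrt 3 / 2)"

lemma scale_square: "scale * scale = 3/4" "inverse scale * inverse scale = 4/3" "scale \<noteq> 0"
proof -
  show 1: "scale * scale = 3/4" unfolding scale_def by (simp flip: of_real_mult)
  thus "scale \<noteq> 0" by auto
  have "inverse scale * inverse scale = inverse (scale * scale)" by simp
  thus "inverse scale * inverse scale = 4/3" unfolding 1 by simp
qed

context hecke_rep
begin

section \<open>Families that define homomorphisms out of the two algebras\<close>

definition form_sum :: "complex vec \<Rightarrow> complex vec \<Rightarrow> 'a" where
  "form_sum v w = (\<Oplus>g\<in>carrier G. a g v w \<odot> T g)"

text \<open>By \<open>A_lift\<close> such a family gives a homomorphism from A to R that sends each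
  group element g to T g. Commutators are prescribed on basis vectors only, since both sides are
  bilinear.\<close>

definition A_module :: "(nat \<Rightarrow> 'a) \<Rightarrow> bool" where
  "A_module w \<longleftrightarrow> equivariant w \<and>
     (\<forall>i<n. \<forall>j<n. comm (w i) (w j) = form_sum (unit_vec n i) (unit_vec n j))"

text \<open>These are the relations of \<open>H_star\<close> beyond those of the group, read in R;
  \<open>H_lift\<close> turns such a family into a homomorphism.\<close>

definition H_module :: "complex \<Rightarrow> (nat \<Rightarrow> 'a) \<Rightarrow> bool" where
  "H_module \<xi> x \<longleftrightarrow> (\<forall>i<n. x i \<in> carrier R) \<and> (\<forall>i<n. \<forall>j<n. x i \<otimes> x j = x j \<otimes> x i) \<and>
     (\<forall>i<n. \<forall>k<n. T (xi_mat n \<xi> i) \<otimes> x k = x k \<otimes> T (xi_mat n \<xi> i)) \<and>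
     (\<forall>i k. Suc i < n \<longrightarrow> k < n \<longrightarrow> k \<noteq> i \<longrightarrow> k \<noteq> Suc i \<longrightarrow>
        T (simple_refl n i) \<otimes> x k = x k \<otimes> T (simple_refl n i)) \<and>
     (\<forall>i. Suc i < n \<longrightarrow> T (simple_refl n i) \<otimes> x (Suc i) = x i \<otimes> T (simple_refl n i) \<oplus>
        (\<Oplus>b\<in>{..<r}. (T (xi_mat n \<xi> i) [^] b) \<otimes> (T (inv\<^bsub>G\<^esub> (xi_mat n \<xi> (Suc i))) [^] b)))"

lemma equivariant_smult:
  assumes "equivariant u" shows "equivariant (\<lambda>i. c \<odot> u i)"
  using assms by (simp add: equivariant_def smult_mult_left smult_mult_right)

lemma form_sum_closed [simp]: "form_sum v w \<in> carrier R"
  unfolding form_sum_def by (intro finsum_closed) auto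

lemma form_sum_unit: "i < n \<Longrightarrow> j < n \<Longrightarrow> i \<noteq> j \<Longrightarrow>
    form_sum (unit_vec n i) (unit_vec n j) = (1/3) \<odot> C i j"
  unfolding form_sum_def by (rule finsum_forms)

lemma form_sum_alt:
  assumes "v \<in> carrier_vec n" shows "form_sum v v = \<zero>"
proof -
  have "form_sum v v = (\<Oplus>g\<in>carrier G. \<zero>)"
    unfolding form_sum_def using assms form_alt by (intro finsum_cong') auto
  thus ?thesis by simp
qed

lemma form_sum_lin:
  assumes "u \<in> carrier_vec n" "v \<in> carrier_vec n" "w \<in> carrier_vec n"
  shows "form_sum (u + v) w = form_sum u w \<oplus> form_sum v w"
    "form_sum (c \<cdot>\<^sub>v u) w = c \<odot> form_sum u w"
    "form_sum u v = \<ominus> form_sum v u"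
proof -
  have "form_sum (u + v) w = (\<Oplus>g\<in>carrier G. a g u w \<odot> T g \<oplus> a g v w \<odot> T g)"
    unfolding form_sum_def using form_lin(1)[OF _ assms]
    by (intro finsum_cong') (auto simp: smult_add_left)
  thus "form_sum (u + v) w = form_sum u w \<oplus> form_sum v w"
    unfolding form_sum_def by (subst (asm) finsum_addf) auto
  have "form_sum (c \<cdot>\<^sub>v u) w = (\<Oplus>g\<in>carrier G. c \<odot> (a g u w \<odot> T g))"
    unfolding form_sum_def using form_lin(2)[OF _ assms]
    by (intro finsum_cong') (auto simp: smult_smult)
  thus "form_sum (c \<cdot>\<^sub>v u) w = c \<odot> form_sum u w"
    unfolding form_sum_def by (subst smult_finsum) auto
  have "form_sum u v = (\<Oplus>g\<in>carrier G. (- 1) \<odot> (a g v u \<odot> T g))"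
    unfolding form_sum_def using form_lin(5)[OF _ assms]
    by (intro finsum_cong') (auto simp: smult_smult)
  also have "\<dots> = (- 1) \<odot> form_sum v u"
    unfolding form_sum_def by (subst smult_finsum) auto
  finally show "form_sum u v = \<ominus> form_sum v u" by (simp add: smult_minus_1)
qed

lemma H_module_of_A_module:
  assumes prim: "primitive_root_of_unity r \<xi>" and w: "A_module w"
  shows "H_module \<xi> (\<lambda>i. scale \<odot> w i \<ominus> M i)"
proof -
  have \<xi>: "\<xi> ^ r = 1" using prim by (simp add: primitive_root_of_unity_def)
  define u where "u i = scale \<odot> w i" for i
  have eq: "equivariant u" unfolding u_def using w by (intro equivariant_smult) (simp add: A_module_def)
  have uc [simp]: "u i \<in> carrier R" if "i < n" for i using eq that by (simp add: equivariant_def)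
  have ue: "T g \<otimes> u i = u (perm_of n g i) \<otimes> T g" if "g \<in> carrier G" "i < n" for g i
    using eq that by (simp add: equivariant_def)
  have wc: "w i \<in> carrier R" if "i < n" for i using w that by (simp add: A_module_def equivariant_def)
  have diff: "t \<otimes> (p \<ominus> q) = t \<otimes> p \<ominus> t \<otimes> q" "(p \<ominus> q) \<otimes> t = p \<otimes> t \<ominus> q \<otimes> t"
    if "t \<in> carrier R" "p \<in> carrier R" "q \<in> carrier R" for t p q
    using that by (simp_all add: a_minus_def r_distr l_distr r_minus l_minus)
  have comm: "(u i \<ominus> M i) \<otimes> (u j \<ominus> M j) = (u j \<ominus> M j) \<otimes> (u i \<ominus> M i)" if ij: "i < n" "j < n" for i j
  proof (cases "i = j")
    case False
    \<comment> \<open>Rescaling turns the factor 1/3 of the forms into the 1/4 that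
      \<open>comm_shift\<close> subtracts.\<close>
    have "comm (u i) (u j) = (scale * scale) \<odot> ((1/3) \<odot> C i j)"
      unfolding u_def using w ij wc False form_sum_unit by (simp add: comm_smult A_module_def)
    also have "\<dots> = (1/4) \<odot> C i j" unfolding scale_square(1) by (simp add: smult_smult)
    finally have "comm (u i \<ominus> M i) (u j \<ominus> M j) = \<zero>"
      using comm_shift[OF eq ij False] diff_eq_zero_iff by simp
    thus ?thesis using ij by (simp add: comm_def diff_eq_zero_iff)
  qed simp
  have xi: "T (xi_mat n \<xi> i) \<otimes> (u k \<ominus> M k) = (u k \<ominus> M k) \<otimes> T (xi_mat n \<xi> i)"
    if "k < n" for i k
    using T_M_id[OF xi_mat_Grn(1)[OF \<xi>, of i] that xi_mat_Grn(2)[OF \<xi>]] ue[OF xi_mat_Grn(1)[OF \<xi>, of i] that]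
      xi_mat_Grn(1)[OF \<xi>, of i] xi_mat_Grn(2)[OF \<xi> that, of i] that
    by (simp add: diff)
  have s: "T (simple_refl n i) \<otimes> (u k \<ominus> M k) = (u k \<ominus> M k) \<otimes> T (simple_refl n i)"
    if "Suc i < n" "k < n" "k \<noteq> i" "k \<noteq> Suc i" for i k
    using T_simple_M_other[OF that] ue[OF simple_refl_Grn(1)[OF that(1)] that(2)]
      simple_refl_Grn(1)[OF that(1)] simple_refl_Grn(2)[OF that(1,2)] that
    by (simp add: diff)
  have s': "T (simple_refl n i) \<otimes> (u (Suc i) \<ominus> M (Suc i)) = (u i \<ominus> M i) \<otimes> T (simple_refl n i) \<oplus>
      (\<Oplus>b\<in>{..<r}. (T (xi_mat n \<xi> i) [^] b) \<otimes> (T (inv\<^bsub>G\<^esub> (xi_mat n \<xi> (Suc i))) [^] b))"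
    if i: "Suc i < n" for i
  proof -
    let ?s = "T (simple_refl n i)"
    have sc: "?s \<in> carrier R" using simple_refl_Grn(1)[OF i] by simp
    have i': "i < n" using i by simp
    have "?s \<otimes> (u (Suc i) \<ominus> M (Suc i)) = u i \<otimes> ?s \<ominus> (M i \<ominus> S i (Suc i)) \<otimes> ?s"
      using T_simple_M_Suc[OF i] ue[OF simple_refl_Grn(1)[OF i] i] simple_refl_Grn(2)[OF i i] sc i
      by (simp add: diff)
    also have "\<dots> = (u i \<ominus> M i) \<otimes> ?s \<oplus> S i (Suc i) \<otimes> ?s"
      using sc i' by (simp add: diff a_minus_def minus_add minus_minus a_assoc l_distr l_minus)
    finally show ?thesis unfolding sum_twisted[OF prim i] .
  qed
  show ?thesis
    unfolding H_module_def u_def[symmetric] using comm xi s s' by auto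
qed

lemma A_module_of_H_module:
  assumes prim: "primitive_root_of_unity r \<xi>" and x: "H_module \<xi> x"
  shows "A_module (\<lambda>i. inverse scale \<odot> (x i \<oplus> M i))"
proof -
  have \<xi>: "\<xi> ^ r = 1" using prim by (simp add: primitive_root_of_unity_def)
  define u where "u i = x i \<oplus> M i" for i
  have xc: "x i \<in> carrier R" if "i < n" for i using x that by (simp add: H_module_def)
  hence uc: "u i \<in> carrier R" if "i < n" for i using that by (simp add: u_def)
  have ue: "\<forall>i<n. T g \<otimes> u i = u (perm_of n g i) \<otimes> T g" if "g \<in> carrier G" for g
    using prim that
  proof (induction g rule: Grn_induct)
    case one
    thus ?case using uc by (simp add: T_one)
  next
    case (xi i)
    show ?case
    proof (intro allI impI)
      fix k assume k: "k < n"
      note X = xi_mat_Grn[OF \<xi>, where i = i]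
      have "T (xi_mat n \<xi> i) \<otimes> x k = x k \<otimes> T (xi_mat n \<xi> i)"
        using x xi k by (simp add: H_module_def)
      thus "T (xi_mat n \<xi> i) \<otimes> u k = u (perm_of n (xi_mat n \<xi> i) k) \<otimes> T (xi_mat n \<xi> i)"
        using T_M_id[OF X(1) k X(2)] X(1) X(2)[OF k] xc[OF k] by (simp add: u_def r_distr l_distr)
    qed
  next
    case (simple i)
    let ?s = "T (simple_refl n i)"
    note G = simple_refl_Grn[OF simple]
    have sc: "?s \<in> carrier R" using G by simp
    have i: "i < n" using simple by simp
    \<comment> \<open>The sum gained by moving the reflection past x is the one lost by moving it
      past M, so the two corrections cancel in u.\<close>
    have "?s \<otimes> u (Suc i) = x i \<otimes> ?s \<oplus> S i (Suc i) \<otimes> ?s \<oplus> (M i \<ominus> S i (Suc i)) \<otimes> ?s"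
      using x simple T_simple_M_Suc[OF simple] sum_twisted[OF prim simple] sc xc[OF simple]
      by (simp add: u_def r_distr H_module_def)
    also have "\<dots> = u i \<otimes> ?s"
      using sc xc[OF i] by (simp add: u_def a_minus_def l_distr l_minus a_ac r_neg)
    finally have 1: "?s \<otimes> u (Suc i) = u i \<otimes> ?s" .
    \<comment> \<open>The presentation has no relation for the reflection and the i-th generator. It
      follows by multiplying the previous identity on both sides by the reflection, which is its own
      inverse.\<close>
    have "u (Suc i) \<otimes> ?s = (?s \<otimes> ?s) \<otimes> (u (Suc i) \<otimes> ?s)"
      using T_simple_simple[OF simple] sc uc[OF simple] by simp
    also have "\<dots> = ?s \<otimes> ((?s \<otimes> u (Suc i)) \<otimes> ?s)"
      using sc uc[OF simple] by (simp add: m_assoc)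
    also have "\<dots> = ?s \<otimes> (u i \<otimes> (?s \<otimes> ?s))"
      unfolding 1 using sc uc[OF i] by (simp add: m_assoc)
    also have "\<dots> = ?s \<otimes> u i"
      using T_simple_simple[OF simple] sc uc[OF i] by simp
    finally have 2: "?s \<otimes> u i = u (Suc i) \<otimes> ?s" by simp
    show ?case
    proof (intro allI impI)
      fix k assume k: "k < n"
      consider "k = i" | "k = Suc i" | "k \<noteq> i" "k \<noteq> Suc i" by blast
      thus "?s \<otimes> u k = u (perm_of n (simple_refl n i) k) \<otimes> ?s"
      proof cases
        case 3
        have "?s \<otimes> x k = x k \<otimes> ?s" using x simple k 3 by (simp add: H_module_def)
        thus ?thesis
          using T_simple_M_other[OF simple k 3] G(2)[OF k] 3 sc xc[OF k] by (simp add: u_def r_distr l_distr)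
      qed (use 1 2 G(2)[OF k] in simp_all)
    qed
  next
    case (mult g h)
    show ?case
    proof (intro allI impI)
      fix k assume k: "k < n"
      have hk: "perm_of n h k < n" and ghk: "perm_of n g (perm_of n h k) < n" using mult k by simp_all
      have gT: "T g \<in> carrier R" "T h \<in> carrier R" using mult by simp_all
      have IH: "T h \<otimes> u k = u (perm_of n h k) \<otimes> T h"
        "T g \<otimes> u (perm_of n h k) = u (perm_of n g (perm_of n h k)) \<otimes> T g"
        using mult k hk by simp_all
      have "T (g * h) \<otimes> u k = T g \<otimes> (T h \<otimes> u k)"
        using mult uc[OF k] by (simp add: T_mult m_assoc)
      also have "\<dots> = (T g \<otimes> u (perm_of n h k)) \<otimes> T h"
        unfolding IH(1) by (rule m_assoc[OF gT(1) uc[OF hk] gT(2), symmetric])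
      also have "\<dots> = u (perm_of n g (perm_of n h k)) \<otimes> T (g * h)"
        unfolding IH(2) using mult gT uc[OF ghk] by (simp add: T_mult m_assoc)
      finally show "T (g * h) \<otimes> u k = u (perm_of n (g * h) k) \<otimes> T (g * h)"
        using mult k by (simp add: perm_mult)
    qed
  qed
  have eq: "equivariant u" using ue uc by (simp add: equivariant_def)
  have "comm (inverse scale \<odot> u i) (inverse scale \<odot> u j) = form_sum (unit_vec n i) (unit_vec n j)"
    if ij: "i < n" "j < n" for i j
  proof (cases "i = j")
    case True
    thus ?thesis using ij uc form_sum_alt by (simp add: comm_def a_minus_def r_neg)
  next
    case False
    have um: "u k \<ominus> M k = x k" if "k < n" for k
      using xc[OF that] by (simp add: u_def a_minus_def a_assoc r_neg)
    have "comm (x i) (x j) = \<zero>" using x ij xc by (intro comm_eq_0) (auto simp: H_module_def)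
    moreover have "comm (x i) (x j) = comm (u i) (u j) \<ominus> (1/4) \<odot> C i j"
      using comm_shift[OF eq ij False] um[OF ij(1)] um[OF ij(2)] by simp
    ultimately have "comm (u i) (u j) \<ominus> (1/4) \<odot> C i j = \<zero>" by (rule trans[OF sym, rotated])
    hence "comm (u i) (u j) = (1/4) \<odot> C i j"
      using ij uc by (simp add: diff_eq_zero_iff)
    hence "comm (inverse scale \<odot> u i) (inverse scale \<odot> u j) = (4/3) \<odot> ((1/4) \<odot> C i j)"
      using ij uc by (simp add: comm_smult scale_square(2) del: inverse_mult_distrib)
    thus ?thesis using form_sum_unit[OF ij False] by (simp add: smult_smult)
  qed
  thus ?thesis
    unfolding A_module_def u_def[symmetric] using equivariant_smult[OF eq] by blast
qed

end


section \<open>The universal property of \<open>A\<^sub>r\<^sub>,\<^sub>1\<^sub>,\<^sub>n\<close>\<close>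

context hecke_form_family
begin

sublocale skew: skew_group_action "tensor_algebra n" "Grn r n" "\<lambda>g. tensor_act n (rho n g)"
  by (rule tensor_skew_action)

lemma skew_TV_eq: "skew_TV r n = skew_group_algebra (tensor_algebra n) (Grn r n) (\<lambda>g. tensor_act n (rho n g))"
  by (simp add: skew_TV_def)

lemma complex_algebra_TV: "complex_algebra (skew_TV r n)"
  unfolding skew_TV_eq by (rule skew.complex_algebra_skew)

sublocale TV: complex_algebra "skew_TV r n" by (rule complex_algebra_TV)

lemma A_vec_closed [simp]: "A_vec n v \<in> carrier (skew_TV r n)"
  unfolding skew_TV_eq A_vec_def using vec_in_tensor_closed by simp

lemma A_bar_closed [simp]: "g \<in> carrier G \<Longrightarrow> A_bar n g \<in> carrier (skew_TV r n)"
  unfolding skew_TV_eq A_bar_def by simp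

lemma A_rels_closed: "A_rels r n a \<subseteq> carrier (skew_TV r n)"
  unfolding A_rels_def Let_def by (auto intro!: TV.minus_closed TV.m_closed TV.finsum_closed)

abbreviation A_proj where "A_proj x \<equiv> Idl\<^bsub>skew_TV r n\<^esub> (A_rels r n a) +>\<^bsub>skew_TV r n\<^esub> x"

sublocale AI: algebra_ideal "skew_TV r n" "Idl\<^bsub>skew_TV r n\<^esub> (A_rels r n a)"
  by (rule TV.algebra_ideal_genideal[OF A_rels_closed])

lemma complex_algebra_A: "complex_algebra (A_algebra r n a)"
  unfolding A_algebra_def by (rule AI.complex_algebra_quot)

lemma A_proj_hom: "alg_hom_pair (skew_TV r n) (A_algebra r n a) A_proj"
  using AI.proj_hom complex_algebra_A complex_algebra_TV
  by (simp add: alg_hom_pair_def alg_hom_pair_axioms_def A_algebra_def)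

lemma hecke_rep_A: "hecke_rep (A_algebra r n a) r n (\<lambda>g. A_proj (A_bar n g)) a"
proof -
  interpret A: complex_algebra "A_algebra r n a" by (rule complex_algebra_A)
  interpret p: alg_hom_pair "skew_TV r n" "A_algebra r n a" A_proj by (rule A_proj_hom)
  have one: "A_bar n (1\<^sub>m n) = \<one>\<^bsub>skew_TV r n\<^esub>"
    unfolding A_bar_def skew_TV_eq skew.one_skew by simp
  have mult: "A_bar n (g * h) = A_bar n g \<otimes>\<^bsub>skew_TV r n\<^esub> A_bar n h"
    if "g \<in> carrier G" "h \<in> carrier G" for g h
    unfolding A_bar_def skew_TV_eq
    using skew.pure_tensor_mult[of "\<one>\<^bsub>tensor_algebra n\<^esub>" g "\<one>\<^bsub>tensor_algebra n\<^esub>" h] that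
      alg_hom_one[OF tensor_act_hom[OF that(1)]] by simp
  show ?thesis
    by unfold_locales (auto simp: one mult p.one p.mult)
qed

lemma A_module_A:
  "hecke_rep.A_module (A_algebra r n a) r n (\<lambda>g. A_proj (A_bar n g)) a (\<lambda>i. A_proj (A_vec n (unit_vec n i)))"
proof -
  interpret A: hecke_rep "A_algebra r n a" r n "\<lambda>g. A_proj (A_bar n g)" a by (rule hecke_rep_A)
  interpret p: alg_hom_pair "skew_TV r n" "A_algebra r n a" A_proj by (rule A_proj_hom)
  let ?e = "\<lambda>i. unit_vec n i :: complex vec"
  have "A_bar n g \<otimes>\<^bsub>skew_TV r n\<^esub> A_vec n (?e i) = A_vec n (?e (perm_of n g i)) \<otimes>\<^bsub>skew_TV r n\<^esub> A_bar n g"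
    if g: "g \<in> carrier G" and i: "i < n" for g i
  proof -
    have fg: "free_gen k \<in> carrier (tensor_algebra n)" if "k < n" for k
      using that by (simp add: tensor_algebra_def)
    have "tensor_act n (rho n g) (free_gen i) = free_gen (perm_of n g i)"
      using tensor_act_word[OF g, of "[i]"] i by (simp add: free_gen_eq_word)
    moreover have "tensor_act n (rho n (1\<^sub>m n)) \<one>\<^bsub>tensor_algebra n\<^esub> = \<one>\<^bsub>tensor_algebra n\<^esub>"
      using alg_hom_one[OF tensor_act_hom[OF one_closed]] .
    moreover have "g * 1\<^sub>m n = g" "1\<^sub>m n * g = g" using Grn_carrier_mat[OF g] by simp_all
    ultimately show ?thesis
      unfolding A_bar_def A_vec_def skew_TV_eq
      using g i fg[of i] fg[of "perm_of n g i"]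
        skew.pure_tensor_mult[of "\<one>\<^bsub>tensor_algebra n\<^esub>" g "free_gen i" "1\<^sub>m n"]
        skew.pure_tensor_mult[of "free_gen (perm_of n g i)" "1\<^sub>m n" "\<one>\<^bsub>tensor_algebra n\<^esub>" g]
      by (simp add: vec_in_tensor_simps)
  qed
  hence eq: "A.equivariant (\<lambda>i. A_proj (A_vec n (?e i)))"
    unfolding A.equivariant_def by (auto simp flip: p.mult)
  have "A.comm (A_proj (A_vec n (?e i))) (A_proj (A_vec n (?e j))) = A.form_sum (?e i) (?e j)"
    if "i < n" "j < n" for i j
  proof -
    let ?S = "skew_TV r n"
    let ?c = "A_vec n (?e i) \<otimes>\<^bsub>?S\<^esub> A_vec n (?e j) \<ominus>\<^bsub>?S\<^esub> A_vec n (?e j) \<otimes>\<^bsub>?S\<^esub> A_vec n (?e i)"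
    let ?f = "\<Oplus>\<^bsub>?S\<^esub>g\<in>carrier G. a g (?e i) (?e j) \<odot>\<^bsub>?S\<^esub> A_bar n g"
    have c: "?c \<in> carrier ?S" and f: "?f \<in> carrier ?S"
      by (auto intro!: TV.minus_closed TV.m_closed TV.finsum_closed)
    have "?c \<ominus>\<^bsub>?S\<^esub> ?f \<in> A_rels r n a" unfolding A_rels_def Let_def by fastforce
    hence "A_proj (?c \<ominus>\<^bsub>?S\<^esub> ?f) = \<zero>\<^bsub>A_algebra r n a\<^esub>"
      unfolding A_algebra_def by (rule TV.proj_rel[OF A_rels_closed])
    hence "A_proj ?c = A_proj ?f"
      using c f p.diff[OF c f] A.diff_eq_zero_iff by simp
    moreover have "A_proj ?c = A.comm (A_proj (A_vec n (?e i))) (A_proj (A_vec n (?e j)))"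
      by (simp add: p.diff p.mult A.comm_def)
    moreover have "A_proj ?f = A.form_sum (?e i) (?e j)"
    proof -
      have "A_proj ?f = (\<Oplus>\<^bsub>A_algebra r n a\<^esub>g\<in>carrier G. A_proj (a g (?e i) (?e j) \<odot>\<^bsub>?S\<^esub> A_bar n g))"
        by (rule p.finsum) auto
      also have "\<dots> = A.form_sum (?e i) (?e j)"
        unfolding A.form_sum_def by (rule A.finsum_cong'[OF refl]) (simp_all add: p.smult)
      finally show ?thesis .
    qed
    ultimately show ?thesis by simp
  qed
  thus ?thesis using eq by (simp add: A.A_module_def)
qed

text \<open>The uniqueness statements compose: A is a quotient of the skew group algebra, which is
  generated by the tensor algebra and the group, and the tensor algebra is generated by the basis
  vectors.\<close>

lemma A_hom_eqI:
  assumes B: "complex_algebra B" and f: "f \<in> alg_hom (A_algebra r n a) B" and g: "g \<in> alg_hom (A_algebra r n a) B"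
    and v: "\<And>i. i < n \<Longrightarrow> f (A_proj (A_vec n (unit_vec n i))) = g (A_proj (A_vec n (unit_vec n i)))"
    and G: "\<And>x. x \<in> carrier G \<Longrightarrow> f (A_proj (A_bar n x)) = g (A_proj (A_bar n x))"
    and X: "X \<in> carrier (A_algebra r n a)"
  shows "f X = g X"
proof -
  interpret p: alg_hom_pair "skew_TV r n" "A_algebra r n a" A_proj by (rule A_proj_hom)
  obtain F where F: "F \<in> carrier (skew_TV r n)" "X = A_proj F"
    using X unfolding A_algebra_def AI.carrier_quot by blast
  have fp: "(\<lambda>F. f (A_proj F)) \<in> alg_hom skew.S B" and gp: "(\<lambda>F. g (A_proj F)) \<in> alg_hom skew.S B"
    using alg_hom_comp[OF p.hom f] alg_hom_comp[OF p.hom g] by (simp_all add: skew_TV_eq)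
  have "f (A_proj F) = g (A_proj F)"
  proof (rule skew.alg_hom_skew_eqI[OF B fp gp])
    fix b assume b: "b \<in> carrier (tensor_algebra n)"
    show "f (A_proj (pure_tensor (tensor_algebra n) b \<one>\<^bsub>G\<^esub>)) = g (A_proj (pure_tensor (tensor_algebra n) b \<one>\<^bsub>G\<^esub>))"
    proof (rule alg_hom_free_eqI[OF B])
      show "b \<in> carrier (free_algebra {..<n})" using b by (simp add: tensor_algebra_def)
      show "(\<lambda>b. f (A_proj (pure_tensor (tensor_algebra n) b \<one>\<^bsub>G\<^esub>))) \<in> alg_hom (free_algebra {..<n}) B"
        "(\<lambda>b. g (A_proj (pure_tensor (tensor_algebra n) b \<one>\<^bsub>G\<^esub>))) \<in> alg_hom (free_algebra {..<n}) B"
        using alg_hom_comp[OF skew.inject_hom fp] alg_hom_comp[OF skew.inject_hom gp]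
        unfolding tensor_algebra_def by blast+
      show "f (A_proj (pure_tensor (tensor_algebra n) (free_gen i) \<one>\<^bsub>G\<^esub>)) =
          g (A_proj (pure_tensor (tensor_algebra n) (free_gen i) \<one>\<^bsub>G\<^esub>))" if "i \<in> {..<n}" for i
        using v[of i] that by (simp add: A_vec_def vec_in_tensor_simps)
    qed
  next
    show "f (A_proj (pure_tensor (tensor_algebra n) \<one>\<^bsub>tensor_algebra n\<^esub> x)) =
        g (A_proj (pure_tensor (tensor_algebra n) \<one>\<^bsub>tensor_algebra n\<^esub> x))" if "x \<in> carrier G" for x
      using G[OF that] by (simp add: A_bar_def)
    show "F \<in> carrier skew.S" using F by (simp add: skew_TV_eq)
  qed
  thus ?thesis using F by simp
qed

end

text \<open>The homomorphism is built on the tensor algebra, extended to the skew group algebra by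
  equivariance of w, and factored through the quotient. The last stage has to kill a relation for
  every pair of vectors, whereas w gives information on basis vectors only.\<close>

lemma (in hecke_rep) A_lift:
  assumes w: "A_module w"
  obtains f where "f \<in> alg_hom (A_algebra r n a) R"
    "\<And>i. i < n \<Longrightarrow> f (A_proj (A_vec n (unit_vec n i))) = w i"
    "\<And>g. g \<in> carrier G \<Longrightarrow> f (A_proj (A_bar n g)) = T g"
proof -
  have eq: "equivariant w" using w by (simp add: A_module_def)
  have wc: "w \<in> {..<n} \<rightarrow> carrier R" using eq by (auto simp: equivariant_def)
  have \<phi>: "free_eval w \<in> alg_hom (tensor_algebra n) R"
    unfolding tensor_algebra_def by (rule free_eval_hom[OF wc])
  interpret \<phi>: alg_hom_pair "tensor_algebra n" R "free_eval w"
    using \<phi> by unfold_locales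
  \<comment> \<open>Covariance on words follows by carrying T g past one letter after the
    other.\<close>
  have word: "T g \<otimes> word_prod w u = word_prod w (map (perm_of n g) u) \<otimes> T g"
    if g: "g \<in> carrier G" and u: "u \<in> lists {..<n}" for g u
    using u
  proof (induction u)
    case Nil
    thus ?case using g by (simp add: word_prod_def)
  next
    case (Cons i u)
    have "u \<in> lists {..<n}" using Cons by simp
    hence "word_prod w u \<in> carrier R" "word_prod w (map (perm_of n g) u) \<in> carrier R"
      by (intro word_prod_closed[OF wc] map_perm_closed g; assumption)+
    moreover have "w i \<in> carrier R" "w (perm_of n g i) \<in> carrier R" using Cons g wc by auto
    ultimately have c: "w i \<in> carrier R" "w (perm_of n g i) \<in> carrier R" "word_prod w u \<in> carrier R"
      "word_prod w (map (perm_of n g) u) \<in> carrier R" by simp_all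
    have "T g \<otimes> (w i \<otimes> word_prod w u) = (T g \<otimes> w i) \<otimes> word_prod w u"
      using c g by (simp add: m_assoc)
    also have "T g \<otimes> w i = w (perm_of n g i) \<otimes> T g" using eq g Cons by (simp add: equivariant_def)
    also have "w (perm_of n g i) \<otimes> T g \<otimes> word_prod w u =
        w (perm_of n g i) \<otimes> word_prod w (map (perm_of n g) u) \<otimes> T g"
      using c g Cons by (simp add: m_assoc)
    finally show ?case by (simp add: word_prod_def)
  qed
  have act: "T g \<otimes> free_eval w b = free_eval w (tensor_act n (rho n g) b) \<otimes> T g"
    if g: "g \<in> carrier G" and b: "b \<in> carrier (tensor_algebra n)" for g b
  proof -
    interpret ag: alg_hom_pair "tensor_algebra n" "tensor_algebra n" "tensor_act n (rho n g)"
      using tensor_act_hom[OF g] by unfold_locales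
    from b have "b \<in> carrier (free_algebra {..<n})" by (simp add: tensor_algebra_def)
    thus ?thesis
    proof (induction b rule: free_algebra_induct)
      case zero
      thus ?case using g \<phi>.zero ag.zero by (simp add: tensor_algebra_def)
    next
      case (add b c u)
      have 1: "b \<in> carrier (tensor_algebra n)" "free_word u \<in> carrier (tensor_algebra n)"
        "free_word (map (perm_of n g) u) \<in> carrier (tensor_algebra n)"
        using add map_perm_closed[OF g] by (simp_all add: tensor_algebra_def)
      have 2: "free_eval w (free_word u) = word_prod w u"
        "free_eval w (free_word (map (perm_of n g) u)) = word_prod w (map (perm_of n g) u)"
        using free_eval_word[OF wc] add map_perm_closed[OF g] by blast+
      have 3: "word_prod w u \<in> carrier R" "word_prod w (map (perm_of n g) u) \<in> carrier R"
        using word_prod_closed[OF wc] add map_perm_closed[OF g] by blast+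
      show ?case
        using 1 2 3 g add word[OF g] unfolding tensor_algebra_def[symmetric]
        by (simp add: \<phi>.add \<phi>.smult ag.add ag.smult tensor_act_word[OF g] r_distr l_distr
            smult_mult_left smult_mult_right)
    qed
  qed
  obtain \<Psi> where \<Psi>: "\<Psi> \<in> alg_hom skew.S R"
    "\<And>b g. b \<in> carrier (tensor_algebra n) \<Longrightarrow> g \<in> carrier G \<Longrightarrow>
      \<Psi> (pure_tensor (tensor_algebra n) b g) = free_eval w b \<otimes> T g"
    by (rule skew.skew_lift[OF complex_algebra_axioms \<phi>, of T]) (auto simp: T_one T_mult act)
  interpret \<Psi>: alg_hom_pair "skew_TV r n" R \<Psi>
    using \<Psi>(1) by unfold_locales (simp add: skew_TV_eq)
  define V where "V v = free_eval w (vec_in_tensor n v)" for v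
  have Vc [simp]: "V v \<in> carrier R" for v unfolding V_def by (simp add: vec_in_tensor_closed)
  have \<Psi>_vec: "\<Psi> (A_vec n v) = V v" for v
    unfolding A_vec_def using \<Psi>(2)[OF vec_in_tensor_closed one_closed] T_one
    by (simp add: V_def vec_in_tensor_closed)
  have \<Psi>_bar: "\<Psi> (A_bar n g) = T g" if "g \<in> carrier G" for g
    unfolding A_bar_def using \<Psi>(2)[OF _ that] that \<phi>.one by simp
  have V_unit: "V (unit_vec n i) = w i" if "i < n" for i
    using free_eval_gen[of i "{..<n}" w] wc that by (simp add: V_def vec_in_tensor_simps)
  have V_lin: "V (u + v) = V u \<oplus> V v" "V (c \<cdot>\<^sub>v u) = c \<odot> V u"
    if "u \<in> carrier_vec n" "v \<in> carrier_vec n" for u v c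
    using that by (simp_all add: V_def vec_in_tensor_simps \<phi>.add \<phi>.smult vec_in_tensor_closed)
  have n0: "n > 0" using n3 by simp
  \<comment> \<open>Linear extension is carried out in the first argument only; skew symmetry then
    transfers it to the second.\<close>
  have left: "comm (V v) (V u) = form_sum v u"
    if u: "u \<in> carrier_vec n" and v: "v \<in> carrier_vec n"
      and basis: "\<And>i. i < n \<Longrightarrow> comm (V (unit_vec n i)) (V u) = form_sum (unit_vec n i) u" for u v
    using v n0
  proof (induction v rule: carrier_vec_induct)
    case (unit i)
    thus ?case by (rule basis)
  next
    case (smult c v)
    thus ?case
      using comm_smult[of "V v" "V u" c 1] V_lin(2)[of v v c] form_sum_lin(2)[of v v u c] u by simp
  next
    case (add v v')
    have "comm (V v \<oplus> V v') (V u) = comm (V v) (V u) \<oplus> comm (V v') (V u)"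
      by (simp add: comm_def a_minus_def l_distr r_distr minus_add a_ac)
    thus ?case using add V_lin(1)[of v v'] form_sum_lin(1)[of v v' u] u by simp
  qed
  have swap: "comm (V v) (V u) = form_sum v u"
    if "comm (V u) (V v) = form_sum u v" "u \<in> carrier_vec n" "v \<in> carrier_vec n" for u v
    using that comm_swap[of "V u" "V v"] form_sum_lin(3)[of v u u] by simp
  have 1: "comm (V (unit_vec n i)) (V (unit_vec n j)) = form_sum (unit_vec n i) (unit_vec n j)"
    if "i < n" "j < n" for i j
    using w that by (simp add: A_module_def V_unit)
  have 2: "comm (V v) (V (unit_vec n j)) = form_sum v (unit_vec n j)" if "j < n" "v \<in> carrier_vec n" for j v
    using that(1) by (intro left[OF unit_vec_carrier that(2) 1])
  have 3: "comm (V (unit_vec n j)) (V v) = form_sum (unit_vec n j) v" if "j < n" "v \<in> carrier_vec n" for j v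
    by (rule swap[OF 2[OF that] that(2) unit_vec_carrier])
  have rel: "comm (V v) (V u) = form_sum v u" if "u \<in> carrier_vec n" "v \<in> carrier_vec n" for u v
    by (rule left[OF that 3[OF _ that(1)]])
  have kill: "\<Psi> x = \<zero>" if x: "x \<in> A_rels r n a" for x
  proof -
    let ?S = "skew_TV r n"
    obtain v u where vu: "v \<in> carrier_vec n" "u \<in> carrier_vec n" and
      x: "x = A_vec n v \<otimes>\<^bsub>?S\<^esub> A_vec n u \<ominus>\<^bsub>?S\<^esub> A_vec n u \<otimes>\<^bsub>?S\<^esub> A_vec n v
        \<ominus>\<^bsub>?S\<^esub> (\<Oplus>\<^bsub>?S\<^esub>g\<in>carrier G. a g v u \<odot>\<^bsub>?S\<^esub> A_bar n g)"
      using x unfolding A_rels_def Let_def by blast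
    have "\<Psi> (\<Oplus>\<^bsub>?S\<^esub>g\<in>carrier G. a g v u \<odot>\<^bsub>?S\<^esub> A_bar n g) = form_sum v u"
      unfolding form_sum_def by (subst \<Psi>.finsum) (auto simp: \<Psi>.smult \<Psi>_bar intro!: finsum_cong')
    moreover have "(\<Oplus>\<^bsub>?S\<^esub>g\<in>carrier G. a g v u \<odot>\<^bsub>?S\<^esub> A_bar n g) \<in> carrier ?S"
      by (auto intro!: TV.finsum_closed)
    ultimately have "\<Psi> x = comm (V v) (V u) \<ominus> form_sum v u"
      unfolding x by (simp add: \<Psi>.diff \<Psi>.mult \<Psi>_vec comm_def)
    thus ?thesis using rel[OF vu(2,1)] by (simp add: a_minus_def r_neg)
  qed
  obtain k where k: "k \<in> alg_hom (A_algebra r n a) R"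
    "\<And>x. x \<in> carrier (skew_TV r n) \<Longrightarrow> k (A_proj x) = \<Psi> x"
    using TV.quot_lift[OF complex_algebra_axioms \<Psi>.hom A_rels_closed kill]
    unfolding A_algebra_def by metis
  show ?thesis
    by (rule that[OF k(1)]) (simp_all add: k(2) \<Psi>_vec V_unit \<Psi>_bar)
qed


section \<open>The universal property of \<open>H\<^sup>*\<^sub>r\<^sub>,\<^sub>1\<^sub>,\<^sub>n\<close>\<close>

locale wreath_hecke = hecke_form_family r n a for r n a +
  fixes \<xi> :: complex
  assumes prim: "primitive_root_of_unity r \<xi>"
begin

lemma root: "\<xi> ^ r = 1"
  using prim by (simp add: primitive_root_of_unity_def)

lemma simple_refl_closed [simp]: "Suc i < n \<Longrightarrow> simple_refl n i \<in> carrier G"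
  unfolding simple_refl_def by (intro perm_mat_Grn(1) permutes_swap_id) auto

lemma xi_closed [simp]: "xi_mat n \<xi> i \<in> carrier G"
  by (rule xi_mat_Grn(1)[OF root])

lemma complex_algebra_H_free: "complex_algebra (H_free r n)"
  unfolding H_free_def by (rule complex_algebra_free)

sublocale HF: complex_algebra "H_free r n" by (rule complex_algebra_H_free)

lemma H_v_closed [simp]: "i < n \<Longrightarrow> H_v i \<in> carrier (H_free r n)"
  unfolding H_free_def by (intro free_gen_closed) auto

lemma H_bar_closed [simp]: "g \<in> carrier G \<Longrightarrow> H_bar g \<in> carrier (H_free r n)"
  unfolding H_free_def by (intro free_gen_closed) auto

lemma H_rels_closed: "H_rels r n \<xi> \<subseteq> carrier (H_free r n)"
  unfolding H_rels_def Let_def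
  by (auto simp del: Grn_simps intro!: HF.minus_closed HF.m_closed HF.add.m_closed HF.finsum_closed)

lemma H_relI:
  "g \<in> carrier G \<Longrightarrow> h \<in> carrier G \<Longrightarrow>
    H_bar g \<otimes>\<^bsub>H_free r n\<^esub> H_bar h \<ominus>\<^bsub>H_free r n\<^esub> H_bar (g * h) \<in> H_rels r n \<xi>"
  "H_bar (1\<^sub>m n) \<ominus>\<^bsub>H_free r n\<^esub> \<one>\<^bsub>H_free r n\<^esub> \<in> H_rels r n \<xi>"
  "i < n \<Longrightarrow> j < n \<Longrightarrow>
    H_v i \<otimes>\<^bsub>H_free r n\<^esub> H_v j \<ominus>\<^bsub>H_free r n\<^esub> H_v j \<otimes>\<^bsub>H_free r n\<^esub> H_v i \<in> H_rels r n \<xi>"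
  "i < n \<Longrightarrow> k < n \<Longrightarrow> H_bar (xi_mat n \<xi> i) \<otimes>\<^bsub>H_free r n\<^esub> H_v k \<ominus>\<^bsub>H_free r n\<^esub>
    H_v k \<otimes>\<^bsub>H_free r n\<^esub> H_bar (xi_mat n \<xi> i) \<in> H_rels r n \<xi>"
  "Suc i < n \<Longrightarrow> k < n \<Longrightarrow> k \<noteq> i \<Longrightarrow> k \<noteq> Suc i \<Longrightarrow> H_bar (simple_refl n i) \<otimes>\<^bsub>H_free r n\<^esub> H_v k \<ominus>\<^bsub>H_free r n\<^esub>
    H_v k \<otimes>\<^bsub>H_free r n\<^esub> H_bar (simple_refl n i) \<in> H_rels r n \<xi>"
  unfolding H_rels_def Let_def Grn_simps by blast+

abbreviation H_proj where "H_proj x \<equiv> Idl\<^bsub>H_free r n\<^esub> (H_rels r n \<xi>) +>\<^bsub>H_free r n\<^esub> x"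

sublocale HI: algebra_ideal "H_free r n" "Idl\<^bsub>H_free r n\<^esub> (H_rels r n \<xi>)"
  by (rule HF.algebra_ideal_genideal[OF H_rels_closed])

lemma complex_algebra_H: "complex_algebra (H_star r n \<xi>)"
  unfolding H_star_def by (rule HI.complex_algebra_quot)

lemma H_proj_hom: "alg_hom_pair (H_free r n) (H_star r n \<xi>) H_proj"
  using HI.proj_hom complex_algebra_H complex_algebra_H_free
  by (simp add: alg_hom_pair_def alg_hom_pair_axioms_def H_star_def)

lemma H_proj_diff_eq:
  assumes "x \<ominus>\<^bsub>H_free r n\<^esub> y \<in> H_rels r n \<xi>" "x \<in> carrier (H_free r n)" "y \<in> carrier (H_free r n)"
  shows "H_proj x = H_proj y"
proof -
  interpret H: complex_algebra "H_star r n \<xi>" by (rule complex_algebra_H)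
  interpret p: alg_hom_pair "H_free r n" "H_star r n \<xi>" H_proj by (rule H_proj_hom)
  have "H_proj (x \<ominus>\<^bsub>H_free r n\<^esub> y) = \<zero>\<^bsub>H_star r n \<xi>\<^esub>"
    unfolding H_star_def by (rule HF.proj_rel[OF H_rels_closed assms(1)])
  thus ?thesis using assms p.diff[OF assms(2,3)] H.diff_eq_zero_iff by simp
qed

lemma hecke_rep_H: "hecke_rep (H_star r n \<xi>) r n (\<lambda>g. H_proj (H_bar g)) a"
proof -
  interpret H: complex_algebra "H_star r n \<xi>" by (rule complex_algebra_H)
  interpret p: alg_hom_pair "H_free r n" "H_star r n \<xi>" H_proj by (rule H_proj_hom)
  have "H_proj (H_bar (1\<^sub>m n)) = H_proj \<one>\<^bsub>H_free r n\<^esub>"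
    by (rule H_proj_diff_eq[OF H_relI(2)]) simp_all
  moreover have "H_proj (H_bar (g * h)) = H_proj (H_bar g \<otimes>\<^bsub>H_free r n\<^esub> H_bar h)"
    if "g \<in> carrier G" "h \<in> carrier G" for g h
    by (rule H_proj_diff_eq[OF H_relI(1), symmetric]) (use that in simp_all)
  ultimately show ?thesis
    by unfold_locales (auto simp: p.one p.mult)
qed

lemma H_module_H:
  "hecke_rep.H_module (H_star r n \<xi>) r n (\<lambda>g. H_proj (H_bar g)) \<xi> (\<lambda>i. H_proj (H_v i))"
proof -
  interpret H: hecke_rep "H_star r n \<xi>" r n "\<lambda>g. H_proj (H_bar g)" a by (rule hecke_rep_H)
  interpret p: alg_hom_pair "H_free r n" "H_star r n \<xi>" H_proj by (rule H_proj_hom)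
  let ?F = "H_free r n" and ?x = "xi_mat n \<xi>" and ?s = "simple_refl n"
  have 1: "H_proj (H_v i \<otimes>\<^bsub>?F\<^esub> H_v j) = H_proj (H_v j \<otimes>\<^bsub>?F\<^esub> H_v i)" if "i < n" "j < n" for i j
    by (rule H_proj_diff_eq[OF H_relI(3)]) (use that in simp_all)
  have 2: "H_proj (H_bar (?x i) \<otimes>\<^bsub>?F\<^esub> H_v k) = H_proj (H_v k \<otimes>\<^bsub>?F\<^esub> H_bar (?x i))"
    if "i < n" "k < n" for i k
    by (rule H_proj_diff_eq[OF H_relI(4)]) (use that in simp_all)
  have 3: "H_proj (H_bar (?s i) \<otimes>\<^bsub>?F\<^esub> H_v k) = H_proj (H_v k \<otimes>\<^bsub>?F\<^esub> H_bar (?s i))"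
    if "Suc i < n" "k < n" "k \<noteq> i" "k \<noteq> Suc i" for i k
    by (rule H_proj_diff_eq[OF H_relI(5)]) (use that in simp_all)
  have 4: "H_proj (H_bar (?s i) \<otimes>\<^bsub>?F\<^esub> H_v (Suc i)) = H_proj (H_v i) \<otimes>\<^bsub>H_star r n \<xi>\<^esub> H_proj (H_bar (?s i)) \<oplus>\<^bsub>H_star r n \<xi>\<^esub>
      (\<Oplus>\<^bsub>H_star r n \<xi>\<^esub>b\<in>{..<r}. (H_proj (H_bar (?x i)) [^]\<^bsub>H_star r n \<xi>\<^esub> b) \<otimes>\<^bsub>H_star r n \<xi>\<^esub>
        (H_proj (H_bar (inv\<^bsub>G\<^esub> (?x (Suc i)))) [^]\<^bsub>H_star r n \<xi>\<^esub> b))" if i: "Suc i < n" for i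
  proof -
    let ?t = "\<lambda>b. (H_bar (?x i) [^]\<^bsub>?F\<^esub> b) \<otimes>\<^bsub>?F\<^esub> (H_bar (inv\<^bsub>G\<^esub> (?x (Suc i))) [^]\<^bsub>?F\<^esub> b)"
    have t: "?t b \<in> carrier ?F" for b :: nat by simp
    have y: "H_v i \<otimes>\<^bsub>?F\<^esub> H_bar (?s i) \<in> carrier ?F" "(\<Oplus>\<^bsub>?F\<^esub>b\<in>{..<r}. ?t b) \<in> carrier ?F"
      using i t by (auto intro!: HF.finsum_closed)
    have "H_proj (H_bar (?s i) \<otimes>\<^bsub>?F\<^esub> H_v (Suc i)) =
        H_proj (H_v i \<otimes>\<^bsub>?F\<^esub> H_bar (?s i) \<oplus>\<^bsub>?F\<^esub> (\<Oplus>\<^bsub>?F\<^esub>b\<in>{..<r}. ?t b))"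
    proof (rule H_proj_diff_eq)
      show "H_bar (?s i) \<otimes>\<^bsub>?F\<^esub> H_v (Suc i) \<ominus>\<^bsub>?F\<^esub>
          (H_v i \<otimes>\<^bsub>?F\<^esub> H_bar (?s i) \<oplus>\<^bsub>?F\<^esub> (\<Oplus>\<^bsub>?F\<^esub>b\<in>{..<r}. ?t b)) \<in> H_rels r n \<xi>"
        unfolding H_rels_def Let_def using i by blast
    qed (use i y in auto)
    also have "\<dots> = H_proj (H_v i) \<otimes>\<^bsub>H_star r n \<xi>\<^esub> H_proj (H_bar (?s i)) \<oplus>\<^bsub>H_star r n \<xi>\<^esub>
        H_proj (\<Oplus>\<^bsub>?F\<^esub>b\<in>{..<r}. ?t b)"
      using i y by (simp add: p.add p.mult)
    also have "H_proj (\<Oplus>\<^bsub>?F\<^esub>b\<in>{..<r}. ?t b) = (\<Oplus>\<^bsub>H_star r n \<xi>\<^esub>b\<in>{..<r}. H_proj (?t b))"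
      using t by (intro p.finsum) auto
    also have "\<dots> = (\<Oplus>\<^bsub>H_star r n \<xi>\<^esub>b\<in>{..<r}. (H_proj (H_bar (?x i)) [^]\<^bsub>H_star r n \<xi>\<^esub> b) \<otimes>\<^bsub>H_star r n \<xi>\<^esub>
        (H_proj (H_bar (inv\<^bsub>G\<^esub> (?x (Suc i)))) [^]\<^bsub>H_star r n \<xi>\<^esub> b))"
      by (simp add: p.mult p.nat_pow)
    finally show ?thesis .
  qed
  show ?thesis
    unfolding H.H_module_def using 1 2 3 4 by (auto simp flip: p.mult)
qed

lemmas H_free_eqI =
  alg_hom_free_eqI[where S = "VGen ` {..<n} \<union> GGen ` carrier (Grn r n)", folded H_free_def]

lemma H_hom_eqI:
  assumes B: "complex_algebra B" and f: "f \<in> alg_hom (H_star r n \<xi>) B" and g: "g \<in> alg_hom (H_star r n \<xi>) B"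
    and v: "\<And>i. i < n \<Longrightarrow> f (H_proj (H_v i)) = g (H_proj (H_v i))"
    and G: "\<And>x. x \<in> carrier G \<Longrightarrow> f (H_proj (H_bar x)) = g (H_proj (H_bar x))"
    and X: "X \<in> carrier (H_star r n \<xi>)"
  shows "f X = g X"
proof -
  interpret p: alg_hom_pair "H_free r n" "H_star r n \<xi>" H_proj by (rule H_proj_hom)
  obtain F where F: "F \<in> carrier (H_free r n)" "X = H_proj F"
    using X unfolding H_star_def HI.carrier_quot by blast
  have "f (H_proj F) = g (H_proj F)"
  proof (rule H_free_eqI[OF B alg_hom_comp[OF p.hom f] alg_hom_comp[OF p.hom g] _ F(1)])
    fix x assume "x \<in> VGen ` {..<n} \<union> GGen ` carrier G"
    thus "f (H_proj (free_gen x)) = g (H_proj (free_gen x))" using v G by auto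
  qed
  thus ?thesis using F by simp
qed

end

locale wreath_hecke_rep = hecke_rep R r n T a + wreath_hecke r n a \<xi>
  for R :: "(complex, 'a, 'm) module_scheme" (structure) and r n T a \<xi>
begin

text \<open>The first two families of relations are killed because T is a homomorphism, the other
  four because they are the equations in \<open>H_module\<close>.\<close>

lemma H_lift:
  assumes x: "H_module \<xi> x"
  obtains f where "f \<in> alg_hom (H_star r n \<xi>) R"
    "\<And>i. i < n \<Longrightarrow> f (H_proj (H_v i)) = x i"
    "\<And>g. g \<in> carrier G \<Longrightarrow> f (H_proj (H_bar g)) = T g"
proof -
  let ?S = "VGen ` {..<n} \<union> GGen ` carrier G" and ?F = "H_free r n"
  let ?e = "case_H_gen x T"
  have e: "?e \<in> ?S \<rightarrow> carrier R" using x by (auto simp: H_module_def)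
  interpret h: alg_hom_pair ?F R "free_eval ?e"
    using free_eval_hom[OF e] by unfold_locales (simp add: H_free_def)
  have hv: "free_eval ?e (H_v i) = x i" if "i < n" for i
    using free_eval_gen[OF _ e, of "VGen i"] that by simp
  have hg: "free_eval ?e (H_bar g) = T g" if "g \<in> carrier G" for g
    using free_eval_gen[OF _ e, of "GGen g"] that by simp
  have xc: "x i \<in> carrier R" if "i < n" for i using x that by (simp add: H_module_def)
  have kill: "free_eval ?e y = \<zero>" if y: "y \<in> H_rels r n \<xi>" for y
    using y unfolding H_rels_def Let_def
  proof (elim UnE, goal_cases)
    case 1
    thus ?case by (auto simp: h.diff h.mult hg T_mult diff_eq_zero_iff)
  next
    case 2
    thus ?case by (auto simp: h.diff h.one hg T_one diff_eq_zero_iff)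
  next
    case 6
    then obtain i where i: "Suc i < n" and y: "y = H_bar (simple_refl n i) \<otimes>\<^bsub>?F\<^esub> H_v (Suc i) \<ominus>\<^bsub>?F\<^esub>
        (H_v i \<otimes>\<^bsub>?F\<^esub> H_bar (simple_refl n i) \<oplus>\<^bsub>?F\<^esub>
          (\<Oplus>\<^bsub>?F\<^esub>b\<in>{..<r}. (H_bar (xi_mat n \<xi> i) [^]\<^bsub>?F\<^esub> b) \<otimes>\<^bsub>?F\<^esub>
            (H_bar (inv\<^bsub>G\<^esub> (xi_mat n \<xi> (Suc i))) [^]\<^bsub>?F\<^esub> b)))" by blast
    let ?t = "\<lambda>b. (H_bar (xi_mat n \<xi> i) [^]\<^bsub>?F\<^esub> b) \<otimes>\<^bsub>?F\<^esub> (H_bar (inv\<^bsub>G\<^esub> (xi_mat n \<xi> (Suc i))) [^]\<^bsub>?F\<^esub> b)"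
    have t: "?t b \<in> carrier ?F" for b :: nat by simp
    hence f: "(\<Oplus>\<^bsub>?F\<^esub>b\<in>{..<r}. ?t b) \<in> carrier ?F" by (intro HF.finsum_closed) auto
    have "free_eval ?e (\<Oplus>\<^bsub>?F\<^esub>b\<in>{..<r}. ?t b) = (\<Oplus>b\<in>{..<r}. free_eval ?e (?t b))"
      using t by (intro h.finsum) auto
    also have "\<dots> = (\<Oplus>b\<in>{..<r}. (T (xi_mat n \<xi> i) [^] b) \<otimes> (T (inv\<^bsub>G\<^esub> (xi_mat n \<xi> (Suc i))) [^] b))"
      by (simp add: h.mult h.nat_pow hg)
    finally have "free_eval ?e y = T (simple_refl n i) \<otimes> x (Suc i) \<ominus> (x i \<otimes> T (simple_refl n i) \<oplus>
        (\<Oplus>b\<in>{..<r}. (T (xi_mat n \<xi> i) [^] b) \<otimes> (T (inv\<^bsub>G\<^esub> (xi_mat n \<xi> (Suc i))) [^] b)))"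
      unfolding y using i f by (simp add: h.diff h.add h.mult hv hg)
    moreover have "T (simple_refl n i) \<otimes> x (Suc i) = x i \<otimes> T (simple_refl n i) \<oplus>
        (\<Oplus>b\<in>{..<r}. (T (xi_mat n \<xi> i) [^] b) \<otimes> (T (inv\<^bsub>G\<^esub> (xi_mat n \<xi> (Suc i))) [^] b))"
      using x i by (simp add: H_module_def)
    moreover have "T (simple_refl n i) \<otimes> x (Suc i) \<in> carrier R" using xc i by simp
    ultimately show ?case by (metis a_minus_def r_neg)
  qed (use x in \<open>auto simp: h.diff h.mult hv hg xc diff_eq_zero_iff H_module_def\<close>)
  obtain k where k: "k \<in> alg_hom (H_star r n \<xi>) R"
    "\<And>y. y \<in> carrier ?F \<Longrightarrow> k (H_proj y) = free_eval ?e y"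
    using HF.quot_lift[OF complex_algebra_axioms h.hom H_rels_closed kill]
    unfolding H_star_def by metis
  show ?thesis
    by (rule that[OF k(1)]) (simp_all add: k(2) hv hg)
qed

end

text \<open>The element M is a fixed linear combination of images of group elements, so a
  homomorphism compatible with the two images of the group preserves it.\<close>

lemma M_hom:
  assumes A: "Grn_rep A r n T" and B: "Grn_rep B r n U" and f: "f \<in> alg_hom A B"
    and fT: "\<And>g. g \<in> carrier (Grn r n) \<Longrightarrow> f (T g) = U g"
  shows "f (Grn_rep.M A r n T i) = Grn_rep.M B r n U i"
proof -
  interpret A: Grn_rep A r n T by (rule A)
  interpret B: Grn_rep B r n U by (rule B)
  interpret f: alg_hom_pair A B f using f by unfold_locales
  have "f (A.S i j) = B.S i j" for i j
  proof -
    have "f (A.S i j) = (\<Oplus>\<^bsub>B\<^esub>g\<in>A.refls i j. f (T g))"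
      unfolding A.S_def by (rule f.finsum) (auto intro: A.T_closed A.refls_Grn)
    also have "\<dots> = B.S i j"
      unfolding B.S_def using fT A.refls_Grn by (intro B.finsum_cong') auto
    finally show ?thesis .
  qed
  moreover have "f (A.M i) = (\<Oplus>\<^bsub>B\<^esub>l\<in>{..<n}. f (A.eps i l \<odot>\<^bsub>A\<^esub> A.S i l))"
    unfolding A.M_def by (rule f.finsum) auto
  ultimately show ?thesis by (simp add: B.M_def f.smult)
qed

section \<open>The two mutually inverse homomorphisms\<close>

theorem theorem9p8:
  fixes r n :: nat and \<xi> :: complex
    and a :: "complex mat \<Rightarrow> complex vec \<Rightarrow> complex vec \<Rightarrow> complex"
  assumes "r \<ge> 1" and "n \<ge> 3"
    and "primitive_root_of_unity r \<xi>"
    and "hecke_forms r n a"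
  shows "\<exists>\<phi>. \<phi> \<in> algebra_iso (A_algebra r n a) (H_star r n \<xi>)"
proof -
  interpret W: wreath_hecke r n a \<xi> using assms by unfold_locales
  let ?A = "A_algebra r n a" and ?H = "H_star r n \<xi>"
  let ?TA = "\<lambda>g. W.A_proj (A_bar n g)" and ?TH = "\<lambda>g. W.H_proj (H_bar g)"
  let ?vA = "\<lambda>i. W.A_proj (A_vec n (unit_vec n i))" and ?vH = "\<lambda>i. W.H_proj (H_v i)"
  interpret hA: hecke_rep ?A r n ?TA a by (rule W.hecke_rep_A)
  interpret hH: hecke_rep ?H r n ?TH a by (rule W.hecke_rep_H)
  interpret A: wreath_hecke_rep ?A r n ?TA a \<xi> by unfold_locales
  \<comment> \<open>The generators of \<open>H_star\<close>, shifted by M and rescaled, satisfy the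
    relations of A inside \<open>H_star\<close>; so A maps there.\<close>
  have "\<exists>f. f \<in> alg_hom ?A ?H \<and> (\<forall>i<n. f (?vA i) = inverse scale \<odot>\<^bsub>?H\<^esub> (?vH i \<oplus>\<^bsub>?H\<^esub> hH.M i)) \<and>
      (\<forall>g\<in>carrier (Grn r n). f (?TA g) = ?TH g)"
    by (rule hH.A_lift[OF hH.A_module_of_H_module[OF assms(3) W.H_module_H]]) blast
  then obtain f where f: "f \<in> alg_hom ?A ?H"
    "\<And>i. i < n \<Longrightarrow> f (?vA i) = inverse scale \<odot>\<^bsub>?H\<^esub> (?vH i \<oplus>\<^bsub>?H\<^esub> hH.M i)"
    "\<And>g. g \<in> carrier (Grn r n) \<Longrightarrow> f (?TA g) = ?TH g" by blast
  have "\<exists>h. h \<in> alg_hom ?H ?A \<and> (\<forall>i<n. h (?vH i) = scale \<odot>\<^bsub>?A\<^esub> ?vA i \<ominus>\<^bsub>?A\<^esub> hA.M i) \<and>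
      (\<forall>g\<in>carrier (Grn r n). h (?TH g) = ?TA g)"
    by (rule A.H_lift[OF hA.H_module_of_A_module[OF assms(3) W.A_module_A]]) blast
  then obtain h where h: "h \<in> alg_hom ?H ?A"
    "\<And>i. i < n \<Longrightarrow> h (?vH i) = scale \<odot>\<^bsub>?A\<^esub> ?vA i \<ominus>\<^bsub>?A\<^esub> hA.M i"
    "\<And>g. g \<in> carrier (Grn r n) \<Longrightarrow> h (?TH g) = ?TA g" by blast
  interpret f: alg_hom_pair ?A ?H f using f(1) by unfold_locales
  interpret h: alg_hom_pair ?H ?A h using h(1) by unfold_locales
  have fM: "f (hA.M i) = hH.M i" for i
    by (rule M_hom[OF hA.Grn_rep_axioms hH.Grn_rep_axioms f(1,3)])
  have hM: "h (hH.M i) = hA.M i" for i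
    by (rule M_hom[OF hH.Grn_rep_axioms hA.Grn_rep_axioms h(1,3)])
  have vAc: "?vA i \<in> carrier ?A" if "i < n" for i
    using W.A_module_A that by (simp add: hA.A_module_def hA.equivariant_def)
  have vHc: "?vH i \<in> carrier ?H" if "i < n" for i
    using W.H_module_H that by (simp add: hH.H_module_def)
  \<comment> \<open>By uniqueness it suffices to compare with the identity on generators. Since both
    maps preserve M, the shifts cancel there, and so do the scale factors.\<close>
  have hf: "h (f X) = X" if "X \<in> carrier ?A" for X
  proof (rule W.A_hom_eqI[OF W.complex_algebra_A alg_hom_comp[OF f(1) h(1)] _ _ _ that])
    show "(\<lambda>X. X) \<in> alg_hom ?A ?A" by (rule alg_homI) auto
    fix i assume i: "i < n"
    have "h (f (?vA i)) = inverse scale \<odot>\<^bsub>?A\<^esub> ((scale \<odot>\<^bsub>?A\<^esub> ?vA i \<ominus>\<^bsub>?A\<^esub> hA.M i) \<oplus>\<^bsub>?A\<^esub> hA.M i)"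
      using i vHc[OF i] by (simp add: f(2) h.smult h.add h(2) hM)
    also have "\<dots> = ?vA i"
      using vAc[OF i] scale_square(3)
      by (simp add: a_minus_def hA.a_assoc hA.l_neg hA.smult_smult)
    finally show "h (f (?vA i)) = ?vA i" .
  qed (simp_all add: f(3) h(3))
  have fh: "f (h Y) = Y" if "Y \<in> carrier ?H" for Y
  proof (rule W.H_hom_eqI[OF W.complex_algebra_H alg_hom_comp[OF h(1) f(1)] _ _ _ that])
    show "(\<lambda>Y. Y) \<in> alg_hom ?H ?H" by (rule alg_homI) auto
    fix i assume i: "i < n"
    have "f (h (?vH i)) = scale \<odot>\<^bsub>?H\<^esub> (inverse scale \<odot>\<^bsub>?H\<^esub> (?vH i \<oplus>\<^bsub>?H\<^esub> hH.M i)) \<ominus>\<^bsub>?H\<^esub> hH.M i"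
      using i vAc[OF i] by (simp add: h(2) f.smult f.diff f(2) fM)
    also have "\<dots> = ?vH i"
      using vHc[OF i] scale_square(3)
      by (simp add: a_minus_def hH.a_assoc hH.r_neg hH.smult_smult)
    finally show "f (h (?vH i)) = ?vH i" .
  qed (simp_all add: f(3) h(3))
  show ?thesis using algebra_isoI[OF f(1) h(1) hf fh] by blast
qed

end
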